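(* Let $\hat g_1,\dots,\hat g_m$ be linearly independent traceless Hermitian $N\times N$ matrices, let $f_1,\dots,f_m:\mathbb R^r\to\mathbb R$ ($r\le m$) and $q:\mathbb R^r\to\mathbb R$ be twice continuously differentiable, and put $\hat H_0(\boldsymbol\theta)=\sum_{j=1}^m f_j(\boldsymbol\theta)\hat g_j$. Fix $\boldsymbol\theta_0\in\mathbb R^r$ such that $\nabla q(\boldsymbol\theta_0)\neq 0$ and the Jacobian matrix $F\in\mathbb R^{r\times m}$, $F_{ij}=\partial f_j/\partial\theta_i(\boldsymbol\theta_0)$, has rank $r$. Let $\hat h_i=(F\hat{\boldsymbol g})_i=\sum_{j=1}^m F_{ij}\hat g_j$ for $i=1,\dots,r$. Consider any estimation protocol of total evolution time $t>0$ for $\hat H_0(\boldsymbol\theta)$, and any real estimator $q_{\rm est}$ of $q$ based on its measurement outcome that is locally unbiased at $\boldsymbol\theta_0$. Then the variance of $q_{\rm est}$ at $\boldsymbol\theta_0$ satisfies $$\mathrm{Var}(q_{\rm est})\;\ge\;\frac{\gamma^2(F\hat{\boldsymbol g}\mid\nabla q(\boldsymbol\theta_0))}{t^2},$$ where $$\gamma(\hat{\boldsymbol h}\mid\boldsymbol\alpha)=\min\Big\{\tfrac12\|\hat A\|_1:\ \hat A=\hat A^\dagger\in\mathbb C^{N\times N},\ \mathrm{Tr}(\hat A\hat h_i)=\alpha_i\ (i=1,\dots,r),\ \mathrm{Tr}(\hat A)=0\Big\}.$$ In particular, if $r=m$, $f_j(\boldsymbol\theta)=\theta_j$ and $q(\boldsymbol\theta)=\boldsymbol\alpha\cdot\boldsymbol\theta$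 with $\boldsymbol\alpha\ne 0$, then $\mathrm{Var}(q_{\rm est})\ge\gamma^2(\hat{\boldsymbol g}\mid\boldsymbol\alpha)/t^2$.
   Context: $\|\hat A\|_1=\mathrm{Tr}\sqrt{\hat A^\dagger\hat A}$ is the trace norm. Estimation protocol of total evolution time $t$: choose a finite-dimensional ancilla space $\mathbb C^d$ and a $\boldsymbol\theta$-independent density matrix $\rho_0$ on $\mathbb C^N\otimes\mathbb C^d$. Let the state evolve for time $t$ by the Schrödinger equation ($\hbar=1$) with Hamiltonian $\hat H(s)=\hat H_0(\boldsymbol\theta)\otimes\hat I+\hat H_c(s)$, $s\in[0,t]$, where $\hat H_c(s)$ is an arbitrary $\boldsymbol\theta$-independent piecewise continuous Hermitian control Hamiltonian on $\mathbb C^N\otimes\mathbb C^d$; finitely many instantaneous $\boldsymbol\theta$-independent unitary pulses are also allowed. This gives the state $\rho_{\boldsymbol\theta}$. Finally perform an arbitrary $\boldsymbol\theta$-independent measurement (POVM $M$). Estimator: a real-valued measurable function $q_{\rm est}$ of the measurement outcome $\omega$, assumed to have finite variance at $\boldsymbol\theta_0$. It is locally unbiased at $\boldsymbol\theta_0$ if $\int q_{\rm est}(\omega)\,\mathrm{Tr}(\rho_{\boldsymbol\theta_0}M(d\omega))=q(\boldsymbol\theta_0)$ and $\int q_{\rm est}(\omega)\,\mathrm{Tr}\big((\partial_{\theta_i}\rho_{\boldsymbol\theta})|_{\boldsymbol\theta_0}M(d\omega)\big)=\partial_{\theta_i}q(\boldsymbol\theta_0)$ for all $i=1,\dots,r$.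 *)

theory Defs
  imports "HOL-Probability.Probability"
begin

section \<open>Complex matrices\<close>

definition dagger :: "complex^'n^'m \<Rightarrow> complex^'m^'n" where
  "dagger A = (\<chi> i j. cnj (A $ j $ i))"

definition hermitian :: "complex^'n^'n \<Rightarrow> bool" where
  "hermitian A \<longleftrightarrow> dagger A = A"

definition unitary_mat :: "complex^'n^'n \<Rightarrow> bool" where
  "unitary_mat U \<longleftrightarrow> dagger U ** U = mat 1 \<and> U ** dagger U = mat 1"

definition psd :: "complex^'n^'n \<Rightarrow> bool" where
  "psd A \<longleftrightarrow> hermitian A \<and> (\<forall>v. 0 \<le> Re (\<Sum>i\<in>UNIV. cnj (v $ i) * (A *v v) $ i))"

definition density_matrix :: "complex^'n^'n \<Rightarrow> bool" where
  "density_matrix \<rho> \<longleftrightarrow> psd \<rho> \<and> trace \<rho> = 1"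

definition psd_sqrt :: "complex^'n^'n \<Rightarrow> complex^'n^'n" where
  "psd_sqrt A = (THE B. psd B \<and> B ** B = A)"

definition trace_norm :: "complex^'n^'n \<Rightarrow> real" where
  "trace_norm A = Re (trace (psd_sqrt (dagger A ** A)))"

text \<open>The tensor product of \<open>\<complex>\<^sup>N\<close> and \<open>\<complex>\<^sup>d\<close> is the space of vectors indexed by pairs.\<close>

definition tensor_mat ::
    "complex^'n^'n \<Rightarrow> complex^'d^'d \<Rightarrow> complex^('n \<times> 'd)^('n \<times> 'd)" where
  "tensor_mat A B = (\<chi> p q. A $ fst p $ fst q * B $ snd p $ snd q)"

text \<open>The minimum is taken literally: \<open>LEAST\<close> specifies a value only if the minimum is attained.\<close>

definition gamma :: "('r \<Rightarrow> complex^'n^'n) \<Rightarrow> real^'r \<Rightarrow> real" where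
  "gamma h \<alpha> = (LEAST x. \<exists>A. x = trace_norm A / 2 \<and> hermitian A \<and>
     (\<forall>i. trace (A ** h i) = complex_of_real (\<alpha> $ i)) \<and> trace A = 0)"


section \<open>Differential calculus on parameter space\<close>

definition partial_deriv :: "'r \<Rightarrow> (real^'r \<Rightarrow> 'b::real_normed_vector) \<Rightarrow> real^'r \<Rightarrow> 'b" where
  "partial_deriv i f x = vector_derivative (\<lambda>s. f (x + s *\<^sub>R axis i 1)) (at 0)"

definition gradient :: "(real^'r \<Rightarrow> real) \<Rightarrow> real^'r \<Rightarrow> real^'r" where
  "gradient q x = (\<chi> i. partial_deriv i q x)"

text \<open>Rows are indexed by the parameters, columns by the functions.\<close>

definition jacobian_mat :: "('m \<Rightarrow> real^'r \<Rightarrow> real) \<Rightarrow> real^'r \<Rightarrow> real^'m^'r" where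
  "jacobian_mat f x = (\<chi> i j. partial_deriv i (f j) x)"

definition twice_continuously_differentiable :: "(real^'r \<Rightarrow> real) \<Rightarrow> bool" where
  "twice_continuously_differentiable f \<longleftrightarrow>
     (\<exists>(f' :: real^'r \<Rightarrow> ((real^'r) \<Rightarrow>\<^sub>L real)) (f'' :: real^'r \<Rightarrow> ((real^'r) \<Rightarrow>\<^sub>L ((real^'r) \<Rightarrow>\<^sub>L real))).
        (\<forall>x. (f has_derivative blinfun_apply (f' x)) (at x)) \<and>
        (\<forall>x. (f' has_derivative blinfun_apply (f'' x)) (at x)) \<and>
        continuous_on UNIV f'')"


section \<open>Controlled evolution\<close>

definition piecewise_continuous :: "real \<Rightarrow> (real \<Rightarrow> 'b::topological_space) \<Rightarrow> bool" where
  "piecewise_continuous t f \<longleftrightarrow>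
     (\<exists>D. finite D \<and> (\<forall>s\<in>{0<..<t} - D. isCont f s)) \<and>
     (\<forall>s\<in>{0..<t}. \<exists>l. (f \<longlongrightarrow> l) (at_right s)) \<and>
     (\<forall>s\<in>{0<..t}. \<exists>l. (f \<longlongrightarrow> l) (at_left s))"

text \<open>\<open>V s\<close> is the instantaneous unitary pulse applied at time \<open>s\<close>, with \<open>V s = mat 1\<close>
  when there is none (several pulses at the same instant are multiplied together).
  \<open>U s\<close> is the propagator from the initial time to the instant just after the pulse at \<open>s\<close>,
  so \<open>U\<close> is right continuous and is \<open>V s\<close> times its left limit at \<open>s\<close>. Away from the pulses
  and the discontinuities of \<open>H\<close> it satisfies \<open>U' = - \<i> H U\<close>; \<open>mat (-\<i>)\<close> is
  \<open>-\<i>\<close> times the identity matrix.\<close>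

definition propagator ::
    "real \<Rightarrow> (real \<Rightarrow> complex^'n^'n) \<Rightarrow> (real \<Rightarrow> complex^'n^'n) \<Rightarrow> (real \<Rightarrow> complex^'n^'n) \<Rightarrow> bool"
  where
  "propagator t H V U \<longleftrightarrow>
     U 0 = V 0 \<and>
     (\<forall>s\<in>{0<..<t}. V s = mat 1 \<and> isCont H s \<longrightarrow>
        (U has_vector_derivative (mat (-\<i>) ** H s ** U s)) (at s)) \<and>
     (\<forall>s\<in>{0..<t}. (U \<longlongrightarrow> U s) (at_right s)) \<and>
     (\<forall>s\<in>{0<..t}. ((\<lambda>x. V s ** U x) \<longlongrightarrow> U s) (at_left s))"


section \<open>Measurement\<close>

text \<open>Only \<open>space \<Omega>\<close> and \<open>sets \<Omega>\<close> of the outcome space are used.\<close>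

definition povm :: "'w measure \<Rightarrow> ('w set \<Rightarrow> complex^'n^'n) \<Rightarrow> bool" where
  "povm \<Omega> M \<longleftrightarrow>
     (\<forall>E\<in>sets \<Omega>. psd (M E)) \<and> M (space \<Omega>) = mat 1 \<and>
     (\<forall>E. range E \<subseteq> sets \<Omega> \<and> disjoint_family E \<longrightarrow> (\<lambda>k::nat. M (E k)) sums M (\<Union>k. E k))"

definition outcome_dist ::
    "'w measure \<Rightarrow> ('w set \<Rightarrow> complex^'n^'n) \<Rightarrow> complex^'n^'n \<Rightarrow> 'w measure" where
  "outcome_dist \<Omega> M \<rho> =
     measure_of (space \<Omega>) (sets \<Omega>) (\<lambda>E. ennreal (Re (trace (\<rho> ** M E))))"

text \<open>Integration against a finite signed measure \<open>\<nu>\<close> by its Jordan decomposition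
  \<open>\<nu> = \<nu>\<^sup>+ - \<nu>\<^sup>-\<close>, where \<open>\<nu>\<^sup>+(E)\<close> is the supremum of \<open>\<nu>(B)\<close> over measurable \<open>B \<subseteq> E\<close>
  and \<open>\<nu>\<^sup>-\<close> is the positive variation of \<open>-\<nu>\<close>; \<open>ennreal\<close> sends negative
  reals to 0, which does not change the supremum since \<open>B\<close> may be empty.\<close>

definition pos_variation :: "'w measure \<Rightarrow> ('w set \<Rightarrow> real) \<Rightarrow> 'w measure" where
  "pos_variation \<Omega> \<nu> =
     measure_of (space \<Omega>) (sets \<Omega>) (\<lambda>E. SUP B\<in>{B \<in> sets \<Omega>. B \<subseteq> E}. ennreal (\<nu> B))"

definition signed_integral :: "'w measure \<Rightarrow> ('w set \<Rightarrow> real) \<Rightarrow> ('w \<Rightarrow> real) \<Rightarrow> real" where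
  "signed_integral \<Omega> \<nu> u =
     integral\<^sup>L (pos_variation \<Omega> \<nu>) u - integral\<^sup>L (pos_variation \<Omega> (\<lambda>E. - \<nu> E)) u"


section \<open>Estimation\<close>

text \<open>\<open>\<rho>\<close> is the family of final states and \<open>M\<close> the measurement of a protocol of total
  evolution time \<open>t\<close>. The initial state, the control, the pulses and \<open>M\<close> are
  chosen before, hence independently of, the parameter \<open>\<theta>\<close>.\<close>

definition estimation_protocol ::
    "real \<Rightarrow> (real^'r \<Rightarrow> complex^'n^'n) \<Rightarrow> (real^'r \<Rightarrow> complex^('n::finite \<times> 'd::finite)^('n \<times> 'd)) \<Rightarrow>
     'w measure \<Rightarrow> ('w set \<Rightarrow> complex^('n::finite \<times> 'd::finite)^('n \<times> 'd)) \<Rightarrow> bool" where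
  "estimation_protocol t H0 \<rho> \<Omega> M \<longleftrightarrow>
     povm \<Omega> M \<and>
     (\<exists>\<rho>0 Hc V.
        density_matrix \<rho>0 \<and>
        (\<forall>s\<in>{0..t}. hermitian (Hc s)) \<and> piecewise_continuous t Hc \<and>
        (\<forall>s\<in>{0..t}. unitary_mat (V s)) \<and> finite {s \<in> {0..t}. V s \<noteq> mat 1} \<and>
        (\<forall>\<theta>. \<exists>U. propagator t (\<lambda>s. tensor_mat (H0 \<theta>) (mat 1) + Hc s) V U \<and>
                 \<rho> \<theta> = U t ** \<rho>0 ** dagger (U t)))"

definition estimator_variance :: "'w measure \<Rightarrow> ('w \<Rightarrow> real) \<Rightarrow> real" where
  "estimator_variance P u = integral\<^sup>L P (\<lambda>\<omega>. (u \<omega> - integral\<^sup>L P u)\<^sup>2)"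

definition has_finite_variance :: "'w measure \<Rightarrow> ('w \<Rightarrow> real) \<Rightarrow> bool" where
  "has_finite_variance P u \<longleftrightarrow>
     integrable P u \<and> integrable P (\<lambda>\<omega>. (u \<omega> - integral\<^sup>L P u)\<^sup>2)"

text \<open>For a protocol and an estimator with finite variance at \<open>\<theta>0\<close> all the integrals
  below converge absolutely.\<close>

definition locally_unbiased ::
    "'w measure \<Rightarrow> ('w set \<Rightarrow> complex^'n^'n) \<Rightarrow> (real^'r \<Rightarrow> complex^'n^'n) \<Rightarrow>
     ('w \<Rightarrow> real) \<Rightarrow> (real^'r \<Rightarrow> real) \<Rightarrow> real^'r \<Rightarrow> bool" where
  "locally_unbiased \<Omega> M \<rho> qest q \<theta>0 \<longleftrightarrow>
     integral\<^sup>L (outcome_dist \<Omega> M (\<rho> \<theta>0)) qest = q \<theta>0 \<and>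
     (\<forall>i. signed_integral \<Omega> (\<lambda>E. Re (trace (partial_deriv i \<rho> \<theta>0 ** M E))) qest
            = partial_deriv i q \<theta>0)"

definition admissible_estimator ::
    "'w measure \<Rightarrow> ('w set \<Rightarrow> complex^'n^'n) \<Rightarrow> (real^'r \<Rightarrow> complex^'n^'n) \<Rightarrow>
     ('w \<Rightarrow> real) \<Rightarrow> (real^'r \<Rightarrow> real) \<Rightarrow> real^'r \<Rightarrow> bool" where
  "admissible_estimator \<Omega> M \<rho> qest q \<theta>0 \<longleftrightarrow>
     qest \<in> borel_measurable \<Omega> \<and>
     has_finite_variance (outcome_dist \<Omega> M (\<rho> \<theta>0)) qest \<and>
     locally_unbiased \<Omega> M \<rho> qest q \<theta>0"

end

(*
The Heisenberg-picture perturbation of the final state by theta_i is -i[G_i, rho], where G_i is the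
time integral of the generator h_i transported along the controlled evolution. Pairing it with a
Hermitian observable X and moving the transport onto the commutator gives Tr(A h_i), where A is the
partial trace over the ancilla of the time integral of the transported commutator -i[rho, X]. This A
is Hermitian and traceless, and since unitary conjugation and partial trace do not increase the trace
norm, |A|_1 <= t |[rho, X]|_1 <= 2 t sqrt(Tr(rho X^2)). If X is the operator-valued integral of a
simple function u against the POVM, then Tr(rho X^2) is at most the second moment of u.

The centred estimator need not be integrable against the POVM itself, only against the measures that
it induces, so it is approximated by simple functions; the corresponding operators A stay bounded and
a subsequence converges to a feasible point of the minimum that defines gamma. The same compactness
shows that this minimum is attained, so that LEAST denotes it. Throughout, the trace norm is used in
its dual form, as the maximum of Re Tr(W A) over contractions W.
*)
theory Submission
  imports Defs
begin

section \<open>Matrix algebra\<close>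

text \<open>The control is arbitrary, so the proof never analyses a propagator alone, only the
  product of the adjoint propagator at \<open>\<theta>0\<close> with a perturbed one. Pulses and
  control Hamiltonian cancel in it: it is continuous across pulses, and its derivative contains only
  the change of \<open>H0\<close>.

  A second moment under the outcome distribution does not by itself give integrability against the
  two Jordan parts of a derivative measure. The estimate by a multiple of sqrt(Tr(\<rho> X^2)) is
  therefore used twice: with a crude constant for each i, to get this integrability, and in sharp
  form for a single \<open>A\<close> serving all i together, to get the bound. The 2 in the sharp
  form comes from the two terms of the commutator and meets the 1/2 in \<open>gamma\<close>; the t
  is the length of the time interval.

  The dual form of the trace norm suits this because Re Tr(W A) is linear and continuous in A: it
  passes through the time integral and through limits, while conjugation and partial trace are moved
  onto W.\<close>

lemma dagger_nth [simp]: "dagger A $ i $ j = cnj (A $ j $ i)"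
  by (simp add: dagger_def)

lemma dagger_dagger [simp]: "dagger (dagger A) = A"
  by (simp add: vec_eq_iff)

lemma dagger_mult: "dagger (A ** B) = dagger B ** dagger A"
  by (simp add: vec_eq_iff matrix_matrix_mult_def mult.commute)

lemma dagger_add: "dagger (A + B) = dagger A + dagger B"
  and dagger_diff: "dagger (A - B) = dagger A - dagger B"
  and dagger_minus: "dagger (- A) = - dagger A"
  and dagger_scaleR: "dagger (r *\<^sub>R A) = r *\<^sub>R dagger A"
  and dagger_0 [simp]: "dagger 0 = 0"
  by (simp_all add: vec_eq_iff)

lemma dagger_sum: "dagger (sum f S) = (\<Sum>x\<in>S. dagger (f x))"
  by (induction S rule: infinite_finite_induct) (auto simp: dagger_add)

lemma dagger_mat [simp]: "dagger (mat c) = mat (cnj c)"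
  by (simp add: vec_eq_iff mat_def)

text \<open>The adjoint is conjugate-linear over the complex numbers, but real linearity is enough:
  all derivatives, integrals and limits below are taken over the reals.\<close>

lemma bounded_linear_dagger: "bounded_linear (dagger :: complex^'n^'m \<Rightarrow> _)"
  by (simp add: linear_conv_bounded_linear[symmetric] linear_iff dagger_add dagger_scaleR)

lemma trace_dagger: "trace (dagger A) = cnj (trace A)"
  by (simp add: trace_def)

lemma trace_scaleR: "trace (r *\<^sub>R A) = r *\<^sub>R trace A"
  for A :: "complex^'n^'n"
  by (simp add: trace_def scaleR_sum_right)

lemma trace_zero [simp]: "trace (0 :: complex^'n^'n) = 0"
  by (simp add: trace_def)

lemma trace_rotate: "trace (A ** (B ** C)) = trace (C ** (A ** B))"
  for A B C :: "complex^'n^'n"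
  by (simp only: matrix_mul_assoc trace_mul_sym[of "A ** B" C])

lemma trace_sum: "trace (sum f S) = (\<Sum>x\<in>S. trace (f x))"
  for f :: "'a \<Rightarrow> complex^'n^'n"
  by (induction S rule: infinite_finite_induct) (auto simp: trace_add)

lemma bounded_linear_trace: "bounded_linear (trace :: complex^'n^'n \<Rightarrow> complex)"
  by (simp add: linear_conv_bounded_linear[symmetric] linear_iff trace_add trace_scaleR)

lemma matrix_mult_simps:
  fixes A B C :: "complex^'n^'n"
  shows "A ** (B + C) = A ** B + A ** C" "(A + B) ** C = A ** C + B ** C"
    "A ** (B - C) = A ** B - A ** C" "(A - B) ** C = A ** C - B ** C"
    "A ** (- B) = - (A ** B)" "(- A) ** B = - (A ** B)"
    "(r *\<^sub>R A) ** B = r *\<^sub>R (A ** B)" "A ** (r *\<^sub>R B) = r *\<^sub>R (A ** B)"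
  by (simp_all add: vec_eq_iff matrix_matrix_mult_def algebra_simps sum.distrib sum_subtractf
      sum_negf scaleR_sum_right)

lemma matrix_mult_zero [simp]: "A ** 0 = 0" "0 ** A = 0"
  for A :: "complex^'n^'n"
  by (simp_all add: vec_eq_iff matrix_matrix_mult_def)

lemma bounded_bilinear_matrix_mult:
  "bounded_bilinear ((**) :: complex^'n^'n \<Rightarrow> complex^'n^'n \<Rightarrow> complex^'n^'n)"
  by (simp add: bilinear_conv_bounded_bilinear[symmetric] bilinear_def linear_iff matrix_mult_simps)

lemmas matrix_mult_sum_right = bounded_bilinear.sum_right[OF bounded_bilinear_matrix_mult]

lemma matrix_vector_mult_scaleR_left: "(r *\<^sub>R A) *v x = r *\<^sub>R (A *v x)"
  for A :: "complex^'n^'m"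
  by (simp add: vec_eq_iff matrix_vector_mult_def scaleR_sum_right)

lemma matrix_vector_mult_scaleR_right: "A *v (r *\<^sub>R x) = r *\<^sub>R (A *v x)"
  for A :: "complex^'n^'m"
  by (simp add: vec_eq_iff matrix_vector_mult_def scaleR_sum_right)

lemma matrix_vector_mult_sum_left: "sum f S *v x = (\<Sum>i\<in>S. f i *v x)"
  for f :: "'a \<Rightarrow> complex^'n^'m"
  by (induction S rule: infinite_finite_induct) (auto simp: matrix_vector_mult_add_rdistrib)

text \<open>Complex scalars are written \<open>mat c\<close>, since \<open>scaleR\<close> covers
  only real ones. This and the following rules carry them through products and traces.\<close>

lemma mat_mult_nth: "(mat c ** A) $ i $ j = c * A $ i $ j" "(A ** mat c) $ i $ j = A $ i $ j * c"
  for A :: "complex^'n^'n"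
  by (simp_all add: matrix_matrix_mult_def mat_def if_distrib if_distribR cong: if_cong)

lemma mat_mult_commute: "A ** mat c = mat c ** A"
  for A :: "complex^'n^'n"
  by (simp add: vec_eq_iff mat_mult_nth)

lemma mat_mult_left_commute: "A ** (mat c ** B) = mat c ** (A ** B)"
  for A B :: "complex^'n^'n"
  by (simp add: matrix_mul_assoc mat_mult_commute)

lemma trace_mat_mult: "trace (mat c ** A) = c * trace A"
  for A :: "complex^'n^'n"
  by (simp add: trace_def mat_mult_nth sum_distrib_left)

lemma mat_minus: "mat (- c) = - (mat c :: complex^'n^'n)"
  by (simp add: vec_eq_iff mat_def)

section \<open>The Hermitian inner product\<close>

text \<open>Conjugate-linear in the first argument. Its real part is the type class product
  \<open>\<bullet>\<close>, which is used wherever the phase does not matter.\<close>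

definition cip :: "complex^'n \<Rightarrow> complex^'n \<Rightarrow> complex" where
  "cip v w = (\<Sum>i\<in>UNIV. cnj (v $ i) * w $ i)"

text \<open>The rank-one operator that Dirac notation writes as ket v times bra w.\<close>

definition outer :: "complex^'n \<Rightarrow> complex^'n \<Rightarrow> complex^'n^'n" where
  "outer v w = (\<chi> i j. v $ i * cnj (w $ j))"

lemma Re_cip: "Re (cip v w) = v \<bullet> w"
  by (simp add: cip_def inner_vec_def inner_complex_def)

lemma cip_add_right: "cip v (w + w') = cip v w + cip v w'"
  and cip_diff_right: "cip v (w - w') = cip v w - cip v w'"
  and cip_scaleR_right: "cip v (r *\<^sub>R w) = r *\<^sub>R cip v w"
  and cip_scale_right: "cip v (c *s w) = c * cip v w"
  and cip_zero_right [simp]: "cip v 0 = 0"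
  by (simp_all add: cip_def algebra_simps sum.distrib sum_subtractf scaleR_sum_right sum_distrib_left)

lemma cip_sum_right: "cip v (sum f S) = (\<Sum>i\<in>S. cip v (f i))"
  by (induction S rule: infinite_finite_induct) (auto simp: cip_add_right)

lemma cip_commute: "cip w v = cnj (cip v w)"
  by (simp add: cip_def mult.commute)

lemma cip_self: "cip v v = complex_of_real ((norm v)\<^sup>2)"
proof -
  have "Im (cip v v) = 0"
    by (simp add: cip_def mult.commute)
  moreover have "Re (cip v v) = (norm v)\<^sup>2"
    by (simp add: Re_cip power2_norm_eq_inner)
  ultimately show ?thesis by (simp add: complex_eq_iff)
qed

lemma cip_mult_left: "cip (A *v v) w = cip v (dagger A *v w)"
proof -
  have "cip (A *v v) w = (\<Sum>i\<in>UNIV. \<Sum>j\<in>UNIV. cnj (A $ i $ j) * cnj (v $ j) * w $ i)"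
    by (simp add: cip_def matrix_vector_mult_def sum_distrib_right)
  also have "\<dots> = (\<Sum>j\<in>UNIV. \<Sum>i\<in>UNIV. cnj (A $ i $ j) * cnj (v $ j) * w $ i)"
    by (rule sum.swap)
  also have "\<dots> = cip v (dagger A *v w)"
    by (simp add: cip_def matrix_vector_mult_def sum_distrib_left algebra_simps)
  finally show ?thesis .
qed

lemma inner_mult_left: "(A *v v) \<bullet> w = v \<bullet> (dagger A *v w)"
  by (metis Re_cip cip_mult_left)

lemma hermitian_inner: "hermitian A \<Longrightarrow> (A *v v) \<bullet> w = v \<bullet> (A *v w)"
  by (simp add: inner_mult_left hermitian_def)

lemma psd_inner: "psd A \<longleftrightarrow> hermitian A \<and> (\<forall>v. 0 \<le> v \<bullet> (A *v v))"
  unfolding psd_def cip_def[symmetric] Re_cip ..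

lemma outer_mult: "outer v w *v x = cip w x *s v"
  by (simp add: vec_eq_iff outer_def matrix_vector_mult_def cip_def sum_distrib_right
      sum_distrib_left mult_ac)

lemma trace_mult_outer: "trace (A ** outer v w) = cip w (A *v v)"
  by (simp add: trace_def matrix_matrix_mult_def matrix_vector_mult_def outer_def cip_def
      sum_distrib_right sum_distrib_left mult_ac)

lemma dagger_outer: "dagger (outer v w) = outer w v"
  by (simp add: vec_eq_iff outer_def)

text \<open>This identifies the inner product of the matrix type as the real part of the
  Hilbert-Schmidt product, so \<open>norm\<close> on matrices is the Frobenius norm.\<close>

lemma inner_matrix: "A \<bullet> B = Re (trace (dagger A ** B))"
  for A B :: "complex^'n^'n"
proof -
  have "A \<bullet> B = (\<Sum>i\<in>UNIV. \<Sum>j\<in>UNIV. Re (cnj (A $ i $ j) * B $ i $ j))"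
    by (simp add: inner_vec_def inner_complex_def)
  also have "\<dots> = (\<Sum>j\<in>UNIV. \<Sum>i\<in>UNIV. Re (cnj (A $ i $ j) * B $ i $ j))"
    by (rule sum.swap)
  finally show ?thesis
    by (simp add: trace_def matrix_matrix_mult_def)
qed

lemma hermitian_trace_mult_real:
  assumes "hermitian A" "hermitian B"
  shows "trace (A ** B) = complex_of_real (Re (trace (A ** B)))"
proof -
  have "cnj (trace (A ** B)) = trace (dagger (A ** B))" by (rule trace_dagger[symmetric])
  also have "\<dots> = trace (B ** A)" using assms by (simp add: dagger_mult hermitian_def)
  also have "\<dots> = trace (A ** B)" by (rule trace_mul_sym)
  finally have "trace (A ** B) = cnj (trace (A ** B))" by simp
  then show ?thesis by (simp add: complex_eq_iff)
qed

lemma hermitian_add: "hermitian A \<Longrightarrow> hermitian B \<Longrightarrow> hermitian (A + B)"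
  and hermitian_scaleR: "hermitian A \<Longrightarrow> hermitian (r *\<^sub>R A)"
  by (simp_all add: hermitian_def dagger_add dagger_scaleR)

lemma hermitian_sum: "(\<And>i. i \<in> S \<Longrightarrow> hermitian (f i)) \<Longrightarrow> hermitian (sum f S)"
  by (simp add: hermitian_def dagger_sum)

section \<open>The spectral theorem\<close>

text \<open>A maximiser \<open>x\<close> of the Rayleigh quotient on the compact unit sphere of
  \<open>S\<close> is an eigenvector: otherwise moving along the residual \<open>y\<close>, which
  stays in \<open>S\<close> by invariance, would raise the quotient to first order.\<close>

lemma hermitian_eigenvector:
  fixes A :: "complex^'n^'n"
  assumes A: "hermitian A" and S: "subspace S" and inv: "\<And>x. x \<in> S \<Longrightarrow> A *v x \<in> S"
    and ne: "\<exists>x\<in>S. x \<noteq> 0"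
  obtains x \<mu> where "x \<in> S" "norm x = 1" "A *v x = \<mu> *\<^sub>R x"
proof -
  let ?K = "S \<inter> sphere 0 1"
  obtain y where y: "y \<in> S" "y \<noteq> 0" using ne by blast
  then have "(1 / norm y) *\<^sub>R y \<in> ?K"
    using subspace_scale[OF S y(1), of "1 / norm y"] by simp
  then have "?K \<noteq> {}" by blast
  moreover have "compact ?K"
    by (intro closed_Int_compact closed_subspace S compact_sphere)
  moreover have "continuous_on ?K (\<lambda>x. x \<bullet> (A *v x))"
    by (intro continuous_intros linear_continuous_on matrix_vector_mul_bounded_linear)
  ultimately obtain x where x: "x \<in> ?K" and max: "\<And>y. y \<in> ?K \<Longrightarrow> y \<bullet> (A *v y) \<le> x \<bullet> (A *v x)"
    using continuous_attains_sup[of ?K "\<lambda>x. x \<bullet> (A *v x)"] by blast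
  define \<mu> where "\<mu> = x \<bullet> (A *v x)"
  have max': "z \<bullet> (A *v z) \<le> \<mu> * (z \<bullet> z)" if "z \<in> S" for z
  proof (cases "z = 0")
    case False
    have "(1 / norm z) *\<^sub>R z \<in> ?K"
      using False subspace_scale[OF S that, of "1 / norm z"] by simp
    from max[OF this] have "(z \<bullet> (A *v z)) / (norm z)\<^sup>2 \<le> \<mu>"
      by (simp add: \<mu>_def matrix_vector_mult_scaleR_right power2_eq_square)
    then show ?thesis using False
      by (simp add: divide_le_eq power2_norm_eq_inner)
  qed simp
  define y where "y = A *v x - \<mu> *\<^sub>R x"
  have yS: "y \<in> S"
    unfolding y_def using x inv by (intro subspace_diff[OF S] subspace_scale[OF S]) auto
  have xx: "x \<bullet> x = 1" using x by (simp add: dot_square_norm)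
  have Ayx: "y \<bullet> (A *v x) = x \<bullet> (A *v y)"
    using hermitian_inner[OF A, of x y] by (simp add: inner_commute)
  define c where "c = \<mu> * (y \<bullet> y) - y \<bullet> (A *v y)"
  have yy: "y \<bullet> (A *v x) - \<mu> * (y \<bullet> x) = y \<bullet> y"
    by (simp add: y_def inner_diff_right)
  \<comment> \<open>Maximality tested at \<open>x + s *\<^sub>R y\<close>. Since \<open>y\<close> is
    the residual, the coefficient linear in \<open>s\<close> is exactly
    \<open>2 * (y \<bullet> y)\<close>.\<close>
  have quad: "2 * s * (y \<bullet> y) \<le> s\<^sup>2 * c" for s :: real
  proof -
    have "x + s *\<^sub>R y \<in> S" using x yS by (intro subspace_add[OF S] subspace_scale[OF S]) auto
    from max'[OF this] have "\<mu> + 2 * s * (y \<bullet> (A *v x)) + s\<^sup>2 * (y \<bullet> (A *v y)) \<le>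
        \<mu> * (1 + 2 * s * (y \<bullet> x) + s\<^sup>2 * (y \<bullet> y))"
      by (simp add: matrix_vector_right_distrib matrix_vector_mult_scaleR_right inner_add_left
          inner_add_right xx \<mu>_def[symmetric] Ayx inner_commute[of x y] power2_eq_square algebra_simps)
    then have "2 * s * (y \<bullet> (A *v x) - \<mu> * (y \<bullet> x)) \<le> s\<^sup>2 * c"
      unfolding c_def by (simp add: algebra_simps)
    then show ?thesis unfolding yy .
  qed
  have "y \<bullet> y = 0"
  proof (rule ccontr)
    assume "y \<bullet> y \<noteq> 0"
    then have pos: "y \<bullet> y > 0" by simp
    \<comment> \<open>The choice \<open>s = 1\<close> only shows \<open>c > 0\<close>, which permits
      \<open>s = (y \<bullet> y) / c\<close>; there the right side of \<open>quad\<close> is half of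
      the left side, a contradiction.\<close>
    have "2 * (y \<bullet> y) \<le> c" using quad[of 1] by simp
    then have cpos: "c > 0" using pos by linarith
    have "2 * ((y \<bullet> y) / c) * (y \<bullet> y) \<le> ((y \<bullet> y) / c)\<^sup>2 * c" by (rule quad)
    then have "2 * (y \<bullet> y)\<^sup>2 / c \<le> (y \<bullet> y)\<^sup>2 / c"
      using cpos by (simp add: power2_eq_square)
    then have "(y \<bullet> y)\<^sup>2 / c \<le> 0" by simp
    with cpos pos show False by (simp add: divide_le_0_iff)
  qed
  then have "A *v x = \<mu> *\<^sub>R x" by (simp add: y_def)
  then show thesis using that x by auto
qed

definition orthonormal :: "(complex^'n) set \<Rightarrow> bool" where
  "orthonormal S \<longleftrightarrow> (\<forall>v\<in>S. \<forall>w\<in>S. cip v w = (if v = w then 1 else 0))"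

text \<open>Completeness is stated as a trivial orthogonal complement, the form that maximality of
  an orthonormal set of eigenvectors yields. A basis is a set, so eigenvalues become a function on
  vectors.\<close>

definition onb :: "(complex^'n) set \<Rightarrow> bool" where
  "onb S \<longleftrightarrow> finite S \<and> orthonormal S \<and> (\<forall>x. (\<forall>v\<in>S. cip v x = 0) \<longrightarrow> x = 0)"

lemma orthonormal_independent:
  assumes "orthonormal S" shows "independent S"
proof (rule pairwise_orthogonal_independent)
  show "pairwise orthogonal S"
    using assms by (auto simp: pairwise_def orthogonal_def orthonormal_def Re_cip[symmetric])
  show "0 \<notin> S"
    using assms unfolding orthonormal_def by (metis cip_zero_right zero_neq_one)
qed

text \<open>An orthonormal set of eigenvectors of maximal size is a basis: its orthogonal complement is
  invariant, so if it were nonzero it would contain a further eigenvector.\<close>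

lemma hermitian_eigenbasis:
  fixes A :: "complex^'n^'n"
  assumes A: "hermitian A"
  obtains S \<mu> where "onb S" "\<And>v. v \<in> S \<Longrightarrow> A *v v = \<mu> v *\<^sub>R v"
proof -
  define P where "P S \<longleftrightarrow> orthonormal S \<and> (\<forall>v\<in>S. \<exists>r::real. A *v v = r *\<^sub>R v)" for S
  \<comment> \<open>Independence over the reals bounds the size only by the real dimension, twice
    the complex one. Any bound suffices for a largest size to exist.\<close>
  have fin: "finite S \<and> card S \<le> DIM(complex^'n)" if "P S" for S
    using that independent_bound orthonormal_independent P_def by blast
  have "P {}" by (simp add: P_def orthonormal_def)
  moreover have "\<forall>S. P S \<longrightarrow> card S < Suc DIM(complex^'n)" using fin by fastforce
  ultimately obtain S where S: "P S" and max: "\<And>S'. P S' \<Longrightarrow> card S' \<le> card S"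
    using Lattices_Big.ex_has_greatest_nat[of P "{}" card "Suc DIM(complex^'n)"] by metis
  have fS: "finite S" and on: "orthonormal S" and eig: "\<forall>v\<in>S. \<exists>r::real. A *v v = r *\<^sub>R v"
    using S fin by (auto simp: P_def)
  have "x = 0" if x: "\<forall>v\<in>S. cip v x = 0" for x
  proof (rule ccontr)
    assume "x \<noteq> 0"
    let ?C = "{x. \<forall>v\<in>S. cip v x = 0}"
    have "subspace ?C"
      by (auto simp: subspace_def cip_add_right cip_scaleR_right)
    moreover have "A *v y \<in> ?C" if y: "y \<in> ?C" for y
    proof safe
      fix v assume v: "v \<in> S"
      then obtain r where "A *v v = r *\<^sub>R v" using eig by blast
      have "cip v (A *v y) = cip (A *v v) y"
        using A by (simp add: cip_mult_left hermitian_def)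
      also have "\<dots> = cnj (cip y (r *\<^sub>R v))"
        by (simp add: \<open>A *v v = r *\<^sub>R v\<close> cip_commute[of "r *\<^sub>R v"])
      also have "\<dots> = r *\<^sub>R cip v y"
        by (simp add: cip_scaleR_right cip_commute[of v y])
      finally show "cip v (A *v y) = 0" using y v by simp
    qed
    moreover have "\<exists>x\<in>?C. x \<noteq> 0" using x \<open>x \<noteq> 0\<close> by blast
    ultimately obtain z r where z: "z \<in> ?C" "norm z = 1" "A *v z = r *\<^sub>R z"
      using hermitian_eigenvector[OF A, of ?C] by blast
    have zz: "cip z z = 1" using z by (simp add: cip_self)
    have "z \<notin> S" using z zz by auto
    have "cip z v = 0" if "v \<in> S" for v
      using z that by (simp add: cip_commute[of z v])
    then have "orthonormal (insert z S)"
      using on z zz \<open>z \<notin> S\<close> unfolding orthonormal_def by auto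
    then have "P (insert z S)"
      using S z(3) by (auto simp: P_def)
    from max[OF this] show False using fS \<open>z \<notin> S\<close> by simp
  qed
  then have "onb S" using fS on by (auto simp: onb_def)
  moreover obtain \<mu> where "\<And>v. v \<in> S \<Longrightarrow> A *v v = \<mu> v *\<^sub>R v"
    using eig by metis
  ultimately show thesis using that by blast
qed

text \<open>What remains of a vector after subtracting its expansion is orthogonal to all of
  \<open>S\<close>, hence zero.\<close>

lemma onb_resolution:
  assumes "onb S" shows "(\<Sum>v\<in>S. outer v v) = mat 1"
proof -
  have fin: "finite S" and on: "orthonormal S" and full: "\<And>x. \<forall>v\<in>S. cip v x = 0 \<Longrightarrow> x = 0"
    using assms by (auto simp: onb_def)
  have "(\<Sum>v\<in>S. cip v x *s v) = x" for x
  proof -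
    have "cip w (x - (\<Sum>v\<in>S. cip v x *s v)) = 0" if "w \<in> S" for w
    proof -
      have "cip w (\<Sum>v\<in>S. cip v x *s v) = (\<Sum>v\<in>S. cip v x * (if w = v then 1 else 0))"
        unfolding cip_sum_right cip_scale_right
        by (rule sum.cong) (use that on in \<open>auto simp: orthonormal_def\<close>)
      also have "\<dots> = cip w x" using that fin by (simp add: if_distrib cong: if_cong)
      finally show ?thesis by (simp add: cip_diff_right)
    qed
    then have "x - (\<Sum>v\<in>S. cip v x *s v) = 0" by (intro full) blast
    then show ?thesis by simp
  qed
  then show ?thesis
    by (subst matrix_eq) (simp add: matrix_vector_mult_sum_left outer_mult)
qed

text \<open>Multiply both matrices by the resolution of the identity. Through this rule, identities
  between functions of a Hermitian matrix are checked on its eigenvectors.\<close>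

lemma onb_eqI:
  fixes A B :: "complex^'n^'n"
  assumes "onb S" "\<And>v. v \<in> S \<Longrightarrow> A *v v = B *v v" shows "A = B"
proof -
  have o: "C ** outer v v = outer (C *v v) v" for C :: "complex^'n^'n" and v
    by (simp add: vec_eq_iff matrix_matrix_mult_def matrix_vector_mult_def outer_def
        sum_distrib_left mult_ac)
  have "A ** (\<Sum>v\<in>S. outer v v) = B ** (\<Sum>v\<in>S. outer v v)"
    unfolding matrix_mult_sum_right using assms(2) by (simp add: o)
  then show ?thesis by (simp add: onb_resolution assms)
qed

lemma onb_norm: "onb S \<Longrightarrow> v \<in> S \<Longrightarrow> norm v = 1"
proof -
  assume "onb S" "v \<in> S"
  then have "cip v v = 1" by (simp add: onb_def orthonormal_def)
  then have "(norm v)\<^sup>2 = 1" by (metis cip_self of_real_eq_1_iff)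
  then show "norm v = 1" by (metis norm_ge_zero power2_eq_1_iff neg_0_le_iff_le not_one_le_zero)
qed

text \<open>The eigenvalues are a separate argument, so the modulus, the sign and the positive part
  of a Hermitian matrix are sums over the same \<open>S\<close> with another function.\<close>

definition spectral_sum :: "(complex^'n) set \<Rightarrow> (complex^'n \<Rightarrow> real) \<Rightarrow> complex^'n^'n" where
  "spectral_sum S \<mu> = (\<Sum>v\<in>S. \<mu> v *\<^sub>R outer v v)"

lemma spectral_sum_eigen:
  assumes S: "onb S" and v: "v \<in> S" shows "spectral_sum S \<mu> *v v = \<mu> v *\<^sub>R v"
proof -
  have "spectral_sum S \<mu> *v v = (\<Sum>w\<in>S. \<mu> w *\<^sub>R (cip w v *s w))"
    by (simp add: spectral_sum_def matrix_vector_mult_sum_left matrix_vector_mult_scaleR_left outer_mult)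
  also have "\<dots> = (\<Sum>w\<in>S. if w = v then \<mu> v *\<^sub>R v else 0)"
    by (rule sum.cong) (use S v in \<open>auto simp: onb_def orthonormal_def\<close>)
  also have "\<dots> = \<mu> v *\<^sub>R v" using S v by (simp add: onb_def)
  finally show ?thesis .
qed

lemma hermitian_spectral_sum: "hermitian (spectral_sum S \<mu>)"
  by (simp add: spectral_sum_def hermitian_def dagger_sum dagger_scaleR dagger_outer)

lemma psd_spectral_sum:
  assumes "\<And>v. v \<in> S \<Longrightarrow> 0 \<le> \<mu> v" shows "psd (spectral_sum S \<mu>)"
  unfolding psd_inner
proof (intro conjI allI)
  show "hermitian (spectral_sum S \<mu>)" by (rule hermitian_spectral_sum)
  fix x
  have "x \<bullet> (spectral_sum S \<mu> *v x) = (\<Sum>v\<in>S. \<mu> v * (x \<bullet> (cip v x *s v)))"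
    by (simp add: spectral_sum_def matrix_vector_mult_sum_left matrix_vector_mult_scaleR_left
        outer_mult inner_sum_right)
  also have "\<dots> = (\<Sum>v\<in>S. \<mu> v * (cmod (cip v x))\<^sup>2)"
  proof -
    have "x \<bullet> (cip v x *s v) = (cmod (cip v x))\<^sup>2" for v
    proof -
      have "x \<bullet> (cip v x *s v) = Re (cip v x * cnj (cip v x))"
        by (simp only: Re_cip[symmetric] cip_scale_right cip_commute[of x v])
      then show ?thesis by (simp only: complex_norm_square[symmetric] Re_complex_of_real)
    qed
    then show ?thesis by simp
  qed
  also have "\<dots> \<ge> 0" by (intro sum_nonneg mult_nonneg_nonneg assms) auto
  finally show "0 \<le> x \<bullet> (spectral_sum S \<mu> *v x)" .
qed

lemma spectral_sum_trace_mult: "trace (A ** spectral_sum S \<mu>) = (\<Sum>v\<in>S. \<mu> v *\<^sub>R cip v (A *v v))"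
  by (simp add: spectral_sum_def matrix_mult_sum_right trace_sum matrix_mult_simps trace_scaleR
      trace_mult_outer)

lemma hermitian_spectral:
  fixes A :: "complex^'n^'n"
  assumes "hermitian A"
  obtains S \<mu> where "onb S" "A = spectral_sum S \<mu>"
proof -
  obtain S \<mu> where S: "onb S" and e: "\<And>v. v \<in> S \<Longrightarrow> A *v v = \<mu> v *\<^sub>R v"
    using hermitian_eigenbasis[OF assms] by blast
  have "A = spectral_sum S \<mu>"
    using S by (rule onb_eqI) (simp add: e spectral_sum_eigen S)
  then show thesis using that S by blast
qed

lemma psd_spectral:
  fixes A :: "complex^'n^'n"
  assumes "psd A"
  obtains S \<mu> where "onb S" "A = spectral_sum S \<mu>" "\<And>v. v \<in> S \<Longrightarrow> 0 \<le> \<mu> v"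
proof -
  obtain S \<mu> where S: "onb S" and A: "A = spectral_sum S \<mu>"
    using hermitian_spectral assms unfolding psd_def by blast
  have "0 \<le> \<mu> v" if "v \<in> S" for v
  proof -
    have "0 \<le> v \<bullet> (A *v v)" using assms by (simp add: psd_inner)
    also have "\<dots> = \<mu> v"
      using onb_norm[OF S that] by (simp add: A spectral_sum_eigen[OF S that] dot_square_norm)
    finally show ?thesis .
  qed
  then show thesis using that S A by blast
qed

section \<open>The trace norm\<close>

text \<open>On an eigenvector v of \<open>C\<close> with eigenvalue \<mu> the equation reads (B +
  \<mu>)(B - \<mu>) v = 0, and B + \<mu> is injective for \<mu> > 0 because \<open>B\<close> is
  positive semidefinite. For \<mu> = 0 the squared norm of B v is the product of v with B B v = 0.
  This gives the \<open>THE\<close> in \<open>psd_sqrt\<close> its meaning.\<close>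

lemma psd_sqrt_unique:
  fixes B C :: "complex^'n^'n"
  assumes B: "psd B" and C: "psd C" and eq: "B ** B = C ** C"
  shows "B = C"
proof -
  obtain S \<mu> where S: "onb S" and Cs: "C = spectral_sum S \<mu>" and pos: "\<And>v. v \<in> S \<Longrightarrow> 0 \<le> \<mu> v"
    using psd_spectral[OF C] by blast
  have "B *v v = C *v v" if v: "v \<in> S" for v
  proof -
    have Cv: "C *v v = \<mu> v *\<^sub>R v" by (simp add: Cs spectral_sum_eigen S v)
    have BB: "B *v (B *v v) = (\<mu> v)\<^sup>2 *\<^sub>R v"
    proof -
      have "B *v (B *v v) = C *v (C *v v)" by (simp add: matrix_vector_mul_assoc eq)
      then show ?thesis by (simp add: Cv matrix_vector_mult_scaleR_right power2_eq_square)
    qed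
    show ?thesis
    proof (cases "\<mu> v = 0")
      case True
      have "(B *v v) \<bullet> (B *v v) = v \<bullet> (B *v (B *v v))"
        using B by (intro hermitian_inner) (simp add: psd_def)
      then have "B *v v = 0" by (simp add: BB True)
      then show ?thesis by (simp add: Cv True)
    next
      case False
      define y where "y = B *v v - \<mu> v *\<^sub>R v"
      have "B *v y = - \<mu> v *\<^sub>R y"
        by (simp add: y_def matrix_vector_mult_diff_distrib BB matrix_vector_mult_scaleR_right
            power2_eq_square scaleR_diff_right)
      then have "0 \<le> y \<bullet> (- \<mu> v *\<^sub>R y)" using B by (metis psd_inner)
      then have "\<mu> v * (y \<bullet> y) \<le> 0" by simp
      then have "y \<bullet> y \<le> 0" using False pos[OF v] by (simp add: mult_le_0_iff)
      then have "y = 0" by (metis inner_ge_zero inner_eq_zero_iff order_antisym)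
      then show ?thesis by (simp add: y_def Cv)
    qed
  qed
  then show ?thesis by (rule onb_eqI[OF S])
qed

lemma psd_sqrt_eq: "psd B \<Longrightarrow> B ** B = A \<Longrightarrow> psd_sqrt A = B"
  unfolding psd_sqrt_def by (rule the_equality) (auto intro: psd_sqrt_unique)

lemma trace_norm_spectral:
  assumes S: "onb S" shows "trace_norm (spectral_sum S \<mu>) = (\<Sum>v\<in>S. \<bar>\<mu> v\<bar>)"
proof -
  let ?A = "spectral_sum S \<mu>" and ?B = "spectral_sum S (\<lambda>v. \<bar>\<mu> v\<bar>)"
  have "?B ** ?B = ?A ** ?A"
    using S by (rule onb_eqI)
      (simp add: matrix_vector_mul_assoc[symmetric] spectral_sum_eigen S matrix_vector_mult_scaleR_right)
  then have "psd_sqrt (dagger ?A ** ?A) = ?B"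
    using hermitian_spectral_sum[of S \<mu>] by (intro psd_sqrt_eq psd_spectral_sum) (auto simp: hermitian_def)
  then have "trace_norm ?A = Re (trace (mat 1 ** ?B))"
    by (simp add: trace_norm_def)
  also have "\<dots> = (\<Sum>v\<in>S. \<bar>\<mu> v\<bar>)"
    unfolding spectral_sum_trace_mult using onb_norm[OF S]
    by (simp add: cip_self)
  finally show ?thesis .
qed

text \<open>The unit ball of the operator norm, which is the dual ball of the trace norm.\<close>

definition contraction :: "complex^'n^'n \<Rightarrow> bool" where
  "contraction W \<longleftrightarrow> (\<forall>v. norm (W *v v) \<le> norm v)"

lemma contraction_dagger:
  assumes "contraction W" shows "contraction (dagger W)"
  unfolding contraction_def
proof
  fix v
  let ?w = "dagger W *v v"
  have "(norm ?w)\<^sup>2 = v \<bullet> (W *v ?w)"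
    by (simp add: power2_norm_eq_inner inner_mult_left)
  also have "\<dots> \<le> norm v * norm (W *v ?w)" by (rule norm_cauchy_schwarz)
  also have "\<dots> \<le> norm v * norm ?w"
    using assms by (simp add: contraction_def mult_left_mono)
  finally have "norm ?w * norm ?w \<le> norm v * norm ?w" by (simp add: power2_eq_square)
  then show "norm ?w \<le> norm v"
    by (cases "norm ?w = 0") (auto simp: mult_le_cancel_right)
qed

text \<open>One half of the duality. In an eigenbasis of \<open>A\<close> the trace is the sum of
  the eigenvalues weighted by the diagonal entries of \<open>W\<close>, which a contraction keeps
  within [-1, 1].\<close>

lemma trace_contraction_le_trace_norm:
  assumes A: "hermitian A" and W: "contraction W"
  shows "Re (trace (W ** A)) \<le> trace_norm A"
proof -
  obtain S \<mu> where S: "onb S" and As: "A = spectral_sum S \<mu>"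
    using hermitian_spectral[OF A] by blast
  have "Re (trace (W ** A)) = (\<Sum>v\<in>S. \<mu> v * (v \<bullet> (W *v v)))"
    by (simp add: As spectral_sum_trace_mult Re_cip)
  also have "\<dots> \<le> (\<Sum>v\<in>S. \<bar>\<mu> v\<bar>)"
  proof (rule sum_mono)
    fix v assume "v \<in> S"
    then have nv: "norm v = 1" by (rule onb_norm[OF S])
    have "\<bar>v \<bullet> (W *v v)\<bar> \<le> norm v * norm (W *v v)" by (rule Cauchy_Schwarz_ineq2)
    also have "\<dots> \<le> 1" using W nv unfolding contraction_def by (metis mult_1)
    finally have "\<bar>\<mu> v * (v \<bullet> (W *v v))\<bar> \<le> \<bar>\<mu> v\<bar> * 1"
      unfolding abs_mult by (intro mult_left_mono) auto
    then show "\<mu> v * (v \<bullet> (W *v v)) \<le> \<bar>\<mu> v\<bar>" by simp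
  qed
  finally show ?thesis by (simp add: As trace_norm_spectral S)
qed

text \<open>The other half of the duality: the sign of \<open>A\<close>, taken in its eigenbasis, is
  a contraction at which the pairing equals the trace norm.\<close>

lemma trace_norm_le:
  assumes A: "hermitian A" and c: "\<And>W. contraction W \<Longrightarrow> Re (trace (W ** A)) \<le> c"
  shows "trace_norm A \<le> c"
proof -
  obtain S \<mu> where S: "onb S" and As: "A = spectral_sum S \<mu>"
    using hermitian_spectral[OF A] by blast
  let ?W = "spectral_sum S (\<lambda>v. sgn (\<mu> v))"
  have "contraction ?W"
    unfolding contraction_def
  proof
    fix x
    have herm: "hermitian ?W" by (rule hermitian_spectral_sum)
    have nrm: "(norm (?W *v x))\<^sup>2 = x \<bullet> ((?W ** ?W) *v x)"
      by (simp add: power2_norm_eq_inner hermitian_inner[OF herm] matrix_vector_mul_assoc)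
    have sq: "?W ** ?W = spectral_sum S (\<lambda>v. sgn (\<mu> v) * sgn (\<mu> v))"
      using S by (rule onb_eqI)
        (simp add: matrix_vector_mul_assoc[symmetric] spectral_sum_eigen S matrix_vector_mult_scaleR_right)
    \<comment> \<open>The second summand is the projection onto the span of the basis vectors with
      eigenvalue 0; it completes the square of the sign to the identity and is positive
      semidefinite.\<close>
    have one: "mat 1 = spectral_sum S (\<lambda>v. sgn (\<mu> v) * sgn (\<mu> v)) +
        spectral_sum S (\<lambda>v. 1 - sgn (\<mu> v) * sgn (\<mu> v))"
      by (simp add: spectral_sum_def onb_resolution[OF S, symmetric] sum.distrib[symmetric]
          scaleR_add_left[symmetric])
    have "psd (spectral_sum S (\<lambda>v. 1 - sgn (\<mu> v) * sgn (\<mu> v)))"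
      by (rule psd_spectral_sum) (auto simp: sgn_real_def)
    then have "0 \<le> x \<bullet> (spectral_sum S (\<lambda>v. 1 - sgn (\<mu> v) * sgn (\<mu> v)) *v x)"
      by (simp add: psd_inner)
    then have "x \<bullet> ((?W ** ?W) *v x) \<le> x \<bullet> (mat 1 *v x)"
      unfolding sq one by (simp only: matrix_vector_mult_add_rdistrib inner_add_right)
    then have "(norm (?W *v x))\<^sup>2 \<le> (norm x)\<^sup>2"
      using nrm by (simp add: power2_norm_eq_inner)
    then show "norm (?W *v x) \<le> norm x" by (rule power2_le_imp_le) simp
  qed
  then have "Re (trace (?W ** A)) \<le> c" by (rule c)
  moreover have "Re (trace (?W ** A)) = (\<Sum>v\<in>S. \<bar>\<mu> v\<bar>)"
    using onb_norm[OF S]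
    by (simp add: As spectral_sum_trace_mult Re_cip spectral_sum_eigen S dot_square_norm
        mult.commute abs_sgn)
  ultimately show ?thesis by (simp add: As trace_norm_spectral S)
qed

lemma trace_norm_nonneg: "hermitian A \<Longrightarrow> 0 \<le> trace_norm A"
  using trace_contraction_le_trace_norm[of A 0] by (simp add: contraction_def)

text \<open>The Frobenius norm dominates the operator norm, by Cauchy-Schwarz in each row.\<close>

lemma norm_matrix_vector_le: "norm (A *v x) \<le> norm A * norm x"
  for A :: "complex^'n^'n"
proof (rule power2_le_imp_le)
  have row: "(cmod ((A *v x) $ i))\<^sup>2 \<le> (norm (A $ i))\<^sup>2 * (norm x)\<^sup>2" for i
  proof -
    have "cmod ((A *v x) $ i) \<le> (\<Sum>j\<in>UNIV. cmod (A $ i $ j) * cmod (x $ j))"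
      unfolding matrix_vector_mult_def
      by simp (rule order_trans[OF norm_sum], simp add: norm_mult)
    also have "\<dots> \<le> L2_set (\<lambda>j. cmod (A $ i $ j)) UNIV * L2_set (\<lambda>j. cmod (x $ j)) UNIV"
      using L2_set_mult_ineq[of "\<lambda>j. cmod (A $ i $ j)" "\<lambda>j. cmod (x $ j)" UNIV] by simp
    also have "\<dots> = norm (A $ i) * norm x" by (simp add: norm_vec_def)
    finally show ?thesis
      unfolding power_mult_distrib[symmetric] by (intro power_mono) auto
  qed
  have "(norm (A *v x))\<^sup>2 = (\<Sum>i\<in>UNIV. (cmod ((A *v x) $ i))\<^sup>2)"
    by (simp add: norm_vec_def L2_set_def sum_nonneg)
  also have "\<dots> \<le> (\<Sum>i\<in>UNIV. (norm (A $ i))\<^sup>2 * (norm x)\<^sup>2)"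
    by (intro sum_mono row)
  also have "\<dots> = (norm A * norm x)\<^sup>2"
    by (simp add: norm_vec_def[of A] L2_set_def sum_nonneg power_mult_distrib sum_distrib_right)
  finally show "(norm (A *v x))\<^sup>2 \<le> (norm A * norm x)\<^sup>2" .
qed simp

text \<open>Test with \<open>A\<close> divided by its Frobenius norm, which is a contraction and
  pairs with \<open>A\<close> to give that norm. Dual bounds thus become bounds in the library norm,
  where bounded sequences have convergent subsequences.\<close>

lemma norm_le_contraction_bound:
  assumes A: "hermitian A" and c: "\<And>W. contraction W \<Longrightarrow> Re (trace (W ** A)) \<le> c"
  shows "norm A \<le> c"
proof (cases "A = 0")
  case True
  then show ?thesis using c[of 0] by (simp add: contraction_def)
next
  case False
  let ?W = "(1 / norm A) *\<^sub>R A"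
  have "contraction ?W"
    unfolding contraction_def
    using False norm_matrix_vector_le[of A]
    by (simp add: matrix_vector_mult_scaleR_left divide_le_eq mult.commute)
  then have "Re (trace (?W ** A)) \<le> c" by (rule c)
  moreover have "Re (trace (A ** A)) = (norm A)\<^sup>2"
    using inner_matrix[of A A] A by (simp add: hermitian_def power2_norm_eq_inner)
  ultimately show ?thesis
    using False by (simp add: matrix_mult_simps trace_scaleR power2_eq_square)
qed

text \<open>As a supremum of continuous functionals the trace norm is lower semicontinuous, so the
  bound survives the limit. The constraints with \<open>h i\<close> need hold only asymptotically:
  they are exact along a minimising sequence for \<open>gamma\<close>, but only approximate along
  the simple functions replacing an estimator.\<close>

lemma feasible_limit:
  fixes A :: "nat \<Rightarrow> complex^'n^'n"
  assumes herm: "\<And>k. hermitian (A k)" and tr: "\<And>k. trace (A k) = 0"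
    and lim: "\<And>i. (\<lambda>k. trace (A k ** h i)) \<longlonglongrightarrow> complex_of_real (\<alpha> $ i)"
    and bound: "\<And>k W. contraction W \<Longrightarrow> Re (trace (W ** A k)) \<le> c k" and c: "c \<longlonglongrightarrow> l"
  obtains B where "hermitian B" "\<And>i. trace (B ** h i) = complex_of_real (\<alpha> $ i)" "trace B = 0"
    "trace_norm B \<le> l"
proof -
  have nA: "norm (A k) \<le> c k" for k
    using norm_le_contraction_bound herm bound by blast
  obtain K where K: "\<And>k. norm (c k) \<le> K"
    using c by (metis BseqE convergentI convergent_imp_Bseq)
  have "norm (A k) \<le> K" for k using nA[of k] K[of k] by simp
  then have "bounded (range A)" by (auto simp: bounded_iff)
  then obtain B r where r: "strict_mono r" and B: "(A \<circ> r) \<longlonglongrightarrow> B"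
    using bounded_imp_convergent_subsequence by blast
  have "(\<lambda>k. dagger ((A \<circ> r) k)) \<longlonglongrightarrow> dagger B"
    by (rule bounded_linear.tendsto[OF bounded_linear_dagger B])
  then have "hermitian B"
    using B herm unfolding hermitian_def by (auto intro: LIMSEQ_unique simp: o_def)
  moreover have "trace (B ** h i) = complex_of_real (\<alpha> $ i)" for i
  proof (rule LIMSEQ_unique)
    show "(\<lambda>k. trace ((A \<circ> r) k ** h i)) \<longlonglongrightarrow> trace (B ** h i)"
      by (intro bounded_linear.tendsto[OF bounded_linear_trace]
          bounded_bilinear.tendsto[OF bounded_bilinear_matrix_mult] B tendsto_const)
    show "(\<lambda>k. trace ((A \<circ> r) k ** h i)) \<longlonglongrightarrow> complex_of_real (\<alpha> $ i)"
      using LIMSEQ_subseq_LIMSEQ[OF lim[of i] r] by (simp add: o_def)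
  qed
  moreover have "trace B = 0"
  proof (rule LIMSEQ_unique)
    show "(\<lambda>k. trace ((A \<circ> r) k)) \<longlonglongrightarrow> trace B"
      by (intro bounded_linear.tendsto[OF bounded_linear_trace] B)
    show "(\<lambda>k. trace ((A \<circ> r) k)) \<longlonglongrightarrow> 0" by (simp add: tr)
  qed
  moreover have "trace_norm B \<le> l"
  proof (rule trace_norm_le[OF \<open>hermitian B\<close>])
    fix W :: "complex^'n^'n" assume W: "contraction W"
    show "Re (trace (W ** B)) \<le> l"
    proof (rule LIMSEQ_le)
      show "(\<lambda>k. Re (trace (W ** (A \<circ> r) k))) \<longlonglongrightarrow> Re (trace (W ** B))"
        by (intro tendsto_Re bounded_linear.tendsto[OF bounded_linear_trace]
            bounded_bilinear.tendsto[OF bounded_bilinear_matrix_mult] B tendsto_const)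
      show "(c \<circ> r) \<longlonglongrightarrow> l" by (rule LIMSEQ_subseq_LIMSEQ[OF c r])
      show "\<exists>N. \<forall>n\<ge>N. Re (trace (W ** (A \<circ> r) n)) \<le> (c \<circ> r) n"
        using bound[OF W] by auto
    qed
  qed
  ultimately show thesis using that by blast
qed

text \<open>The given \<open>A\<close> makes the feasible set nonempty, and a minimising sequence
  with excess at most 1/(k+1) has a feasible limit \<open>B\<close> that attains the infimum. Only
  then does \<open>LEAST\<close> denote a value that can be compared with anything.\<close>

lemma gamma_le:
  fixes A :: "complex^'n^'n" and h :: "'r::finite \<Rightarrow> complex^'n^'n"
  assumes "hermitian A" "\<And>i. trace (A ** h i) = complex_of_real (\<alpha> $ i)" "trace A = 0"
  shows "0 \<le> gamma h \<alpha>" "gamma h \<alpha> \<le> trace_norm A / 2"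
proof -
  define F where "F A \<longleftrightarrow> hermitian A \<and> (\<forall>i. trace (A ** h i) = complex_of_real (\<alpha> $ i)) \<and> trace A = 0"
    for A
  define m where "m = Inf (trace_norm ` Collect F)"
  have FA: "F A" using assms by (simp add: F_def)
  have bdd: "bdd_below (trace_norm ` Collect F)"
    by (rule bdd_belowI[of _ 0]) (auto simp: F_def trace_norm_nonneg)
  have "\<exists>A. F A \<and> trace_norm A < m + 1 / real (Suc k)" for k
  proof -
    have "m < m + 1 / real (Suc k)" by simp
    then show ?thesis
      using cInf_lessD[of "trace_norm ` Collect F" "m + 1 / real (Suc k)"] FA
      unfolding m_def[symmetric] by blast
  qed
  then obtain S where S: "\<And>k. F (S k)" "\<And>k. trace_norm (S k) < m + 1 / real (Suc k)" by metis
  have lim: "(\<lambda>k. m + 1 / real (Suc k)) \<longlonglongrightarrow> m"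
    using tendsto_add[OF tendsto_const[of m] LIMSEQ_inverse_real_of_nat] by (simp add: field_simps)
  obtain B where "hermitian B" "\<And>i. trace (B ** h i) = complex_of_real (\<alpha> $ i)" "trace B = 0"
    and Bm: "trace_norm B \<le> m"
  proof (rule feasible_limit[where A = S and h = h and \<alpha> = \<alpha>])
    show "Re (trace (W ** S k)) \<le> m + 1 / real (Suc k)" if "contraction W" for k W
      using trace_contraction_le_trace_norm[OF _ that, of "S k"] S[of k] F_def by fastforce
  qed (use S lim F_def in auto)
  then have FB: "F B" by (simp add: F_def)
  have min: "trace_norm B \<le> trace_norm C" if "F C" for C
    using that Bm cInf_lower[OF _ bdd, of "trace_norm C"] unfolding m_def by fastforce
  have "gamma h \<alpha> = (LEAST x. \<exists>A. x = trace_norm A / 2 \<and> F A)"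
    by (simp add: gamma_def F_def)
  also have "\<dots> = trace_norm B / 2"
    using FB min by (intro Least_equality) auto
  finally have g: "gamma h \<alpha> = trace_norm B / 2" .
  show "gamma h \<alpha> \<le> trace_norm A / 2" using min[OF FA] g by simp
  show "0 \<le> gamma h \<alpha>" using g trace_norm_nonneg[OF \<open>hermitian B\<close>] by simp
qed

section \<open>Commutators and measurements\<close>

lemma cmod_cip_le: "cmod (cip v w) \<le> norm v * norm w"
proof -
  have "cmod (cip v w) \<le> (\<Sum>j\<in>UNIV. cmod (v $ j) * cmod (w $ j))"
    unfolding cip_def by (rule order_trans[OF norm_sum]) (simp add: norm_mult)
  also have "\<dots> \<le> L2_set (\<lambda>j. cmod (v $ j)) UNIV * L2_set (\<lambda>j. cmod (w $ j)) UNIV"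
    using L2_set_mult_ineq[of "\<lambda>j. cmod (v $ j)" "\<lambda>j. cmod (w $ j)" UNIV] by simp
  finally show ?thesis by (simp add: norm_vec_def)
qed

lemma Re_trace_mult_spectral:
  "Re (trace (spectral_sum S \<mu> ** A)) = (\<Sum>v\<in>S. \<mu> v * (v \<bullet> (A *v v)))"
  by (simp add: trace_mul_sym[of _ A] spectral_sum_trace_mult Re_cip)

lemma trace_psd_mult_nonneg:
  assumes "psd \<rho>" "psd A" shows "0 \<le> Re (trace (\<rho> ** A))"
proof -
  obtain S \<mu> where "\<rho> = spectral_sum S \<mu>" and "\<And>v. v \<in> S \<Longrightarrow> 0 \<le> \<mu> v"
    using psd_spectral assms(1) by blast
  then show ?thesis using assms(2)
    by (simp add: Re_trace_mult_spectral psd_inner sum_nonneg)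
qed

text \<open>In an eigenbasis of \<open>\<rho>\<close> each of the two terms of the commutator is an
  average, with the eigenvalues as weights, of numbers of modulus at most the norm of X v; this is
  the source of the factor 2. Cauchy-Schwarz turns the average of norms into the root of the average
  of squares. The scalar \<open>-\<i>\<close> makes the commutator Hermitian.\<close>

lemma commutator_trace_bound:
  fixes \<rho> X W :: "complex^'n^'n"
  assumes \<rho>: "density_matrix \<rho>" and X: "hermitian X" and W: "contraction W"
  shows "Re (trace (W ** (mat (-\<i>) ** (\<rho> ** X - X ** \<rho>)))) \<le> 2 * sqrt (Re (trace (\<rho> ** (X ** X))))"
proof -
  obtain S p where S: "onb S" and r: "\<rho> = spectral_sum S p" and p: "\<And>v. v \<in> S \<Longrightarrow> 0 \<le> p v"
    using psd_spectral \<rho> unfolding density_matrix_def by blast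
  have sum_p: "(\<Sum>v\<in>S. p v) = 1"
  proof -
    have "Re (trace (\<rho> ** mat 1)) = 1" using \<rho> by (simp add: density_matrix_def)
    then show ?thesis unfolding r Re_trace_mult_spectral
      using onb_norm[OF S] by (simp add: dot_square_norm)
  qed
  have t: "trace (\<rho> ** A) = (\<Sum>v\<in>S. p v *\<^sub>R cip v (A *v v))" for A
    by (simp add: r trace_mul_sym[of _ A] spectral_sum_trace_mult)
  have XX: "v \<bullet> ((X ** X) *v v) = (norm (X *v v))\<^sup>2" for v
    by (simp add: power2_norm_eq_inner hermitian_inner[OF X] matrix_vector_mul_assoc)
  have "trace (W ** (mat (-\<i>) ** (\<rho> ** X - X ** \<rho>))) = - \<i> * (trace (W ** (\<rho> ** X)) - trace (W ** (X ** \<rho>)))"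
    by (simp add: mat_mult_left_commute trace_mat_mult matrix_mult_simps trace_sub right_diff_distrib)
  also have "trace (W ** (\<rho> ** X)) = trace (\<rho> ** (X ** W))"
    by (simp only: trace_rotate[of W] trace_rotate[of X])
  also have "trace (W ** (X ** \<rho>)) = trace (\<rho> ** (W ** X))"
    by (rule trace_rotate)
  finally have "Re (trace (W ** (mat (-\<i>) ** (\<rho> ** X - X ** \<rho>)))) \<le>
      cmod (- \<i> * (trace (\<rho> ** (X ** W)) - trace (\<rho> ** (W ** X))))"
    using complex_Re_le_cmod by metis
  also have "\<dots> = cmod (trace (\<rho> ** (X ** W)) - trace (\<rho> ** (W ** X)))"
    by (simp add: norm_mult)
  also have "\<dots> \<le> cmod (trace (\<rho> ** (X ** W))) + cmod (trace (\<rho> ** (W ** X)))"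
    by (rule norm_triangle_ineq4)
  also have "\<dots> \<le> (\<Sum>v\<in>S. p v * norm (X *v v)) + (\<Sum>v\<in>S. p v * norm (X *v v))"
  proof (rule add_mono)
    have 1: "cmod (cip v ((X ** W) *v v)) \<le> norm (X *v v)" if "v \<in> S" for v
    proof -
      have "cip v ((X ** W) *v v) = cip (X *v v) (W *v v)"
        using X by (simp add: cip_mult_left hermitian_def matrix_vector_mul_assoc)
      then have "cmod (cip v ((X ** W) *v v)) \<le> norm (X *v v) * norm (W *v v)"
        by (simp add: cmod_cip_le)
      also have "\<dots> \<le> norm (X *v v) * norm v"
        using W by (intro mult_left_mono) (auto simp: contraction_def)
      finally show ?thesis using onb_norm[OF S that] by simp
    qed
    have 2: "cmod (cip v ((W ** X) *v v)) \<le> norm (X *v v)" if "v \<in> S" for v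
    proof -
      have "cmod (cip v ((W ** X) *v v)) \<le> norm (W *v (X *v v))"
        using cmod_cip_le[of v "(W ** X) *v v"] onb_norm[OF S that]
        by (simp add: matrix_vector_mul_assoc)
      also have "\<dots> \<le> norm (X *v v)" using W by (auto simp: contraction_def)
      finally show ?thesis .
    qed
    show "cmod (trace (\<rho> ** (X ** W))) \<le> (\<Sum>v\<in>S. p v * norm (X *v v))"
      unfolding t by (rule order_trans[OF norm_sum])
        (auto intro!: sum_mono mult_left_mono 1 simp: p)
    show "cmod (trace (\<rho> ** (W ** X))) \<le> (\<Sum>v\<in>S. p v * norm (X *v v))"
      unfolding t by (rule order_trans[OF norm_sum])
        (auto intro!: sum_mono mult_left_mono 2 simp: p)
  qed
  also have "\<dots> = 2 * (\<Sum>v\<in>S. p v * norm (X *v v))" by simp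
  \<comment> \<open>The weight is split into two square roots, so that one factor of Cauchy-Schwarz
    is the total weight 1.\<close>
  also have "(\<Sum>v\<in>S. p v * norm (X *v v)) = (\<Sum>v\<in>S. \<bar>sqrt (p v)\<bar> * \<bar>sqrt (p v) * norm (X *v v)\<bar>)"
  proof (rule sum.cong[OF refl])
    fix v assume "v \<in> S"
    have "p v * norm (X *v v) = (sqrt (p v) * sqrt (p v)) * norm (X *v v)"
      using p[OF \<open>v \<in> S\<close>] by simp
    then show "p v * norm (X *v v) = \<bar>sqrt (p v)\<bar> * \<bar>sqrt (p v) * norm (X *v v)\<bar>"
      using p[OF \<open>v \<in> S\<close>] by (simp add: abs_mult)
  qed
  also have "\<dots> \<le> L2_set (\<lambda>v. sqrt (p v)) S * L2_set (\<lambda>v. sqrt (p v) * norm (X *v v)) S"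
    by (rule L2_set_mult_ineq)
  also have "L2_set (\<lambda>v. sqrt (p v)) S = 1"
    using p sum_p by (simp add: L2_set_def)
  also have "L2_set (\<lambda>v. sqrt (p v) * norm (X *v v)) S = sqrt (Re (trace (\<rho> ** (X ** X))))"
    unfolding L2_set_def r Re_trace_mult_spectral XX
    by (rule arg_cong[where f = sqrt], rule sum.cong) (use p in \<open>auto simp: power_mult_distrib\<close>)
  finally show ?thesis by simp
qed

text \<open>Expand \<open>0 \<le> \<Sum>k. (u\<^sub>k - X) M\<^sub>k (u\<^sub>k - X)\<close>.\<close>

lemma povm_second_moment:
  fixes M :: "'i \<Rightarrow> complex^'n^'n"
  assumes \<rho>: "psd \<rho>" and M: "\<And>k. k \<in> I \<Longrightarrow> psd (M k)" and one: "(\<Sum>k\<in>I. M k) = mat 1"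
    and X: "X = (\<Sum>k\<in>I. u k *\<^sub>R M k)"
  shows "Re (trace (\<rho> ** (X ** X))) \<le> (\<Sum>k\<in>I. (u k)\<^sup>2 * Re (trace (\<rho> ** M k)))"
proof -
  have hX: "hermitian X"
    unfolding X by (intro hermitian_sum hermitian_scaleR) (use M psd_def in blast)
  \<comment> \<open>A Kadison-Schwarz inequality between operators, read off in every vector. The
    state enters only afterwards, as a nonnegative combination of rank-one operators.\<close>
  have v: "v \<bullet> ((X ** X) *v v) \<le> (\<Sum>k\<in>I. (u k)\<^sup>2 * (v \<bullet> (M k *v v)))" for v
  proof -
    define x where "x = X *v v"
    have x: "x = (\<Sum>k\<in>I. u k *\<^sub>R (M k *v v))"
      by (simp add: x_def X matrix_vector_mult_sum_left matrix_vector_mult_scaleR_left)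
    \<comment> \<open>The cross terms rebuild \<open>x\<close>, and the effects sum to the identity,
      so the expansion ends with minus twice the square of \<open>x\<close> plus that
      square.\<close>
    have xx: "(\<Sum>k\<in>I. u k * (x \<bullet> (M k *v v))) = x \<bullet> x"
      by (subst (2) x) (simp add: inner_sum_right)
    have "0 \<le> (\<Sum>k\<in>I. (u k *\<^sub>R v - x) \<bullet> (M k *v (u k *\<^sub>R v - x)))"
      using M by (intro sum_nonneg) (simp add: psd_inner)
    also have "\<dots> = (\<Sum>k\<in>I. (u k)\<^sup>2 * (v \<bullet> (M k *v v)) - 2 * (x \<bullet> (u k *\<^sub>R (M k *v v))) + x \<bullet> (M k *v x))"
    proof (rule sum.cong[OF refl])
      fix k assume "k \<in> I"
      then have "v \<bullet> (M k *v x) = x \<bullet> (M k *v v)"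
        using M[of k] hermitian_inner[of "M k" v x] by (simp add: psd_def inner_commute)
      then show "(u k *\<^sub>R v - x) \<bullet> (M k *v (u k *\<^sub>R v - x)) =
          (u k)\<^sup>2 * (v \<bullet> (M k *v v)) - 2 * (x \<bullet> (u k *\<^sub>R (M k *v v))) + x \<bullet> (M k *v x)"
        by (simp add: matrix_vector_mult_diff_distrib matrix_vector_mult_scaleR_right inner_diff_left
            inner_diff_right power2_eq_square algebra_simps)
    qed
    also have "\<dots> = (\<Sum>k\<in>I. (u k)\<^sup>2 * (v \<bullet> (M k *v v))) - 2 * (x \<bullet> x) + x \<bullet> ((\<Sum>k\<in>I. M k) *v x)"
      by (simp add: sum.distrib sum_subtractf sum_distrib_left[symmetric] inner_sum_right[symmetric]
          xx matrix_vector_mult_sum_left)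
    finally have "x \<bullet> x \<le> (\<Sum>k\<in>I. (u k)\<^sup>2 * (v \<bullet> (M k *v v)))" by (simp add: one)
    moreover have "v \<bullet> ((X ** X) *v v) = x \<bullet> x"
      by (simp add: x_def hermitian_inner[OF hX] matrix_vector_mul_assoc)
    ultimately show ?thesis by simp
  qed
  obtain S p where r: "\<rho> = spectral_sum S p" and p: "\<And>v. v \<in> S \<Longrightarrow> 0 \<le> p v"
    using psd_spectral \<rho> by blast
  have "Re (trace (\<rho> ** (X ** X))) \<le> (\<Sum>v\<in>S. p v * (\<Sum>k\<in>I. (u k)\<^sup>2 * (v \<bullet> (M k *v v))))"
    unfolding r Re_trace_mult_spectral using p v by (intro sum_mono mult_left_mono) auto
  also have "\<dots> = (\<Sum>v\<in>S. \<Sum>k\<in>I. (u k)\<^sup>2 * (p v * (v \<bullet> (M k *v v))))"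
    by (simp add: sum_distrib_left mult_ac)
  also have "\<dots> = (\<Sum>k\<in>I. (u k)\<^sup>2 * Re (trace (\<rho> ** M k)))"
    unfolding r Re_trace_mult_spectral by (subst sum.swap) (simp add: sum_distrib_left)
  finally show ?thesis .
qed

section \<open>The ancilla\<close>

definition partial_trace :: "complex^('n \<times> 'd)^('n::finite \<times> 'd::finite) \<Rightarrow> complex^'n^'n" where
  "partial_trace Z = (\<chi> i j. \<Sum>d\<in>UNIV. Z $ (i, d) $ (j, d))"

lemma sum_UNIV_prod: "(\<Sum>p\<in>UNIV. f p) = (\<Sum>i\<in>UNIV. \<Sum>d\<in>UNIV. f (i, d))"
  for f :: "'n::finite \<times> 'd::finite \<Rightarrow> 'b::comm_monoid_add"
  unfolding UNIV_Times_UNIV[symmetric] by (simp add: sum.cartesian_product)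

lemma tensor_one_nth: "tensor_mat K (mat 1) $ (i, d) $ (j, e) = (if d = e then K $ i $ j else 0)"
  by (simp add: tensor_mat_def mat_def)

text \<open>The partial trace is the adjoint of tensoring with the identity. Hence pairing a partial
  trace with a contraction \<open>W\<close> on the system is pairing the full operator with
  \<open>tensor_mat W (mat 1)\<close>.\<close>

lemma trace_tensor_one_mult:
  "trace (tensor_mat K (mat 1) ** Z) = trace (K ** partial_trace Z)"
proof -
  have "trace (tensor_mat K (mat 1) ** Z) =
      (\<Sum>i\<in>UNIV. \<Sum>d\<in>UNIV. \<Sum>j\<in>UNIV. K $ i $ j * Z $ (j, d) $ (i, d))"
    by (simp add: trace_def matrix_matrix_mult_def sum_UNIV_prod tensor_one_nth if_distribR
        if_distrib cong: if_cong)
  also have "\<dots> = (\<Sum>i\<in>UNIV. \<Sum>j\<in>UNIV. \<Sum>d\<in>UNIV. K $ i $ j * Z $ (j, d) $ (i, d))"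
    by (rule sum.cong[OF refl]) (rule sum.swap)
  finally show ?thesis
    by (simp add: trace_def matrix_matrix_mult_def partial_trace_def sum_distrib_left)
qed

lemma trace_partial_trace: "trace (partial_trace Z) = trace Z"
  by (simp add: trace_def partial_trace_def sum_UNIV_prod)

lemma hermitian_partial_trace: "hermitian Z \<Longrightarrow> hermitian (partial_trace Z)"
  unfolding hermitian_def vec_eq_iff dagger_nth by (simp add: partial_trace_def)

lemma hermitian_tensor_one: "hermitian K \<Longrightarrow> hermitian (tensor_mat K (mat 1))"
  unfolding hermitian_def vec_eq_iff dagger_nth by (auto simp: tensor_one_nth split_paired_all)

lemma tensor_one_diff: "tensor_mat (A - B) (mat 1) = tensor_mat A (mat 1) - tensor_mat B (mat 1)"
  and tensor_one_add: "tensor_mat (A + B) (mat 1) = tensor_mat A (mat 1) + tensor_mat B (mat 1)"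
  and tensor_one_scaleR: "tensor_mat (r *\<^sub>R A) (mat 1) = r *\<^sub>R tensor_mat A (mat 1)"
  by (simp_all add: vec_eq_iff tensor_mat_def algebra_simps)

lemma bounded_linear_tensor_one:
  "bounded_linear (\<lambda>A :: complex^'n^'n. tensor_mat A (mat 1 :: complex^'d^'d))"
  by (simp add: linear_conv_bounded_linear[symmetric] linear_iff tensor_one_add tensor_one_scaleR)

text \<open>For each basis state of the ancilla the slice of the vector is acted on by
  \<open>W\<close> alone, and the squared norms of the slices add up.\<close>

lemma contraction_tensor_one:
  fixes W :: "complex^'n^'n"
  assumes "contraction W"
  shows "contraction (tensor_mat W (mat 1) :: complex^('n \<times> 'd::finite)^('n \<times> 'd))"
  unfolding contraction_def
proof
  fix x :: "complex^('n \<times> 'd)"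
  let ?T = "tensor_mat W (mat 1) :: complex^('n \<times> 'd)^('n \<times> 'd)"
  let ?x = "\<lambda>d. \<chi> j. x $ (j, d)"
  have split: "(norm y)\<^sup>2 = (\<Sum>d\<in>UNIV. (norm (\<chi> j. y $ (j, d)))\<^sup>2)" for y :: "complex^('n \<times> 'd)"
  proof -
    have "(norm y)\<^sup>2 = (\<Sum>i\<in>UNIV. \<Sum>d\<in>UNIV. (cmod (y $ (i, d)))\<^sup>2)"
      by (simp add: norm_vec_def L2_set_def sum_nonneg sum_UNIV_prod)
    also have "\<dots> = (\<Sum>d\<in>UNIV. \<Sum>i\<in>UNIV. (cmod (y $ (i, d)))\<^sup>2)" by (rule sum.swap)
    finally show ?thesis by (simp add: norm_vec_def L2_set_def sum_nonneg)
  qed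
  have nth: "(\<chi> i. (?T *v x) $ (i, d)) = W *v ?x d" for d
    by (simp add: vec_eq_iff matrix_vector_mult_def sum_UNIV_prod tensor_one_nth if_distribR
        if_distrib cong: if_cong)
  have "(norm (?T *v x))\<^sup>2 = (\<Sum>d\<in>UNIV. (norm (W *v ?x d))\<^sup>2)"
    unfolding split nth ..
  also have "\<dots> \<le> (\<Sum>d\<in>UNIV. (norm (?x d))\<^sup>2)"
    using assms by (intro sum_mono power_mono) (auto simp: contraction_def)
  also have "\<dots> = (norm x)\<^sup>2" by (rule split[symmetric])
  finally show "norm (?T *v x) \<le> norm x" by (rule power2_le_imp_le) simp
qed

section \<open>Norms of matrices\<close>

text \<open>Apply the estimate for matrix times vector to each column of \<open>B\<close>.\<close>

lemma norm_matrix_mult_le: "norm (A ** B) \<le> norm A * norm B"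
  for A B :: "complex^'n^'n"
proof (rule power2_le_imp_le)
  have cols: "(norm M)\<^sup>2 = (\<Sum>j\<in>UNIV. (norm (column j M))\<^sup>2)" for M :: "complex^'n^'n"
  proof -
    have "(norm M)\<^sup>2 = (\<Sum>i\<in>UNIV. \<Sum>j\<in>UNIV. (cmod (M $ i $ j))\<^sup>2)"
      by (simp add: norm_vec_def L2_set_def sum_nonneg)
    also have "\<dots> = (\<Sum>j\<in>UNIV. \<Sum>i\<in>UNIV. (cmod (M $ i $ j))\<^sup>2)" by (rule sum.swap)
    finally show ?thesis by (simp add: norm_vec_def L2_set_def sum_nonneg column_def)
  qed
  have "column j (A ** B) = A *v column j B" for j
    by (simp add: vec_eq_iff column_def matrix_matrix_mult_def matrix_vector_mult_def)
  then have "(norm (A ** B))\<^sup>2 = (\<Sum>j\<in>UNIV. (norm (A *v column j B))\<^sup>2)"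
    by (simp add: cols)
  also have "\<dots> \<le> (\<Sum>j\<in>UNIV. (norm A * norm (column j B))\<^sup>2)"
    by (intro sum_mono power_mono norm_matrix_vector_le) auto
  also have "\<dots> = (norm A * norm B)\<^sup>2"
    by (simp add: cols[of B] power_mult_distrib sum_distrib_left)
  finally show "(norm (A ** B))\<^sup>2 \<le> (norm A * norm B)\<^sup>2" .
qed simp

lemma norm_dagger [simp]: "norm (dagger A) = norm A"
  for A :: "complex^'n^'n"
proof -
  have "(norm (dagger A))\<^sup>2 = (norm A)\<^sup>2"
    by (simp only: power2_norm_eq_inner inner_matrix dagger_dagger trace_mul_sym[of A])
  then show ?thesis by (simp add: power2_eq_iff_nonneg)
qed

lemma norm_mat_mult: "cmod c = 1 \<Longrightarrow> norm (mat c ** A) = norm A"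
  for A :: "complex^'n^'n"
  by (simp add: norm_vec_def mat_mult_nth norm_mult)

text \<open>The dimension factor is harmless: it enters only error terms and integrability bounds.
  The sharp estimate treats unitaries as contractions.\<close>

lemma unitary_norm:
  fixes U :: "complex^'n^'n"
  assumes "unitary_mat U" shows "norm U = sqrt (real CARD('n))"
proof -
  have "(norm U)\<^sup>2 = real CARD('n)"
    using assms by (simp add: power2_norm_eq_inner inner_matrix unitary_mat_def trace_I)
  then show ?thesis by (metis norm_ge_zero real_sqrt_unique)
qed

lemma unitary_contraction:
  assumes U: "unitary_mat U" shows "contraction U" "contraction (dagger U)"
proof -
  have "norm (U *v v) = norm v" for v
  proof -
    have "(U *v v) \<bullet> (U *v v) = v \<bullet> v"
      using U by (simp add: inner_mult_left matrix_vector_mul_assoc unitary_mat_def)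
    then show ?thesis by (simp add: norm_eq_sqrt_inner)
  qed
  then show "contraction U" by (simp add: contraction_def)
  then show "contraction (dagger U)" by (rule contraction_dagger)
qed

lemma contraction_mult: "contraction A \<Longrightarrow> contraction B \<Longrightarrow> contraction (A ** B)"
  unfolding contraction_def matrix_vector_mul_assoc[symmetric] using order_trans by blast

section \<open>Propagators\<close>

text \<open>Both propagators receive the same pulses, which cancel in the product; it is therefore
  continuous even where each factor jumps. Its derivative sees only the difference of the
  Hamiltonians. With \<open>U' = U\<close> this yields unitarity, with a perturbed \<open>U'\<close>
  Duhamel's formula.\<close>

lemma propagator_product:
  fixes U U' :: "real \<Rightarrow> complex^'n^'n"
  assumes t: "t > 0" and P: "propagator t H V U" and P': "propagator t H' V U'"
    and V: "\<And>s. s \<in> {0..t} \<Longrightarrow> unitary_mat (V s)"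
    and H: "\<And>s. s \<in> {0..t} \<Longrightarrow> hermitian (H s)"
    and F: "\<And>s. s \<in> {0<..<t} - F \<Longrightarrow> V s = mat 1 \<and> isCont H s \<and> isCont H' s"
  shows "dagger (U 0) ** U' 0 = mat 1"
    and "continuous_on {0..t} (\<lambda>s. dagger (U s) ** U' s)"
    and "\<And>s. s \<in> {0<..<t} - F \<Longrightarrow> ((\<lambda>s. dagger (U s) ** U' s) has_vector_derivative
      dagger (U s) ** (mat (-\<i>) ** (H' s - H s)) ** U' s) (at s)"
proof -
  have V1: "dagger (V s) ** V s = mat 1" if "s \<in> {0..t}" for s
    using V[OF that] by (simp add: unitary_mat_def)
  show "dagger (U 0) ** U' 0 = mat 1"
    using P P' V1[of 0] t by (simp add: propagator_def)
  have right: "((\<lambda>s. dagger (U s) ** U' s) \<longlongrightarrow> dagger (U s) ** U' s) (at_right s)" if "s \<in> {0..<t}" for s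
    using P P' that unfolding propagator_def
    by (intro bounded_bilinear.tendsto[OF bounded_bilinear_matrix_mult]
        bounded_linear.tendsto[OF bounded_linear_dagger]) auto
  \<comment> \<open>The value at \<open>s\<close> already includes the pulse, so the left limit is
    known only for \<open>V s ** U x\<close>. Inserting \<open>V s\<close> in both factors does not
    change the product, since \<open>V s\<close> is unitary.\<close>
  have left: "((\<lambda>s. dagger (U s) ** U' s) \<longlongrightarrow> dagger (U s) ** U' s) (at_left s)" if s: "s \<in> {0<..t}" for s
  proof -
    have "((\<lambda>x. dagger (V s ** U x) ** (V s ** U' x)) \<longlongrightarrow> dagger (U s) ** U' s) (at_left s)"
      using P P' that unfolding propagator_def
      by (intro bounded_bilinear.tendsto[OF bounded_bilinear_matrix_mult]
          bounded_linear.tendsto[OF bounded_linear_dagger]) auto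
    moreover have "dagger (V s ** U x) ** (V s ** U' x) = dagger (U x) ** U' x" for x
    proof -
      have "dagger (V s ** U x) ** (V s ** U' x) = dagger (U x) ** (dagger (V s) ** V s) ** U' x"
        by (simp only: dagger_mult matrix_mul_assoc)
      then show ?thesis using V1[of s] s by simp
    qed
    ultimately show ?thesis by simp
  qed
  show "continuous_on {0..t} (\<lambda>s. dagger (U s) ** U' s)"
    unfolding continuous_on_def
  proof
    fix s assume s: "s \<in> {0..t}"
    consider "s = 0" | "s = t" | "0 < s" "s < t" using s by force
    then show "((\<lambda>s. dagger (U s) ** U' s) \<longlongrightarrow> dagger (U s) ** U' s) (at s within {0..t})"
    proof cases
      case 1
      then show ?thesis using right[of 0] t by (simp add: at_within_Icc_at_right)
    next
      case 2
      then show ?thesis using left[of t] t by (simp add: at_within_Icc_at_left)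
    next
      case 3
      then show ?thesis using left[of s] right[of s] by (simp add: at_within_Icc_at filterlim_split_at)
    qed
  qed
  fix s assume s: "s \<in> {0<..<t} - F"
  have d: "(U has_vector_derivative mat (-\<i>) ** H s ** U s) (at s)"
    "(U' has_vector_derivative mat (-\<i>) ** H' s ** U' s) (at s)"
    using P P' F[OF s] s by (auto simp: propagator_def)
  have "dagger (U s) ** (mat (-\<i>) ** H' s ** U' s) + dagger (mat (-\<i>) ** H s ** U s) ** U' s =
      dagger (U s) ** (mat (-\<i>) ** (H' s - H s)) ** U' s"
  proof -
    have "dagger (H s) = H s" using H[of s] s by (simp add: hermitian_def)
    then show ?thesis
      by (simp add: dagger_mult dagger_minus matrix_mult_simps matrix_mul_assoc[symmetric] mat_mult_left_commute
          mat_mult_commute mat_minus)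
  qed
  then show "((\<lambda>s. dagger (U s) ** U' s) has_vector_derivative
      dagger (U s) ** (mat (-\<i>) ** (H' s - H s)) ** U' s) (at s)"
    using bounded_bilinear.has_vector_derivative[OF bounded_bilinear_matrix_mult
        bounded_linear.has_vector_derivative[OF bounded_linear_dagger d(1)] d(2)]
    by simp
qed

text \<open>The product of the propagator with its own adjoint is continuous and has zero derivative
  off the finite set \<open>F\<close>, so it keeps its initial value. In finite dimension a left
  inverse is also a right inverse.\<close>

lemma propagator_unitary:
  fixes U :: "real \<Rightarrow> complex^'n^'n"
  assumes t: "t > 0" and P: "propagator t H V U" and fin: "finite F"
    and V: "\<And>s. s \<in> {0..t} \<Longrightarrow> unitary_mat (V s)"
    and H: "\<And>s. s \<in> {0..t} \<Longrightarrow> hermitian (H s)"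
    and F: "\<And>s. s \<in> {0<..<t} - F \<Longrightarrow> V s = mat 1 \<and> isCont H s"
    and s: "s \<in> {0..t}"
  shows "unitary_mat (U s)"
proof -
  note prod = propagator_product[OF t P P V H, of F, simplified]
  have F': "\<And>s. (0 < s \<and> s < t) \<and> s \<notin> F \<Longrightarrow> V s = mat 1 \<and> isCont H s" using F by auto
  have "((\<lambda>_. 0) has_integral (dagger (U s) ** U s - dagger (U 0) ** U 0)) {0..s}"
  proof (rule fundamental_theorem_of_calculus_interior_strong[OF fin])
    show "0 \<le> s" using s by simp
    show "continuous_on {0..s} (\<lambda>s. dagger (U s) ** U s)"
      using prod(2) F' s by (auto intro: continuous_on_subset)
    show "((\<lambda>s. dagger (U s) ** U s) has_vector_derivative 0) (at x)" if "x \<in> {0<..<s} - F" for x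
      using prod(3)[of x] F' s that by auto
  qed
  then have "dagger (U s) ** U s = dagger (U 0) ** U 0"
    using has_integral_unique[OF has_integral_0] by fastforce
  also have "\<dots> = mat 1" using prod(1) F' by auto
  finally have "dagger (U s) ** U s = mat 1" .
  then show ?thesis
    unfolding unitary_mat_def using matrix_left_right_inverse by blast
qed

text \<open>Off the finite set the function is bounded and continuous on an open set of finite
  measure, hence Lebesgue integrable there; the exceptional points are negligible. This fits
  integrands built from propagators, which jump at pulses.\<close>

lemma integrable_on_finite_exceptions:
  fixes f :: "real \<Rightarrow> 'b::euclidean_space"
  assumes "finite F" and cont: "\<And>s. s \<in> {a<..<b} - F \<Longrightarrow> isCont f s"
    and bound: "\<And>s. s \<in> {a<..<b} - F \<Longrightarrow> norm (f s) \<le> B"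
  shows "f integrable_on {a..b}"
proof -
  let ?O = "{a<..<b} - F"
  have op: "open ?O" using \<open>finite F\<close> by (intro open_Diff finite_imp_closed) auto
  have "continuous_on ?O f" using cont by (simp add: continuous_at_imp_continuous_on)
  then have meas: "(\<lambda>x. indicator ?O x *\<^sub>R f x) \<in> borel_measurable lborel"
    using op by (simp add: borel_measurable_continuous_on_indicator)
  \<comment> \<open>The indicator appears twice because measurability is available only for the
    cut-off function, to which the rule then applies its own indicator.\<close>
  have "integrable lborel (\<lambda>x. indicator ?O x *\<^sub>R (indicator ?O x *\<^sub>R f x))"
  proof (rule integrableI_bounded_set_indicator[OF _ meas])
    show "?O \<in> sets lborel" using op by simp
    have "emeasure lborel ?O \<le> emeasure lborel {a..b}" by (rule emeasure_mono) auto
    also have "\<dots> < \<infinity>" by (simp add: emeasure_lborel_Icc_eq)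
    finally show "emeasure lborel ?O < \<infinity>" .
    show "AE x in lborel. x \<in> ?O \<longrightarrow> norm (indicator ?O x *\<^sub>R f x) \<le> B"
      using bound by auto
  qed
  moreover have "(\<lambda>x. indicator ?O x *\<^sub>R (indicator ?O x *\<^sub>R f x)) = (\<lambda>x. indicator ?O x *\<^sub>R f x)"
    by (auto simp: indicator_def)
  ultimately have "set_integrable lborel ?O f" by (simp add: set_integrable_def)
  then have "f integrable_on ?O" by (rule set_borel_integral_eq_integral(1))
  then show ?thesis
  proof (rule integrable_spike_set)
    show "negligible {x \<in> ?O - {a..b}. f x \<noteq> 0}" by (rule negligible_subset[of "{}"]) auto
    show "negligible {x \<in> {a..b} - ?O. f x \<noteq> 0}"
      by (rule negligible_subset[of "F \<union> {a, b}"]) (use \<open>finite F\<close> in auto)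
  qed
qed

lemma propagator_isCont:
  assumes "propagator t H V U" "s \<in> {0<..<t}" "V s = mat 1" "isCont H s"
  shows "isCont U s"
  using assms unfolding propagator_def by (blast intro: has_vector_derivative_continuous)

text \<open>Duhamel's formula for \<open>U\<^sub>0\<^sup>\<dagger> U\<^sub>\<sigma>\<close>, used once to see that this product is within \<open>O(\<sigma>)\<close> of the
  identity, and once more to identify its derivative.\<close>

lemma propagator_parameter_derivative:
  fixes U :: "real \<Rightarrow> real \<Rightarrow> complex^'n^'n" and K :: "real \<Rightarrow> complex^'n^'n"
  assumes t: "t > 0" and P: "\<And>\<sigma>. propagator t (\<lambda>s. H s + K \<sigma>) V (U \<sigma>)" and fin: "finite F"
    and V: "\<And>s. s \<in> {0..t} \<Longrightarrow> unitary_mat (V s)"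
    and H: "\<And>s. s \<in> {0..t} \<Longrightarrow> hermitian (H s)" and K: "\<And>\<sigma>. hermitian (K \<sigma>)"
    and F: "\<And>s. s \<in> {0<..<t} - F \<Longrightarrow> V s = mat 1 \<and> isCont H s"
    and K0: "K 0 = 0" and K': "(K has_vector_derivative K') (at 0)"
  shows "((\<lambda>\<sigma>. U \<sigma> t) has_vector_derivative
      U 0 t ** (mat (-\<i>) ** integral {0..t} (\<lambda>s. dagger (U 0 s) ** K' ** U 0 s))) (at 0)"
    (is "(_ has_vector_derivative _ ** (_ ** ?G)) _")
proof -
  define W where "W \<sigma> s = dagger (U 0 s) ** U \<sigma> s" for \<sigma> s
  define N where "N = real CARD('n)"
  have N: "N \<ge> 0" by (simp add: N_def)
  have F': "V s = mat 1 \<and> isCont (\<lambda>s. H s + K \<sigma>) s" if "s \<in> {0<..<t} - F" for \<sigma> s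
    using F[OF that] by (auto intro: continuous_intros)
  have unit: "unitary_mat (U \<sigma> s)" if "s \<in> {0..t}" for \<sigma> s
    using F' by (intro propagator_unitary[OF t P fin V _ _ that] hermitian_add H K) auto
  have nU: "norm (U \<sigma> s) = sqrt N" if "s \<in> {0..t}" for \<sigma> s
    unfolding N_def by (rule unitary_norm[OF unit[OF that]])
  have UW: "U \<sigma> s = U 0 s ** W \<sigma> s" if "s \<in> {0..t}" for \<sigma> s
    using unit[OF that, of 0] by (simp add: W_def matrix_mul_assoc unitary_mat_def)
  have norm3: "norm (dagger (U 0 s) ** A ** (U 0 s ** B)) \<le> N * norm A * norm B"
    if "s \<in> {0..t}" for s and A B :: "complex^'n^'n"
  proof -
    have "norm (dagger (U 0 s) ** A ** (U 0 s ** B)) \<le> (sqrt N * norm A) * (sqrt N * norm B)"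
      using nU[OF that, of 0] norm_matrix_mult_le[of "dagger (U 0 s)" A] norm_matrix_mult_le[of "U 0 s" B] N
      by (intro order_trans[OF norm_matrix_mult_le] mult_mono) auto
    also have "\<dots> = (sqrt N * sqrt N) * norm A * norm B" by (simp only: mult_ac)
    also have "sqrt N * sqrt N = N" using N by simp
    finally show ?thesis .
  qed
  \<comment> \<open>Since \<open>K 0 = 0\<close>, the difference of the two Hamiltonians is
    \<open>K \<sigma>\<close> and everything else drops out.\<close>
  have Wint: "((\<lambda>x. dagger (U 0 x) ** (mat (-\<i>) ** K \<sigma>) ** U \<sigma> x) has_integral (W \<sigma> s - mat 1)) {0..s}"
    if s: "s \<in> {0..t}" for \<sigma> s
  proof -
    note prod = propagator_product[OF t P[of 0] P[of \<sigma>], of F]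
    have cont: "continuous_on {0..t} (W \<sigma>)"
      unfolding W_def using F' by (intro prod V hermitian_add H K) auto
    have der: "(W \<sigma> has_vector_derivative dagger (U 0 x) ** (mat (-\<i>) ** K \<sigma>) ** U \<sigma> x) (at x)"
      if "x \<in> {0<..<s} - F" for x
    proof -
      have "x \<in> {0<..<t} - F" using that s by auto
      then have "(W \<sigma> has_vector_derivative
          dagger (U 0 x) ** (mat (-\<i>) ** ((H x + K \<sigma>) - (H x + K 0))) ** U \<sigma> x) (at x)"
        unfolding W_def using F' by (intro prod V hermitian_add H K) auto
      then show ?thesis by (simp add: K0)
    qed
    have "W \<sigma> 0 = mat 1"
      unfolding W_def using F' by (intro prod V hermitian_add H K) auto
    moreover have "((\<lambda>x. dagger (U 0 x) ** (mat (-\<i>) ** K \<sigma>) ** U \<sigma> x) has_integral (W \<sigma> s - W \<sigma> 0)) {0..s}"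
    proof (rule fundamental_theorem_of_calculus_interior_strong[OF fin _ der])
      show "continuous_on {0..s} (W \<sigma>)" by (rule continuous_on_subset[OF cont]) (use s in auto)
    qed (use s in auto)
    ultimately show ?thesis by simp
  qed
  have Wbound: "norm (W \<sigma> s - mat 1) \<le> N * norm (K \<sigma>) * sqrt N * t" if s: "s \<in> {0..t}" for \<sigma> s
  proof -
    have "norm (W \<sigma> s - mat 1) \<le> (N * norm (K \<sigma>) * sqrt N) * measure lborel (cbox 0 s)"
    proof (rule has_integral_bound)
      show "((\<lambda>x. dagger (U 0 x) ** (mat (-\<i>) ** K \<sigma>) ** U \<sigma> x) has_integral (W \<sigma> s - mat 1)) (cbox 0 s)"
        using Wint[OF s] by simp
      show "norm (dagger (U 0 x) ** (mat (-\<i>) ** K \<sigma>) ** U \<sigma> x) \<le> N * norm (K \<sigma>) * sqrt N"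
        if "x \<in> cbox 0 s" for x
      proof -
        have x: "x \<in> {0..t}" using that s by auto
        have "norm (W \<sigma> x) = sqrt N"
        proof -
          have "unitary_mat (W \<sigma> x)"
          proof -
            have "W \<sigma> x ** dagger (W \<sigma> x) =
                dagger (U 0 x) ** (U \<sigma> x ** dagger (U \<sigma> x)) ** U 0 x"
              by (simp only: W_def dagger_mult dagger_dagger matrix_mul_assoc)
            then have "W \<sigma> x ** dagger (W \<sigma> x) = mat 1"
              using unit[OF x] by (simp add: unitary_mat_def)
            then show ?thesis
              unfolding unitary_mat_def using matrix_left_right_inverse by blast
          qed
          then show ?thesis unfolding N_def by (rule unitary_norm)
        qed
        then show ?thesis
          using norm3[OF x, of "mat (-\<i>) ** K \<sigma>" "W \<sigma> x"] UW[OF x, of \<sigma>]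
          by (simp add: norm_mat_mult)
      qed
    qed (use N in auto)
    also have "\<dots> = (N * norm (K \<sigma>) * sqrt N) * s" using s by simp
    also have "\<dots> \<le> (N * norm (K \<sigma>) * sqrt N) * t"
      using s N by (intro mult_left_mono) auto
    finally show ?thesis .
  qed
  have Gint: "((\<lambda>s. dagger (U 0 s) ** K' ** U 0 s) has_integral ?G) {0..t}"
  proof (rule integrable_integral, rule integrable_on_finite_exceptions[OF fin])
    fix s assume s: "s \<in> {0<..<t} - F"
    then have "isCont (U 0) s" using F' by (intro propagator_isCont[OF P]) auto
    then show "isCont (\<lambda>s. dagger (U 0 s) ** K' ** U 0 s) s"
      unfolding isCont_def by (intro bounded_bilinear.tendsto[OF bounded_bilinear_matrix_mult]
          bounded_linear.tendsto[OF bounded_linear_dagger] tendsto_const)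
    show "norm (dagger (U 0 s) ** K' ** U 0 s) \<le> N * norm K' * norm (mat 1 :: complex^'n^'n)"
      using norm3[of s K' "mat 1"] s by simp
  qed
  \<comment> \<open>The remainder of the first-order expansion; differentiability at 0 amounts to
    \<open>R \<sigma>\<close> being of smaller order than \<open>\<sigma>\<close>.\<close>
  define R where "R \<sigma> = W \<sigma> t - mat 1 - \<sigma> *\<^sub>R (mat (-\<i>) ** ?G)" for \<sigma>
  define M where "M = norm (mat 1 :: complex^'n^'n)"
  have Rbound: "norm (R \<sigma>) \<le>
      (N * norm (K \<sigma> - \<sigma> *\<^sub>R K') * M + N * norm (K \<sigma>) * (N * norm (K \<sigma>) * sqrt N * t)) * t" for \<sigma>
  proof -
    let ?f = "\<lambda>x. dagger (U 0 x) ** (mat (-\<i>) ** K \<sigma>) ** U \<sigma> x -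
        \<sigma> *\<^sub>R (mat (-\<i>) ** (dagger (U 0 x) ** K' ** U 0 x))"
    have "(?f has_integral R \<sigma>) {0..t}"
      unfolding R_def
    proof (intro has_integral_diff has_integral_scaleR_left)
      show "((\<lambda>x. \<sigma> *\<^sub>R (mat (-\<i>) ** (dagger (U 0 x) ** K' ** U 0 x))) has_integral
          \<sigma> *\<^sub>R (mat (-\<i>) ** ?G)) {0..t}"
        using has_integral_linear[OF Gint bounded_bilinear.bounded_linear_right[OF bounded_bilinear_matrix_mult, of "mat (-\<i>)"]]
        by (intro has_integral_cmul) (simp add: o_def)
      show "((\<lambda>x. dagger (U 0 x) ** (mat (-\<i>) ** K \<sigma>) ** U \<sigma> x) has_integral (W \<sigma> t - mat 1)) {0..t}"
        using Wint[of t \<sigma>] t by simp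
    qed
    then have I: "(?f has_integral R \<sigma>) (cbox 0 t)" by simp
    have "norm (R \<sigma>) \<le>
      (N * norm (K \<sigma> - \<sigma> *\<^sub>R K') * M + N * norm (K \<sigma>) * (N * norm (K \<sigma>) * sqrt N * t)) * measure lborel (cbox 0 t)"
    proof (rule has_integral_bound[OF _ I])
      fix x assume "x \<in> cbox 0 t"
      then have x: "x \<in> {0..t}" by simp
      \<comment> \<open>The error splits into the Taylor error of \<open>K\<close>, and
        \<open>K \<sigma>\<close> times the deviation of \<open>W\<close> from the identity, which
        \<open>Wbound\<close> makes quadratic in \<open>K \<sigma>\<close>.\<close>
      have "?f x = dagger (U 0 x) ** (mat (-\<i>) ** (K \<sigma> - \<sigma> *\<^sub>R K')) ** (U 0 x ** mat 1)
          + dagger (U 0 x) ** (mat (-\<i>) ** K \<sigma>) ** (U 0 x ** (W \<sigma> x - mat 1))"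
        unfolding UW[OF x, of \<sigma>]
        by (simp add: matrix_mult_simps matrix_mul_assoc[symmetric] mat_mult_left_commute mat_minus)
      also have "norm \<dots> \<le> N * norm (K \<sigma> - \<sigma> *\<^sub>R K') * M + N * norm (K \<sigma>) * norm (W \<sigma> x - mat 1)"
        using norm3[OF x, of "mat (-\<i>) ** (K \<sigma> - \<sigma> *\<^sub>R K')" "mat 1"]
          norm3[OF x, of "mat (-\<i>) ** K \<sigma>" "W \<sigma> x - mat 1"]
        unfolding M_def by (intro order_trans[OF norm_triangle_ineq] add_mono) (auto simp: norm_mat_mult)
      also have "\<dots> \<le> N * norm (K \<sigma> - \<sigma> *\<^sub>R K') * M + N * norm (K \<sigma>) * (N * norm (K \<sigma>) * sqrt N * t)"
        using Wbound[OF x, of \<sigma>] N by (intro add_left_mono mult_left_mono) auto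
      finally show "norm (?f x) \<le> N * norm (K \<sigma> - \<sigma> *\<^sub>R K') * M + N * norm (K \<sigma>) * (N * norm (K \<sigma>) * sqrt N * t)" .
    next
      show "0 \<le> N * norm (K \<sigma> - \<sigma> *\<^sub>R K') * M + N * norm (K \<sigma>) * (N * norm (K \<sigma>) * sqrt N * t)"
        using N t by (intro add_nonneg_nonneg mult_nonneg_nonneg) (auto simp: M_def)
    qed
    then show ?thesis using t by simp
  qed
  have K1: "(\<lambda>\<sigma>. norm (K \<sigma> - \<sigma> *\<^sub>R K') / \<bar>\<sigma>\<bar>) \<midarrow>0\<rightarrow> 0"
    using K' by (simp add: has_vector_derivative_def has_derivative_at K0)
  have K2: "K \<midarrow>0\<rightarrow> 0"
    using has_vector_derivative_continuous[OF K'] K0 by (simp add: continuous_at)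
  \<comment> \<open>The first factor stays bounded near 0 because \<open>K\<close> is differentiable
    with \<open>K 0 = 0\<close>; the second tends to 0.\<close>
  have K3: "(\<lambda>\<sigma>. norm (K \<sigma>) / \<bar>\<sigma>\<bar> * norm (K \<sigma>)) \<midarrow>0\<rightarrow> 0"
  proof (rule Lim_null_comparison)
    have le: "norm (K \<sigma>) / \<bar>\<sigma>\<bar> \<le> norm (K \<sigma> - \<sigma> *\<^sub>R K') / \<bar>\<sigma>\<bar> + norm K'" if "\<sigma> \<noteq> 0" for \<sigma>
    proof -
      have "norm (K \<sigma>) \<le> norm (K \<sigma> - \<sigma> *\<^sub>R K') + norm (\<sigma> *\<^sub>R K')"
        using norm_triangle_ineq[of "K \<sigma> - \<sigma> *\<^sub>R K'" "\<sigma> *\<^sub>R K'"] by simp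
      then show ?thesis using that by (simp add: field_simps)
    qed
    have "eventually (\<lambda>\<sigma>::real. \<sigma> \<noteq> 0) (at 0)" by (simp add: eventually_at_filter)
    then show "\<forall>\<^sub>F \<sigma> in at 0. norm (norm (K \<sigma>) / \<bar>\<sigma>\<bar> * norm (K \<sigma>)) \<le>
        (norm (K \<sigma> - \<sigma> *\<^sub>R K') / \<bar>\<sigma>\<bar> + norm K') * norm (K \<sigma>)"
    proof (rule eventually_mono)
      fix \<sigma> :: real assume "\<sigma> \<noteq> 0"
      have "norm (norm (K \<sigma>) / \<bar>\<sigma>\<bar> * norm (K \<sigma>)) = norm (K \<sigma>) / \<bar>\<sigma>\<bar> * norm (K \<sigma>)" by simp
      also have "\<dots> \<le> (norm (K \<sigma> - \<sigma> *\<^sub>R K') / \<bar>\<sigma>\<bar> + norm K') * norm (K \<sigma>)"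
        by (rule mult_right_mono[OF le[OF \<open>\<sigma> \<noteq> 0\<close>] norm_ge_zero])
      finally show "norm (norm (K \<sigma>) / \<bar>\<sigma>\<bar> * norm (K \<sigma>)) \<le>
        (norm (K \<sigma> - \<sigma> *\<^sub>R K') / \<bar>\<sigma>\<bar> + norm K') * norm (K \<sigma>)" .
    qed
    show "(\<lambda>\<sigma>. (norm (K \<sigma> - \<sigma> *\<^sub>R K') / \<bar>\<sigma>\<bar> + norm K') * norm (K \<sigma>)) \<midarrow>0\<rightarrow> 0"
      using tendsto_mult[OF tendsto_add[OF K1 tendsto_const[of "norm K'"]] tendsto_norm[OF K2]] by simp
  qed
  have "(\<lambda>\<sigma>. norm (R \<sigma>) / \<bar>\<sigma>\<bar>) \<midarrow>0\<rightarrow> 0"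
  proof (rule Lim_null_comparison)
    show "\<forall>\<^sub>F \<sigma> in at 0. norm (norm (R \<sigma>) / \<bar>\<sigma>\<bar>) \<le>
      (N * M * t) * (norm (K \<sigma> - \<sigma> *\<^sub>R K') / \<bar>\<sigma>\<bar>) + (N * N * sqrt N * t * t) * (norm (K \<sigma>) / \<bar>\<sigma>\<bar> * norm (K \<sigma>))"
    proof (rule always_eventually, rule allI)
      fix \<sigma> :: real
      have "norm (R \<sigma>) / \<bar>\<sigma>\<bar> \<le> (N * norm (K \<sigma> - \<sigma> *\<^sub>R K') * M +
          N * norm (K \<sigma>) * (N * norm (K \<sigma>) * sqrt N * t)) * t / \<bar>\<sigma>\<bar>"
        using Rbound[of \<sigma>] by (rule divide_right_mono) simp
      then show "norm (norm (R \<sigma>) / \<bar>\<sigma>\<bar>) \<le> (N * M * t) * (norm (K \<sigma> - \<sigma> *\<^sub>R K') / \<bar>\<sigma>\<bar>) +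
          (N * N * sqrt N * t * t) * (norm (K \<sigma>) / \<bar>\<sigma>\<bar> * norm (K \<sigma>))"
        by (simp add: add_divide_distrib algebra_simps)
    qed
    show "(\<lambda>\<sigma>. (N * M * t) * (norm (K \<sigma> - \<sigma> *\<^sub>R K') / \<bar>\<sigma>\<bar>) +
        (N * N * sqrt N * t * t) * (norm (K \<sigma>) / \<bar>\<sigma>\<bar> * norm (K \<sigma>))) \<midarrow>0\<rightarrow> 0"
      using tendsto_add[OF tendsto_mult[OF tendsto_const[of "N * M * t"] K1]
          tendsto_mult[OF tendsto_const[of "N * N * sqrt N * t * t"] K3]] by simp
  qed
  moreover have W0: "W 0 t = mat 1"
    using unit[of t 0] t by (simp add: W_def unitary_mat_def)
  moreover have "bounded_linear (\<lambda>\<sigma>. \<sigma> *\<^sub>R (mat (-\<i>) ** ?G))" by (rule bounded_linear_scaleR_left)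
  ultimately have "((\<lambda>\<sigma>. W \<sigma> t) has_vector_derivative mat (-\<i>) ** ?G) (at 0)"
    unfolding has_vector_derivative_def has_derivative_at R_def by simp
  then have "((\<lambda>\<sigma>. U 0 t ** W \<sigma> t) has_vector_derivative U 0 t ** (mat (-\<i>) ** ?G)) (at 0)"
    by (rule bounded_linear.has_vector_derivative[OF
          bounded_bilinear.bounded_linear_right[OF bounded_bilinear_matrix_mult]])
  moreover have "(\<lambda>\<sigma>. U 0 t ** W \<sigma> t) = (\<lambda>\<sigma>. U \<sigma> t)"
    by (rule ext, rule UW[symmetric]) (use t in auto)
  ultimately show ?thesis by (simp only:)
qed

section \<open>Time integrals of conjugated matrices and the first-order response of a
  protocol\<close>

lemma trace_mult_integral:
  fixes f :: "real \<Rightarrow> complex^'n^'n"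
  assumes "(f has_integral I) S"
  shows "((\<lambda>s. trace (B ** f s)) has_integral trace (B ** I)) S"
proof -
  have "bounded_linear (\<lambda>A. trace (B ** A))"
    using bounded_linear_compose[OF bounded_linear_trace
        bounded_bilinear.bounded_linear_right[OF bounded_bilinear_matrix_mult]] .
  from has_integral_linear[OF assms this] show ?thesis by (simp add: o_def)
qed

lemma hermitian_integral:
  fixes f :: "real \<Rightarrow> complex^'n^'n"
  assumes I: "(f has_integral I) S" and "\<And>s. hermitian (f s)"
  shows "hermitian I"
proof -
  have "((\<lambda>s. dagger (f s)) has_integral dagger I) S"
    using has_integral_linear[OF I bounded_linear_dagger] by (simp add: o_def)
  then have "(f has_integral dagger I) S" using assms(2) by (simp add: hermitian_def)
  then show ?thesis unfolding hermitian_def using I has_integral_unique by blast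
qed

lemma hermitian_conj: "hermitian A \<Longrightarrow> hermitian (U ** A ** dagger U)"
  by (simp add: hermitian_def dagger_mult matrix_mul_assoc)

text \<open>Both orders occur: one transports the generators, the other, its adjoint for the trace
  pairing, transports the commutator.\<close>

lemma conjugation_has_integral:
  fixes U :: "real \<Rightarrow> complex^'n^'n"
  assumes fin: "finite F" and unit: "\<And>s. s \<in> {0..t} \<Longrightarrow> unitary_mat (U s)"
    and cont: "\<And>s. s \<in> {0<..<t} - F \<Longrightarrow> isCont U s"
  shows "((\<lambda>s. U s ** C ** dagger (U s)) has_integral
      integral {0..t} (\<lambda>s. U s ** C ** dagger (U s))) {0..t}" (is ?A)
    and "((\<lambda>s. dagger (U s) ** C ** U s) has_integral
      integral {0..t} (\<lambda>s. dagger (U s) ** C ** U s)) {0..t}" (is ?B)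
proof -
  have bound: "norm (A ** C ** B) \<le> sqrt CARD('n) * norm C * sqrt CARD('n)"
    if "norm A = sqrt CARD('n)" "norm B = sqrt CARD('n)" for A B :: "complex^'n^'n"
    using that norm_matrix_mult_le[of A C]
    by (intro order_trans[OF norm_matrix_mult_le] mult_mono) auto
  show ?A
  proof (rule integrable_integral, rule integrable_on_finite_exceptions[OF fin])
    fix s assume s: "s \<in> {0<..<t} - F"
    show "isCont (\<lambda>s. U s ** C ** dagger (U s)) s"
      using cont[OF s] unfolding isCont_def
      by (intro bounded_bilinear.tendsto[OF bounded_bilinear_matrix_mult]
          bounded_linear.tendsto[OF bounded_linear_dagger] tendsto_const)
    show "norm (U s ** C ** dagger (U s)) \<le> sqrt CARD('n) * norm C * sqrt CARD('n)"
      using s unit[of s] by (intro bound) (auto intro: unitary_norm)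
  qed
  show ?B
  proof (rule integrable_integral, rule integrable_on_finite_exceptions[OF fin])
    fix s assume s: "s \<in> {0<..<t} - F"
    show "isCont (\<lambda>s. dagger (U s) ** C ** U s) s"
      using cont[OF s] unfolding isCont_def
      by (intro bounded_bilinear.tendsto[OF bounded_bilinear_matrix_mult]
          bounded_linear.tendsto[OF bounded_linear_dagger] tendsto_const)
    show "norm (dagger (U s) ** C ** U s) \<le> sqrt CARD('n) * norm C * sqrt CARD('n)"
      using s unit[of s] by (intro bound) (auto intro: unitary_norm)
  qed
qed

text \<open>These four facts are all that the estimation argument uses of the dynamics. In the last
  one \<open>A\<close> comes from the commutator of the state with \<open>X\<close> and from the
  propagator at \<open>\<theta>0\<close>, not from \<open>i\<close>, so one matrix meets all the
  constraints at once.\<close>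

lemma protocol_perturbation:
  fixes \<rho> :: "real^'r::finite \<Rightarrow> complex^('n::finite \<times> 'd::finite)^('n \<times> 'd)"
    and h :: "'r \<Rightarrow> complex^'n^'n"
  assumes t: "t > 0" and E: "estimation_protocol t H0 \<rho> \<Omega> M"
    and H0: "\<And>\<theta>. hermitian (H0 \<theta>)" and h: "\<And>i. hermitian (h i)"
    and d: "\<And>i. ((\<lambda>s. H0 (\<theta>0 + s *\<^sub>R axis i 1)) has_vector_derivative h i) (at 0)"
  shows "density_matrix (\<rho> \<theta>0)"
    and "hermitian (partial_deriv i \<rho> \<theta>0)"
    and "trace (partial_deriv i \<rho> \<theta>0) = 0"
    and "hermitian X \<Longrightarrow> \<exists>A. hermitian A \<and> trace A = 0 \<and>
      (\<forall>i. trace (partial_deriv i \<rho> \<theta>0 ** X) = trace (A ** h i)) \<and>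
      (\<forall>W. contraction W \<longrightarrow> Re (trace (W ** A)) \<le> 2 * t * sqrt (Re (trace (\<rho> \<theta>0 ** (X ** X)))))"
proof -
  let ?T = "\<lambda>A :: complex^'n^'n. tensor_mat A (mat 1 :: complex^'d^'d)"
  obtain \<rho>0 Hc V where \<rho>0: "density_matrix \<rho>0"
    and Hc: "\<And>s. s \<in> {0..t} \<Longrightarrow> hermitian (Hc s)" and pc: "piecewise_continuous t Hc"
    and V: "\<And>s. s \<in> {0..t} \<Longrightarrow> unitary_mat (V s)" and Vfin: "finite {s \<in> {0..t}. V s \<noteq> mat 1}"
    and ex: "\<forall>\<theta>. \<exists>U. propagator t (\<lambda>s. ?T (H0 \<theta>) + Hc s) V U \<and> \<rho> \<theta> = U t ** \<rho>0 ** dagger (U t)"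
    using E unfolding estimation_protocol_def by blast
  from ex obtain U where U: "\<And>\<theta>. propagator t (\<lambda>s. ?T (H0 \<theta>) + Hc s) V (U \<theta>)"
    and \<rho>: "\<And>\<theta>. \<rho> \<theta> = U \<theta> t ** \<rho>0 ** dagger (U \<theta> t)" by metis
  obtain D where D: "finite D" "\<forall>s\<in>{0<..<t} - D. isCont Hc s"
    using pc unfolding piecewise_continuous_def by blast
  define F where "F = D \<union> {s \<in> {0..t}. V s \<noteq> mat 1}"
  have fin: "finite F" using D Vfin by (simp add: F_def)
  have F: "V s = mat 1 \<and> isCont (\<lambda>s. ?T (H0 \<theta>) + Hc s) s" if "s \<in> {0<..<t} - F" for s \<theta>
    using that D by (auto simp: F_def intro!: continuous_intros)
  have H: "hermitian (?T (H0 \<theta>) + Hc s)" if "s \<in> {0..t}" for s \<theta>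
    using that by (intro hermitian_add hermitian_tensor_one H0 Hc)
  define u where "u = U \<theta>0"
  have unit: "unitary_mat (u s)" if "s \<in> {0..t}" for s
    unfolding u_def by (rule propagator_unitary[OF t U fin V H F that])
  have cont: "isCont u s" if "s \<in> {0<..<t} - F" for s
    unfolding u_def using F[OF that] that by (intro propagator_isCont[OF U]) auto
  note int = conjugation_has_integral[OF fin unit cont, simplified]
  have ut: "dagger (u t) ** u t = mat 1" "u t ** dagger (u t) = mat 1"
    using unit[of t] t by (auto simp: unitary_mat_def)
  define G where "G B = integral {0..t} (\<lambda>s. dagger (u s) ** B ** u s)" for B
  define Z where "Z C = integral {0..t} (\<lambda>s. u s ** C ** dagger (u s))" for C
  have G: "((\<lambda>s. dagger (u s) ** B ** u s) has_integral G B) {0..t}" for B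
    unfolding G_def by (rule conjugation_has_integral[OF fin unit cont])
  have Z: "((\<lambda>s. u s ** C ** dagger (u s)) has_integral Z C) {0..t}" for C
    unfolding Z_def by (rule conjugation_has_integral[OF fin unit cont])
  \<comment> \<open>\<open>G\<close> and \<open>Z\<close> are adjoint for the trace pairing, by
    cyclicity under the integral. This moves the transport from the generator onto the
    commutator.\<close>
  have GZ: "trace (G B ** C) = trace (B ** Z C)" for B C
  proof -
    have I: "((\<lambda>s. trace (C ** (dagger (u s) ** B ** u s))) has_integral trace (C ** G B)) {0..t}"
      by (rule trace_mult_integral[OF G])
    have eq: "trace (C ** (dagger (u s) ** B ** u s)) = trace (B ** (u s ** C ** dagger (u s)))" for s
    proof -
      have "trace (C ** (dagger (u s) ** B ** u s)) = trace ((C ** dagger (u s)) ** (B ** u s))"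
        by (simp only: matrix_mul_assoc)
      also have "\<dots> = trace ((B ** u s) ** (C ** dagger (u s)))" by (rule trace_mul_sym)
      finally show ?thesis by (simp only: matrix_mul_assoc)
    qed
    have "trace (C ** G B) = trace (B ** Z C)"
      by (rule has_integral_unique[OF I[unfolded eq] trace_mult_integral[OF Z]])
    then show ?thesis by (rule trans[OF trace_mul_sym])
  qed
  define g where "g i = G (?T (h i))" for i
  have hg: "hermitian (g i)" for i
    unfolding g_def
  proof (rule hermitian_integral[OF G])
    show "hermitian (dagger (u s) ** ?T (h i) ** u s)" for s
      using hermitian_conj[OF hermitian_tensor_one[OF h[of i]], of "dagger (u s)"] by simp
  qed
  have deriv: "partial_deriv i \<rho> \<theta>0 =
      u t ** \<rho>0 ** dagger (u t ** (mat (-\<i>) ** g i)) + u t ** (mat (-\<i>) ** g i) ** \<rho>0 ** dagger (u t)" for i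
  proof -
    \<comment> \<open>The Hamiltonian at \<open>\<theta>0\<close>, control included, becomes the
      unperturbed part, so that the perturbation vanishes at \<open>\<sigma> = 0\<close>.\<close>
    let ?K = "\<lambda>\<sigma>. ?T (H0 (\<theta>0 + \<sigma> *\<^sub>R axis i 1) - H0 \<theta>0)"
    have d': "((\<lambda>s. H0 (\<theta>0 + s *\<^sub>R axis i 1) - H0 \<theta>0) has_vector_derivative h i) (at 0)"
      using has_vector_derivative_diff[OF d[of i] has_vector_derivative_const[of "H0 \<theta>0"]] by simp
    have "((\<lambda>\<sigma>. U (\<theta>0 + \<sigma> *\<^sub>R axis i 1) t) has_vector_derivative
      U (\<theta>0 + 0 *\<^sub>R axis i 1) t ** (mat (-\<i>) ** integral {0..t} (\<lambda>s. dagger (U (\<theta>0 + 0 *\<^sub>R axis i 1) s)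
        ** ?T (h i) ** U (\<theta>0 + 0 *\<^sub>R axis i 1) s))) (at 0)"
    proof (rule propagator_parameter_derivative[where K = ?K and H = "\<lambda>s. ?T (H0 \<theta>0) + Hc s", OF t _ fin V H _ F])
      show "propagator t (\<lambda>s. ?T (H0 \<theta>0) + Hc s + ?K \<sigma>) V (U (\<theta>0 + \<sigma> *\<^sub>R axis i 1))" for \<sigma>
        using U[of "\<theta>0 + \<sigma> *\<^sub>R axis i 1"] by (simp add: tensor_one_diff algebra_simps)
      show "hermitian (?K \<sigma>)" for \<sigma>
        using H0 by (intro hermitian_tensor_one) (simp add: hermitian_def dagger_diff)
      show "?K 0 = 0"
        using linear_0[OF bounded_linear.linear[OF bounded_linear_tensor_one]] by simp
      show "(?K has_vector_derivative ?T (h i)) (at 0)"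
        by (rule bounded_linear.has_vector_derivative[OF bounded_linear_tensor_one d'])
    qed
    then have dU: "((\<lambda>\<sigma>. U (\<theta>0 + \<sigma> *\<^sub>R axis i 1) t) has_vector_derivative u t ** (mat (-\<i>) ** g i)) (at 0)"
      by (simp add: u_def g_def G_def)
    note bb = bounded_bilinear.has_vector_derivative[OF bounded_bilinear_matrix_mult]
    have "((\<lambda>\<sigma>. \<rho> (\<theta>0 + \<sigma> *\<^sub>R axis i 1)) has_vector_derivative
      (u t ** \<rho>0 ** dagger (u t ** (mat (-\<i>) ** g i)) + u t ** (mat (-\<i>) ** g i) ** \<rho>0 ** dagger (u t))) (at 0)"
      using bb[OF bb[OF dU has_vector_derivative_const[of \<rho>0]]
          bounded_linear.has_vector_derivative[OF bounded_linear_dagger dU]]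
      by (simp add: \<rho> u_def)
    then show ?thesis unfolding partial_deriv_def by (rule vector_derivative_at)
  qed
  have h\<rho>0: "hermitian \<rho>0" using \<rho>0 by (simp add: density_matrix_def psd_def)
  show "density_matrix (\<rho> \<theta>0)"
  proof -
    have "trace (\<rho> \<theta>0) = trace (u t ** (\<rho>0 ** dagger (u t)))" by (simp add: \<rho> u_def matrix_mul_assoc)
    also have "\<dots> = trace (\<rho>0 ** (dagger (u t) ** u t))"
      by (simp only: trace_rotate[of "u t"] trace_rotate[of "dagger (u t)"])
    also have "\<dots> = 1" using \<rho>0 by (simp add: ut density_matrix_def)
    finally have "trace (\<rho> \<theta>0) = 1" .
    moreover have "psd (\<rho> \<theta>0)"
      unfolding psd_inner
    proof (intro conjI allI)
      show "hermitian (\<rho> \<theta>0)" unfolding \<rho> by (rule hermitian_conj[OF h\<rho>0])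
      fix v
      have "v \<bullet> (\<rho> \<theta>0 *v v) = (dagger (u t) *v v) \<bullet> (\<rho>0 *v (dagger (u t) *v v))"
        by (simp add: \<rho> u_def inner_mult_left matrix_vector_mul_assoc matrix_mul_assoc)
      also have "\<dots> \<ge> 0" using \<rho>0 by (simp add: density_matrix_def psd_inner)
      finally show "0 \<le> v \<bullet> (\<rho> \<theta>0 *v v)" .
    qed
    ultimately show ?thesis by (simp add: density_matrix_def)
  qed
  show "hermitian (partial_deriv i \<rho> \<theta>0)"
    using h\<rho>0 unfolding deriv hermitian_def
    by (simp add: dagger_add dagger_mult matrix_mul_assoc add.commute)
  \<comment> \<open>The final unitary is moved from the state onto \<open>X\<close> by cyclicity.
    What remains is the commutator of the initial state with the pulled-back observable.\<close>
  have key: "trace (partial_deriv i \<rho> \<theta>0 ** X) =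
      trace (g i ** (mat (-\<i>) ** (\<rho>0 ** (dagger (u t) ** X ** u t) - (dagger (u t) ** X ** u t) ** \<rho>0)))"
    for i X
  proof -
    let ?Y = "dagger (u t) ** X ** u t"
    have gi: "dagger (g i) = g i" using hg by (simp add: hermitian_def)
    have "u t ** \<rho>0 ** dagger (u t ** (mat (-\<i>) ** g i)) ** X = (u t ** (\<rho>0 ** (mat \<i> ** g i))) ** (dagger (u t) ** X)"
      by (simp add: dagger_mult gi matrix_mul_assoc mat_mult_commute)
    also have "trace \<dots> = trace (dagger (u t) ** X ** (u t ** (\<rho>0 ** (mat \<i> ** g i))))"
      by (rule trace_mul_sym)
    also have "\<dots> = trace ((?Y ** \<rho>0) ** (mat \<i> ** g i))" by (simp only: matrix_mul_assoc)
    also have "\<dots> = \<i> * trace ((?Y ** \<rho>0) ** g i)" by (simp only: mat_mult_left_commute trace_mat_mult)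
    also have "trace ((?Y ** \<rho>0) ** g i) = trace (g i ** (?Y ** \<rho>0))" by (rule trace_mul_sym)
    finally have 1: "trace (u t ** \<rho>0 ** dagger (u t ** (mat (-\<i>) ** g i)) ** X) = \<i> * trace (g i ** (?Y ** \<rho>0))" .
    have "trace (u t ** (mat (-\<i>) ** g i) ** \<rho>0 ** dagger (u t) ** X) =
        trace (u t ** ((mat (-\<i>) ** g i) ** (\<rho>0 ** dagger (u t) ** X)))"
      by (simp only: matrix_mul_assoc)
    also have "\<dots> = trace (((mat (-\<i>) ** g i) ** (\<rho>0 ** dagger (u t) ** X)) ** u t)" by (rule trace_mul_sym)
    also have "\<dots> = trace (mat (-\<i>) ** (g i ** (\<rho>0 ** ?Y)))" by (simp only: matrix_mul_assoc)
    finally have 2: "trace (u t ** (mat (-\<i>) ** g i) ** \<rho>0 ** dagger (u t) ** X) = - \<i> * trace (g i ** (\<rho>0 ** ?Y))"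
      by (simp only: trace_mat_mult)
    have "trace (partial_deriv i \<rho> \<theta>0 ** X) =
        \<i> * trace (g i ** (?Y ** \<rho>0)) + - \<i> * trace (g i ** (\<rho>0 ** ?Y))"
      by (simp only: deriv matrix_mult_simps trace_add 1 2)
    also have "\<dots> = - \<i> * (trace (g i ** (\<rho>0 ** ?Y)) - trace (g i ** (?Y ** \<rho>0)))"
      by (simp add: right_diff_distrib)
    finally show ?thesis
      by (simp only: mat_mult_left_commute trace_mat_mult matrix_mult_simps trace_sub
          right_diff_distrib)
  qed
  show "trace (partial_deriv i \<rho> \<theta>0) = 0"
    \<comment> \<open>The identity pulls back to the identity, whose commutator with
      \<open>\<rho>0\<close> vanishes.\<close>
    using key[of i "mat 1"] by (simp add: ut)
  show "\<exists>A. hermitian A \<and> trace A = 0 \<and>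
      (\<forall>i. trace (partial_deriv i \<rho> \<theta>0 ** X) = trace (A ** h i)) \<and>
      (\<forall>W. contraction W \<longrightarrow> Re (trace (W ** A)) \<le> 2 * t * sqrt (Re (trace (\<rho> \<theta>0 ** (X ** X)))))"
    if X: "hermitian X"
  proof -
    define Y where "Y = dagger (u t) ** X ** u t"
    define C where "C = mat (-\<i>) ** (\<rho>0 ** Y - Y ** \<rho>0)"
    have hY: "hermitian Y" using hermitian_conj[OF X, of "dagger (u t)"] by (simp add: Y_def)
    have hC: "hermitian C"
      using hY h\<rho>0 unfolding hermitian_def C_def
      by (simp add: dagger_mult dagger_diff dagger_minus matrix_mult_simps mat_mult_commute mat_minus)
    have YY: "trace (\<rho>0 ** (Y ** Y)) = trace (\<rho> \<theta>0 ** (X ** X))"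
    proof -
      have "Y ** Y = dagger (u t) ** X ** (u t ** dagger (u t)) ** X ** u t"
        unfolding Y_def by (simp only: matrix_mul_assoc)
      then have "\<rho>0 ** (Y ** Y) = (\<rho>0 ** (dagger (u t) ** (X ** X))) ** u t"
        by (simp add: ut matrix_mul_assoc)
      then have "trace (\<rho>0 ** (Y ** Y)) = trace (u t ** (\<rho>0 ** (dagger (u t) ** (X ** X))))"
        by (simp only: trace_mul_sym[of _ "u t"])
      then show ?thesis by (simp only: \<rho> u_def matrix_mul_assoc)
    qed
    define A where "A = partial_trace (Z C)"
    have "hermitian A"
      unfolding A_def by (rule hermitian_partial_trace, rule hermitian_integral[OF Z], rule hermitian_conj[OF hC])
    \<comment> \<open>The trace is the pairing with the identity; transport only multiplies the
      identity by \<open>t\<close>, and a commutator has trace zero.\<close>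
    moreover have "trace A = 0"
    proof -
      have "trace A = trace (mat 1 ** Z C)" by (simp add: A_def trace_partial_trace)
      also have "\<dots> = trace (G (mat 1) ** C)" by (rule GZ[symmetric])
      also have "G (mat 1) = t *\<^sub>R mat 1"
      proof -
        have "((\<lambda>s. mat 1) has_integral G (mat 1)) {0..t}"
          by (rule has_integral_eq[OF _ G]) (use unit in \<open>auto simp: unitary_mat_def\<close>)
        moreover have "((\<lambda>s. mat 1 :: complex^('n \<times> 'd)^('n \<times> 'd)) has_integral (t *\<^sub>R mat 1)) {0..t}"
          using has_integral_const_real[of "mat 1 :: complex^('n \<times> 'd)^('n \<times> 'd)" 0 t] t by simp
        ultimately show ?thesis using has_integral_unique by blast
      qed
      also have "trace (t *\<^sub>R mat 1 ** C) = t *\<^sub>R trace C" by (simp add: matrix_mult_simps trace_scaleR)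
      also have "trace C = 0" by (simp add: C_def trace_mat_mult trace_sub trace_mul_sym[of \<rho>0])
      finally show ?thesis by simp
    qed
    moreover have "trace (partial_deriv i \<rho> \<theta>0 ** X) = trace (A ** h i)" for i
    proof -
      have "trace (partial_deriv i \<rho> \<theta>0 ** X) = trace (?T (h i) ** Z C)"
        by (simp only: key g_def Y_def[symmetric] C_def[symmetric] GZ)
      then show ?thesis by (simp only: trace_tensor_one_mult A_def trace_mul_sym[of "h i"])
    qed
    moreover have "Re (trace (W ** A)) \<le> 2 * t * sqrt (Re (trace (\<rho> \<theta>0 ** (X ** X))))"
      if W: "contraction W" for W
    proof -
      let ?b = "2 * sqrt (Re (trace (\<rho> \<theta>0 ** (X ** X))))"
      have "((\<lambda>s. Re (trace (C ** (dagger (u s) ** ?T W ** u s)))) has_integral Re (trace (C ** G (?T W)))) {0..t}"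
        using has_integral_linear[OF trace_mult_integral[OF G] bounded_linear_Re] by (simp add: o_def)
      moreover have "((\<lambda>s. ?b) has_integral (t * ?b)) {0..t}"
        using has_integral_const_real[of ?b 0 t] t by simp
      \<comment> \<open>Only the contraction depends on \<open>s\<close>, so
        \<open>commutator_trace_bound\<close> gives the same bound at every time; integrating it
        over an interval of length \<open>t\<close> produces the factor \<open>t\<close>.\<close>
      moreover have "Re (trace (C ** (dagger (u s) ** ?T W ** u s))) \<le> ?b" if "s \<in> {0..t}" for s
      proof -
        have "contraction (dagger (u s) ** ?T W ** u s)"
          using unitary_contraction[OF unit[OF that]] W
          by (intro contraction_mult contraction_tensor_one)
        from commutator_trace_bound[OF \<rho>0 hY this] show ?thesis
          unfolding C_def YY by (simp only: trace_mul_sym[of "dagger (u s) ** ?T W ** u s"])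
      qed
      ultimately have "Re (trace (C ** G (?T W))) \<le> t * ?b" by (rule has_integral_le)
      moreover have "trace (W ** A) = trace (C ** G (?T W))"
        by (simp only: A_def trace_tensor_one_mult[symmetric] GZ[symmetric] trace_mul_sym[of C])
      ultimately show ?thesis by simp
    qed
    ultimately show ?thesis by blast
  qed
qed

section \<open>Measures induced by a POVM\<close>

text \<open>The constantly empty family is disjoint, so \<open>M {}\<close> is the term of a
  convergent constant series.\<close>

lemma povm_empty:
  assumes "povm \<Omega> M" shows "M {} = 0"
proof -
  have "(\<lambda>k::nat. M {}) sums M (\<Union>k::nat. {})"
    using assms unfolding povm_def by (auto simp: disjoint_family_on_def)
  then have "(\<lambda>k::nat. M {}) \<longlonglongrightarrow> 0"
    using sums_summable summable_LIMSEQ_zero by blast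
  then show ?thesis by (simp add: LIMSEQ_const_iff)
qed

lemma povm_union:
  assumes M: "povm \<Omega> M" and AB: "A \<in> sets \<Omega>" "B \<in> sets \<Omega>" "A \<inter> B = {}"
  shows "M (A \<union> B) = M A + M B"
proof -
  have "disjoint_family (binaryset A B)"
    using AB by (auto simp: disjoint_family_on_def binaryset_def)
  then have "(\<lambda>k. M (binaryset A B k)) sums M (A \<union> B)"
    using M AB unfolding povm_def
    by (metis UN_binaryset_eq range_binaryset_eq empty_subsetI insert_subset sets.empty_sets)
  moreover have "(\<lambda>k. M (binaryset A B k)) sums (M A + M B)"
    by (rule binaryset_sums[of M, OF povm_empty[OF M]])
  ultimately show ?thesis by (rule sums_unique2)
qed

lemma povm_finite_union:
  assumes M: "povm \<Omega> M" and "finite I" and "\<And>i. i \<in> I \<Longrightarrow> E i \<in> sets \<Omega>"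
    and "disjoint_family_on E I"
  shows "M (\<Union>i\<in>I. E i) = (\<Sum>i\<in>I. M (E i))"
  using assms(2-4)
proof (induction I rule: finite_induct)
  case empty
  then show ?case by (simp add: povm_empty[OF M])
next
  case (insert i I)
  have "M (E i \<union> (\<Union>i\<in>I. E i)) = M (E i) + M (\<Union>i\<in>I. E i)"
    using insert.prems insert.hyps
    by (intro povm_union[OF M] sets.finite_UN) (auto simp: disjoint_family_on_def)
  moreover have "M (\<Union>i\<in>I. E i) = (\<Sum>i\<in>I. M (E i))"
    using insert.prems by (intro insert.IH) (auto simp: disjoint_family_on_def)
  ultimately show ?case using insert.hyps by simp
qed

text \<open>Stated for any positive semidefinite matrix, not only for states, because it is also
  applied to the positive and negative parts of a derivative of the state.\<close>

lemma emeasure_outcome_dist: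
  assumes M: "povm \<Omega> M" and \<rho>: "psd \<rho>" and E: "E \<in> sets \<Omega>"
  shows "emeasure (outcome_dist \<Omega> M \<rho>) E = ennreal (Re (trace (\<rho> ** M E)))"
proof (rule emeasure_measure_of[OF outcome_dist_def])
  have sets: "sets (outcome_dist \<Omega> M \<rho>) = sets \<Omega>"
    by (simp add: outcome_dist_def sets.sets_measure_of_eq)
  show "sets \<Omega> \<subseteq> Pow (space \<Omega>)" by (rule sets.space_closed)
  show "E \<in> sets (outcome_dist \<Omega> M \<rho>)" using E sets by simp
  show "positive (sets (outcome_dist \<Omega> M \<rho>)) (\<lambda>E. ennreal (Re (trace (\<rho> ** M E))))"
    by (simp add: positive_def povm_empty[OF M])
  show "countably_additive (sets (outcome_dist \<Omega> M \<rho>)) (\<lambda>E. ennreal (Re (trace (\<rho> ** M E))))"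
  proof (rule countably_additiveI)
    fix A :: "nat \<Rightarrow> 'a set"
    assume A: "range A \<subseteq> sets (outcome_dist \<Omega> M \<rho>)" "disjoint_family A"
    have "(\<lambda>k. M (A k)) sums M (\<Union>k. A k)"
      using M A sets unfolding povm_def by auto
    then have "(\<lambda>k. Re (trace (\<rho> ** M (A k)))) sums Re (trace (\<rho> ** M (\<Union>k. A k)))"
      by (intro bounded_linear.sums[OF bounded_linear_Re] bounded_linear.sums[OF bounded_linear_trace]
          bounded_linear.sums[OF bounded_bilinear.bounded_linear_right[OF bounded_bilinear_matrix_mult]])
    then show "(\<Sum>k. ennreal (Re (trace (\<rho> ** M (A k))))) = ennreal (Re (trace (\<rho> ** M (\<Union>k. A k))))"
      using M A sets by (intro suminf_ennreal_eq trace_psd_mult_nonneg \<rho>) (auto simp: povm_def)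
  qed
qed

lemma space_outcome_dist [simp]: "space (outcome_dist \<Omega> M \<rho>) = space \<Omega>"
  and sets_outcome_dist [simp]: "sets (outcome_dist \<Omega> M \<rho>) = sets \<Omega>"
  by (simp_all add: outcome_dist_def)

lemma
  assumes M: "povm \<Omega> M" and \<rho>: "psd \<rho>"
  shows finite_measure_outcome_dist: "finite_measure (outcome_dist \<Omega> M \<rho>)"
    and measure_outcome_dist:
      "E \<in> sets \<Omega> \<Longrightarrow> measure (outcome_dist \<Omega> M \<rho>) E = Re (trace (\<rho> ** M E))"
proof -
  show "finite_measure (outcome_dist \<Omega> M \<rho>)"
    by (rule finite_measureI) (simp add: emeasure_outcome_dist[OF M \<rho>])
  show "measure (outcome_dist \<Omega> M \<rho>) E = Re (trace (\<rho> ** M E))" if "E \<in> sets \<Omega>"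
    using M that by (intro measure_eq_emeasure_eq_ennreal trace_psd_mult_nonneg \<rho>
        emeasure_outcome_dist) (auto simp: povm_def)
qed

section \<open>Jordan decomposition of the derivative measures\<close>

text \<open>With a Hahn set \<open>Y\<close> the supremum over subsets of \<open>E\<close> is
  attained at \<open>E \<inter> Y\<close>: dropping the part of \<open>B\<close> outside
  \<open>Y\<close> and adding the rest of \<open>E\<close> inside \<open>Y\<close> can only increase
  \<nu>. Countable additivity has to be shown as well, since \<open>measure_of\<close> otherwise
  yields the null measure.\<close>

lemma emeasure_pos_variation:
  assumes P: "finite_measure P" "sets P = sets \<Omega>" and Q: "finite_measure Q" "sets Q = sets \<Omega>"
    and \<nu>: "\<And>E. E \<in> sets \<Omega> \<Longrightarrow> \<nu> E = measure P E - measure Q E"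
    and Y: "Y \<in> sets \<Omega>" and pos: "\<And>E. E \<in> sets \<Omega> \<Longrightarrow> E \<subseteq> Y \<Longrightarrow> 0 \<le> \<nu> E"
    and neg: "\<And>E. E \<in> sets \<Omega> \<Longrightarrow> E \<inter> Y = {} \<Longrightarrow> \<nu> E \<le> 0"
    and E: "E \<in> sets \<Omega>"
  shows "emeasure (pos_variation \<Omega> \<nu>) E = ennreal (\<nu> (E \<inter> Y))"
proof -
  interpret P: finite_measure P by fact
  interpret Q: finite_measure Q by fact
  have add: "\<nu> (A \<union> B) = \<nu> A + \<nu> B" if "A \<in> sets \<Omega>" "B \<in> sets \<Omega>" "A \<inter> B = {}" for A B
    using that P.finite_measure_Union[of A B] Q.finite_measure_Union[of A B] P(2) Q(2)
    by (simp add: \<nu>)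
  have "pos_variation \<Omega> \<nu> = measure_of (space \<Omega>) (sets \<Omega>) (\<lambda>E. ennreal (\<nu> (E \<inter> Y)))"
    unfolding pos_variation_def
  proof (rule measure_of_eq[OF sets.space_closed])
    fix E assume "E \<in> sigma_sets (space \<Omega>) (sets \<Omega>)"
    then have E: "E \<in> sets \<Omega>" by (simp add: sets.sigma_sets_eq)
    show "(SUP B\<in>{B \<in> sets \<Omega>. B \<subseteq> E}. ennreal (\<nu> B)) = ennreal (\<nu> (E \<inter> Y))"
    proof (rule antisym)
      show "(SUP B\<in>{B \<in> sets \<Omega>. B \<subseteq> E}. ennreal (\<nu> B)) \<le> ennreal (\<nu> (E \<inter> Y))"
      proof (rule SUP_least)
        fix B assume "B \<in> {B \<in> sets \<Omega>. B \<subseteq> E}"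
        then have B: "B \<in> sets \<Omega>" "B \<subseteq> E" by auto
        have "B = (B \<inter> Y) \<union> (B - Y)" by auto
        then have "\<nu> B = \<nu> (B \<inter> Y) + \<nu> (B - Y)"
          using add[of "B \<inter> Y" "B - Y"] B Y by auto
        moreover have "\<nu> (B - Y) \<le> 0" using B Y by (intro neg) auto
        moreover have "E \<inter> Y = (B \<inter> Y) \<union> ((E - B) \<inter> Y)" using B by auto
        then have "\<nu> (E \<inter> Y) = \<nu> (B \<inter> Y) + \<nu> ((E - B) \<inter> Y)"
          using add[of "B \<inter> Y" "(E - B) \<inter> Y"] B Y E by auto
        moreover have "0 \<le> \<nu> ((E - B) \<inter> Y)" using B Y E by (intro pos) auto
        ultimately show "ennreal (\<nu> B) \<le> ennreal (\<nu> (E \<inter> Y))" by (intro ennreal_leI) linarith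
      qed
      show "ennreal (\<nu> (E \<inter> Y)) \<le> (SUP B\<in>{B \<in> sets \<Omega>. B \<subseteq> E}. ennreal (\<nu> B))"
        using E Y by (intro SUP_upper) auto
    qed
  qed
  then show ?thesis
  proof (rule emeasure_measure_of)
    have sets: "sets (pos_variation \<Omega> \<nu>) = sets \<Omega>"
      by (simp add: pos_variation_def)
    show "sets \<Omega> \<subseteq> Pow (space \<Omega>)" by (rule sets.space_closed)
    show "E \<in> sets (pos_variation \<Omega> \<nu>)" using E sets by simp
    show "positive (sets (pos_variation \<Omega> \<nu>)) (\<lambda>E. ennreal (\<nu> (E \<inter> Y)))"
      by (simp add: positive_def \<nu>)
    show "countably_additive (sets (pos_variation \<Omega> \<nu>)) (\<lambda>E. ennreal (\<nu> (E \<inter> Y)))"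
    proof (rule countably_additiveI)
      fix A :: "nat \<Rightarrow> 'a set"
      assume "range A \<subseteq> sets (pos_variation \<Omega> \<nu>)" "disjoint_family A"
      then have A: "A k \<inter> Y \<in> sets \<Omega>" "disjoint_family (\<lambda>k. A k \<inter> Y)" for k
        using Y sets by (auto simp: disjoint_family_on_def)
      have "(\<lambda>k. measure P (A k \<inter> Y) - measure Q (A k \<inter> Y)) sums
          (measure P (\<Union>k. A k \<inter> Y) - measure Q (\<Union>k. A k \<inter> Y))"
        using A P(2) Q(2) by (intro sums_diff P.finite_measure_UNION Q.finite_measure_UNION) auto
      moreover have "(\<Union>k. A k \<inter> Y) \<in> sets \<Omega>" using A by (intro sets.countable_UN) auto
      moreover have "(\<Union>k. A k \<inter> Y) = (\<Union>k. A k) \<inter> Y" by auto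
      ultimately have "(\<lambda>k. \<nu> (A k \<inter> Y)) sums \<nu> ((\<Union>k. A k) \<inter> Y)"
        using A(1) by (simp add: \<nu>)
      then show "(\<Sum>k. ennreal (\<nu> (A k \<inter> Y))) = ennreal (\<nu> ((\<Union>k. A k) \<inter> Y))"
        using A(1) by (intro suminf_ennreal_eq pos) auto
    qed
  qed
qed

lemma space_pos_variation [simp]: "space (pos_variation \<Omega> \<nu>) = space \<Omega>"
  and sets_pos_variation [simp]: "sets (pos_variation \<Omega> \<nu>) = sets \<Omega>"
  by (simp_all add: pos_variation_def)

text \<open>The spectral parts of \<open>D\<close> write \<nu> as a difference of two finite
  measures. These may charge the same outcomes and need not be the Jordan parts, so a Hahn set for
  the pair is still required.\<close>

lemma povm_signed_measure_decomposition:
  fixes D :: "complex^'n^'n"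
  assumes M: "povm \<Omega> M" and D: "hermitian D"
  defines "\<nu> \<equiv> \<lambda>E. Re (trace (D ** M E))"
  obtains Y where "Y \<in> sets \<Omega>"
    "\<And>E. E \<in> sets \<Omega> \<Longrightarrow> emeasure (pos_variation \<Omega> \<nu>) E = ennreal (\<nu> (E \<inter> Y))"
    "\<And>E. E \<in> sets \<Omega> \<Longrightarrow> emeasure (pos_variation \<Omega> (\<lambda>E. - \<nu> E)) E = ennreal (- \<nu> (E - Y))"
    "\<And>E. E \<in> sets \<Omega> \<Longrightarrow> 0 \<le> \<nu> (E \<inter> Y)" "\<And>E. E \<in> sets \<Omega> \<Longrightarrow> \<nu> (E - Y) \<le> 0"
proof -
  obtain S \<mu> where "onb S" and Ds: "D = spectral_sum S \<mu>" using hermitian_spectral[OF D] by blast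
  define Dp where "Dp = spectral_sum S (\<lambda>v. max 0 (\<mu> v))"
  define Dm where "Dm = spectral_sum S (\<lambda>v. max 0 (- \<mu> v))"
  have psd: "psd Dp" "psd Dm" unfolding Dp_def Dm_def by (auto intro: psd_spectral_sum)
  have DD: "D = Dp - Dm"
    unfolding Ds Dp_def Dm_def spectral_sum_def sum_subtractf[symmetric] scaleR_diff_left[symmetric]
    by (intro sum.cong) auto
  let ?P = "outcome_dist \<Omega> M Dp" and ?Q = "outcome_dist \<Omega> M Dm"
  note fin = finite_measure_outcome_dist[OF M psd(1)] finite_measure_outcome_dist[OF M psd(2)]
  interpret P: finite_measure ?P by (rule fin)
  interpret Q: finite_measure ?Q by (rule fin)
  have \<nu>: "\<nu> E = measure ?P E - measure ?Q E" if "E \<in> sets \<Omega>" for E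
    using that by (simp add: \<nu>_def measure_outcome_dist[OF M] psd DD matrix_mult_simps trace_sub)
  obtain Y where Y: "Y \<in> sets \<Omega>" and "\<forall>X\<in>sets \<Omega>. X \<subseteq> Y \<longrightarrow> emeasure ?Q X \<le> emeasure ?P X"
    "\<forall>X\<in>sets \<Omega>. X \<inter> Y = {} \<longrightarrow> emeasure ?P X \<le> emeasure ?Q X"
    using finite_unsigned_Hahn_decomposition[OF fin] by auto
  then have pos: "0 \<le> \<nu> E" if "E \<in> sets \<Omega>" "E \<subseteq> Y" for E
    using that by (auto simp: \<nu> P.emeasure_eq_measure Q.emeasure_eq_measure)
  have neg: "\<nu> E \<le> 0" if "E \<in> sets \<Omega>" "E \<inter> Y = {}" for E
    using that \<open>\<forall>X\<in>sets \<Omega>. X \<inter> Y = {} \<longrightarrow> emeasure ?P X \<le> emeasure ?Q X\<close>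
    by (auto simp: \<nu> P.emeasure_eq_measure Q.emeasure_eq_measure)
  show thesis
  proof
    show "Y \<in> sets \<Omega>" by fact
    show "emeasure (pos_variation \<Omega> \<nu>) E = ennreal (\<nu> (E \<inter> Y))" if "E \<in> sets \<Omega>" for E
      by (rule emeasure_pos_variation[OF fin(1) _ fin(2) _ \<nu> Y pos neg that]) auto
    have "emeasure (pos_variation \<Omega> (\<lambda>E. - \<nu> E)) E = ennreal (- \<nu> (E \<inter> (space \<Omega> - Y)))"
      if "E \<in> sets \<Omega>" for E
    proof (rule emeasure_pos_variation[OF fin(2) _ fin(1)])
      show "- \<nu> E = measure ?Q E - measure ?P E" if "E \<in> sets \<Omega>" for E
        using \<nu>[OF that] by simp
      show "0 \<le> - \<nu> E" if "E \<in> sets \<Omega>" "E \<subseteq> space \<Omega> - Y" for E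
        using neg[of E] that by auto
      show "- \<nu> E \<le> 0" if E: "E \<in> sets \<Omega>" "E \<inter> (space \<Omega> - Y) = {}" for E
      proof -
        have "E \<subseteq> Y" using E sets.sets_into_space[OF E(1)] by auto
        then show ?thesis using pos[of E] E by simp
      qed
    qed (use Y that in auto)
    moreover have "E \<inter> (space \<Omega> - Y) = E - Y" if "E \<in> sets \<Omega>" for E
      using sets.sets_into_space[OF that] by auto
    ultimately show "emeasure (pos_variation \<Omega> (\<lambda>E. - \<nu> E)) E = ennreal (- \<nu> (E - Y))"
      if "E \<in> sets \<Omega>" for E using that by simp
    show "0 \<le> \<nu> (E \<inter> Y)" if "E \<in> sets \<Omega>" for E using that Y by (intro pos) auto
    show "\<nu> (E - Y) \<le> 0" if "E \<in> sets \<Omega>" for E using that Y by (intro neg) auto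
  qed
qed

section \<open>Simple functions, and integration of real functions against a POVM\<close>

lemma integral_simple_function_comp:
  fixes u :: "'a \<Rightarrow> real" and \<phi> :: "real \<Rightarrow> real"
  assumes "finite_measure N" and u: "simple_function N u"
  shows "integrable N (\<lambda>x. \<phi> (u x))"
    and "integral\<^sup>L N (\<lambda>x. \<phi> (u x)) = (\<Sum>y\<in>u ` space N. \<phi> y * measure N (u -` {y} \<inter> space N))"
proof -
  interpret finite_measure N by fact
  let ?g = "\<lambda>x. \<Sum>y\<in>u ` space N. \<phi> y * indicator (u -` {y} \<inter> space N) x"
  have sets: "u -` {y} \<inter> space N \<in> sets N" for y using simple_functionD(2)[OF u] .
  have fin: "finite (u ` space N)" by (rule simple_functionD(1)[OF u])
  have eq: "\<phi> (u x) = ?g x" if "x \<in> space N" for x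
  proof -
    have "?g x = (\<Sum>y\<in>u ` space N. if y = u x then \<phi> (u x) else 0)"
      using that by (intro sum.cong) (auto simp: indicator_def)
    then show ?thesis using fin that by simp
  qed
  have int: "integrable N (\<lambda>x. \<phi> y * indicator (u -` {y} \<inter> space N) x)" for y
    using sets by (intro integrable_mult_right integrable_real_indicator) (auto simp: less_top[symmetric])
  have "integrable N ?g" using int by (intro Bochner_Integration.integrable_sum) auto
  then show "integrable N (\<lambda>x. \<phi> (u x))"
    using eq by (subst Bochner_Integration.integrable_cong[OF refl eq]) auto
  have "integral\<^sup>L N (\<lambda>x. \<phi> (u x)) = integral\<^sup>L N ?g"
    by (rule Bochner_Integration.integral_cong[OF refl eq])
  also have "\<dots> = (\<Sum>y\<in>u ` space N. \<integral>x. \<phi> y * indicator (u -` {y} \<inter> space N) x \<partial>N)"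
    using int by (intro Bochner_Integration.integral_sum) auto
  also have "\<dots> = (\<Sum>y\<in>u ` space N. \<phi> y * measure N (u -` {y} \<inter> space N))"
    by (simp add: Int_assoc)
  finally show "integral\<^sup>L N (\<lambda>x. \<phi> (u x)) = (\<Sum>y\<in>u ` space N. \<phi> y * measure N (u -` {y} \<inter> space N))" .
qed

text \<open>The pointwise bound supplies the dominating function for later limits. The 2 is what the
  approximation around the base point 0 delivers; any fixed factor would serve.\<close>

lemma simple_function_approximation:
  fixes f :: "'a \<Rightarrow> real"
  assumes "f \<in> borel_measurable N"
  obtains F where "\<And>k. simple_function N (F k)" "\<And>x. x \<in> space N \<Longrightarrow> (\<lambda>k. F k x) \<longlonglongrightarrow> f x"
    "\<And>k x. x \<in> space N \<Longrightarrow> \<bar>F k x\<bar> \<le> 2 * \<bar>f x\<bar>"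
proof -
  obtain F where F: "\<forall>k. simple_function N (F k)" "\<forall>x\<in>space N. (\<lambda>k. F k x) \<longlonglongrightarrow> f x"
    "\<forall>k. \<forall>x\<in>space N. \<bar>F k x\<bar> \<le> 2 * \<bar>f x\<bar>"
    using borel_measurable_implies_sequence_metric[OF assms, of 0] by (auto simp: dist_real_def)
  show thesis by (rule that[of F]) (use F in auto)
qed

text \<open>Fatou's lemma along simple functions; this is how square integrability with respect to the
  outcome distribution gives integrability with respect to the derivative measures.\<close>

lemma integrable_of_simple_L2_bound:
  fixes f :: "'a \<Rightarrow> real"
  assumes N: "finite_measure N" "sets N = sets P" and P: "finite_measure P"
    and f: "f \<in> borel_measurable P" and f2: "integrable P (\<lambda>x. (f x)\<^sup>2)"
    and bound: "\<And>u. simple_function P u \<Longrightarrow> (\<And>x. 0 \<le> u x) \<Longrightarrow>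
      integral\<^sup>L N u \<le> C * sqrt (integral\<^sup>L P (\<lambda>x. (u x)\<^sup>2))" and C: "0 \<le> C"
  shows "integrable N f"
proof -
  have space: "space N = space P" using N(2) by (rule sets_eq_imp_space_eq)
  note meas = measurable_cong_sets[OF N(2) refl]
  obtain F where F: "\<And>i. simple_function P (F i)" "\<And>x. x \<in> space P \<Longrightarrow> (\<lambda>i. F i x) \<longlonglongrightarrow> f x"
    and F2: "\<And>i x. x \<in> space P \<Longrightarrow> \<bar>F i x\<bar> \<le> 2 * \<bar>f x\<bar>"
    by (rule simple_function_approximation[OF f]) blast
  \<comment> \<open>The 4 is the square of the factor 2 in \<open>F2\<close>.\<close>
  define K where "K = C * sqrt (integral\<^sup>L P (\<lambda>x. 4 * (f x)\<^sup>2))"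
  have le: "(\<integral>\<^sup>+x. ennreal \<bar>F i x\<bar> \<partial>N) \<le> ennreal K" for i
  proof -
    have s: "simple_function P (\<lambda>x. \<bar>F i x\<bar>)" using simple_function_compose1[OF F(1), of abs] .
    then have sN: "simple_function N (\<lambda>x. \<bar>F i x\<bar>)"
      by (simp add: simple_function_cong_algebra[OF N(2) space])
    have "(\<integral>\<^sup>+x. ennreal \<bar>F i x\<bar> \<partial>N) = ennreal (integral\<^sup>L N (\<lambda>x. \<bar>F i x\<bar>))"
      by (intro nn_integral_eq_integral) (use integral_simple_function_comp(1)[OF N(1) sN, of "\<lambda>x. x"] in auto)
    also have "\<dots> \<le> ennreal K"
    proof (rule ennreal_leI)
      have "integral\<^sup>L N (\<lambda>x. \<bar>F i x\<bar>) \<le> C * sqrt (integral\<^sup>L P (\<lambda>x. \<bar>F i x\<bar>\<^sup>2))"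
        by (rule bound[OF s]) simp
      also have "integral\<^sup>L P (\<lambda>x. \<bar>F i x\<bar>\<^sup>2) \<le> integral\<^sup>L P (\<lambda>x. 4 * (f x)\<^sup>2)"
      proof (rule integral_mono)
        show "integrable P (\<lambda>x. \<bar>F i x\<bar>\<^sup>2)"
          by (rule integral_simple_function_comp(1)[OF P s])
        show "integrable P (\<lambda>x. 4 * (f x)\<^sup>2)" using f2 by simp
        fix x assume "x \<in> space P"
        then have "\<bar>F i x\<bar>\<^sup>2 \<le> (2 * \<bar>f x\<bar>)\<^sup>2" by (intro power_mono F2) auto
        then show "\<bar>F i x\<bar>\<^sup>2 \<le> 4 * (f x)\<^sup>2" by (simp add: power_mult_distrib)
      qed
      finally show "integral\<^sup>L N (\<lambda>x. \<bar>F i x\<bar>) \<le> K" using C by (simp add: K_def mult_left_mono)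
    qed
    finally show ?thesis .
  qed
  show ?thesis
  proof (rule integrableI_bounded)
    show "f \<in> borel_measurable N" using f by (simp only: meas)
    have "(\<integral>\<^sup>+x. ennreal (norm (f x)) \<partial>N) = (\<integral>\<^sup>+x. liminf (\<lambda>i. ennreal \<bar>F i x\<bar>) \<partial>N)"
    proof (rule nn_integral_cong)
      fix x assume "x \<in> space N"
      then have "(\<lambda>i. ennreal \<bar>F i x\<bar>) \<longlonglongrightarrow> ennreal (norm (f x))"
        unfolding space by (intro tendsto_ennrealI) (auto intro!: tendsto_rabs F)
      then show "ennreal (norm (f x)) = liminf (\<lambda>i. ennreal \<bar>F i x\<bar>)"
        by (intro lim_imp_Liminf[symmetric]) auto
    qed
    also have "\<dots> \<le> liminf (\<lambda>i. \<integral>\<^sup>+x. ennreal \<bar>F i x\<bar> \<partial>N)"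
    proof (rule nn_integral_liminf)
      fix i
      have "F i \<in> borel_measurable N" unfolding meas by (rule borel_measurable_simple_function[OF F(1)])
      then show "(\<lambda>x. ennreal \<bar>F i x\<bar>) \<in> borel_measurable N" by simp
    qed
    also have "\<dots> \<le> ennreal K" using le by (intro Liminf_le) auto
    also have "\<dots> < \<infinity>" by simp
    finally show "(\<integral>\<^sup>+x. ennreal (norm (f x)) \<partial>N) < \<infinity>" .
  qed
qed

text \<open>Meant for simple \<open>u\<close>. Summing over values and level sets avoids a choice of
  representation and exhibits the matrix as a combination of the effects of a partition of the
  outcome space.\<close>

definition povm_integral :: "'w measure \<Rightarrow> ('w set \<Rightarrow> complex^'n^'n) \<Rightarrow> ('w \<Rightarrow> real) \<Rightarrow> complex^'n^'n" where
  "povm_integral \<Omega> M u = (\<Sum>y\<in>u ` space \<Omega>. y *\<^sub>R M (u -` {y} \<inter> space \<Omega>))"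

lemma hermitian_povm_integral:
  assumes "povm \<Omega> M" "simple_function \<Omega> u" shows "hermitian (povm_integral \<Omega> M u)"
  unfolding povm_integral_def using assms simple_functionD(2)[OF assms(2)]
  by (intro hermitian_sum hermitian_scaleR) (auto simp: povm_def psd_def)

text \<open>The level sets of \<open>u\<close> partition the outcome space, so their effects form a
  finite measurement to which \<open>povm_second_moment\<close> applies.\<close>

lemma povm_integral_second_moment:
  assumes M: "povm \<Omega> M" and \<rho>: "psd \<rho>" and u: "simple_function \<Omega> u"
  shows "Re (trace (\<rho> ** (povm_integral \<Omega> M u ** povm_integral \<Omega> M u))) \<le>
    integral\<^sup>L (outcome_dist \<Omega> M \<rho>) (\<lambda>x. (u x)\<^sup>2)"
proof -
  have sets: "u -` {y} \<inter> space \<Omega> \<in> sets \<Omega>" for y using simple_functionD(2)[OF u] .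
  have "(\<Sum>y\<in>u ` space \<Omega>. M (u -` {y} \<inter> space \<Omega>)) = M (\<Union>y\<in>u ` space \<Omega>. u -` {y} \<inter> space \<Omega>)"
    using sets simple_functionD(1)[OF u]
    by (intro povm_finite_union[OF M, symmetric]) (auto simp: disjoint_family_on_def)
  also have "(\<Union>y\<in>u ` space \<Omega>. u -` {y} \<inter> space \<Omega>) = space \<Omega>" by auto
  finally have one: "(\<Sum>y\<in>u ` space \<Omega>. M (u -` {y} \<inter> space \<Omega>)) = mat 1"
    using M by (simp add: povm_def)
  have u': "simple_function (outcome_dist \<Omega> M \<rho>) u"
    using simple_function_cong_algebra[of "outcome_dist \<Omega> M \<rho>" \<Omega> u] u by simp
  have "Re (trace (\<rho> ** (povm_integral \<Omega> M u ** povm_integral \<Omega> M u))) \<le>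
      (\<Sum>y\<in>u ` space \<Omega>. y\<^sup>2 * Re (trace (\<rho> ** M (u -` {y} \<inter> space \<Omega>))))"
    by (rule povm_second_moment[OF \<rho> _ one povm_integral_def]) (use M sets in \<open>auto simp: povm_def\<close>)
  also have "\<dots> = integral\<^sup>L (outcome_dist \<Omega> M \<rho>) (\<lambda>x. (u x)\<^sup>2)"
    using integral_simple_function_comp(2)[OF finite_measure_outcome_dist[OF M \<rho>] u', of "\<lambda>x. x\<^sup>2"] sets
    by (simp add: measure_outcome_dist[OF M \<rho>])
  finally show ?thesis .
qed

text \<open>Hypothesis \<open>C\<close> bounds the difference of the integrals of a simple function
  against the two Jordan parts by its second moment under the outcome distribution. Cutting the
  function to a Hahn set or its complement isolates either part, so \<open>f\<close> is integrable
  against both, and dominated convergence applies to each.\<close>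

lemma signed_integral_povm:
  fixes D \<rho> :: "complex^'n^'n" and f :: "'w \<Rightarrow> real"
  assumes M: "povm \<Omega> M" and \<rho>: "psd \<rho>" and D: "hermitian D" and trD: "trace D = 0"
    and f: "f \<in> borel_measurable \<Omega>" and f2: "integrable (outcome_dist \<Omega> M \<rho>) (\<lambda>x. (f x)\<^sup>2)"
    and C: "\<And>X. hermitian X \<Longrightarrow> \<bar>Re (trace (D ** X))\<bar> \<le> C * sqrt (Re (trace (\<rho> ** (X ** X))))"
    and F: "\<And>k. simple_function \<Omega> (F k)" "\<And>x. x \<in> space \<Omega> \<Longrightarrow> (\<lambda>k. F k x) \<longlonglongrightarrow> f x"
    and F2: "\<And>k x. x \<in> space \<Omega> \<Longrightarrow> \<bar>F k x\<bar> \<le> 2 * \<bar>f x\<bar>"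
  shows "(\<lambda>k. Re (trace (D ** povm_integral \<Omega> M (F k)))) \<longlonglongrightarrow>
    signed_integral \<Omega> (\<lambda>E. Re (trace (D ** M E))) (\<lambda>x. f x + a)"
proof -
  define \<nu> where "\<nu> E = Re (trace (D ** M E))" for E
  obtain Y where Y: "Y \<in> sets \<Omega>"
    and ep: "\<And>E. E \<in> sets \<Omega> \<Longrightarrow> emeasure (pos_variation \<Omega> \<nu>) E = ennreal (\<nu> (E \<inter> Y))"
    and em: "\<And>E. E \<in> sets \<Omega> \<Longrightarrow> emeasure (pos_variation \<Omega> (\<lambda>E. - \<nu> E)) E = ennreal (- \<nu> (E - Y))"
    and np: "\<And>E. E \<in> sets \<Omega> \<Longrightarrow> 0 \<le> \<nu> (E \<inter> Y)" and nm: "\<And>E. E \<in> sets \<Omega> \<Longrightarrow> \<nu> (E - Y) \<le> 0"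
    using povm_signed_measure_decomposition[OF M D] unfolding \<nu>_def by blast
  define p where "p = pos_variation \<Omega> \<nu>"
  define m where "m = pos_variation \<Omega> (\<lambda>E. - \<nu> E)"
  define P where "P = outcome_dist \<Omega> M \<rho>"
  have [simp]: "space p = space \<Omega>" "space m = space \<Omega>" "space P = space \<Omega>"
    "sets p = sets \<Omega>" "sets m = sets \<Omega>" "sets P = sets \<Omega>"
    by (simp_all add: p_def m_def P_def)
  have finp: "finite_measure p" by (rule finite_measureI) (simp add: ep p_def)
  have finm: "finite_measure m" by (rule finite_measureI) (simp add: em m_def)
  have finP: "finite_measure P" unfolding P_def by (rule finite_measure_outcome_dist[OF M \<rho>])
  have mp: "measure p E = \<nu> (E \<inter> Y)" and mm: "measure m E = - \<nu> (E - Y)" if "E \<in> sets \<Omega>" for E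
    using that np[OF that] nm[OF that] ep[OF that] em[OF that]
    by (auto intro!: measure_eq_emeasure_eq_ennreal simp: p_def m_def)
  have \<nu>_split: "\<nu> E = \<nu> (E \<inter> Y) + \<nu> (E - Y)" if "E \<in> sets \<Omega>" for E
  proof -
    have "M ((E \<inter> Y) \<union> (E - Y)) = M (E \<inter> Y) + M (E - Y)"
      using that Y by (intro povm_union[OF M]) auto
    moreover have "(E \<inter> Y) \<union> (E - Y) = E" by auto
    ultimately show ?thesis by (simp add: \<nu>_def matrix_mult_simps trace_add)
  qed
  have simple: "simple_function N u" if "simple_function \<Omega> u" "sets N = sets \<Omega>" for u N
    using that simple_function_cong_algebra[OF that(2) sets_eq_imp_space_eq[OF that(2)]] by auto
  have intu: "integrable p u" "integrable m u"
    and diff: "integral\<^sup>L p u - integral\<^sup>L m u = Re (trace (D ** povm_integral \<Omega> M u))"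
    if u: "simple_function \<Omega> u" for u :: "'w \<Rightarrow> real"
  proof -
    have sets: "u -` {y} \<inter> space \<Omega> \<in> sets \<Omega>" for y using simple_functionD(2)[OF u] .
    have up: "simple_function p u" and um: "simple_function m u" using u by (auto intro: simple)
    show "integrable p u" "integrable m u"
      using integral_simple_function_comp(1)[OF finp up, of "\<lambda>x. x"]
        integral_simple_function_comp(1)[OF finm um, of "\<lambda>x. x"] by auto
    have "integral\<^sup>L p u - integral\<^sup>L m u =
        (\<Sum>y\<in>u ` space \<Omega>. y * measure p (u -` {y} \<inter> space \<Omega>)) -
        (\<Sum>y\<in>u ` space \<Omega>. y * measure m (u -` {y} \<inter> space \<Omega>))"
      using integral_simple_function_comp(2)[OF finp up, of "\<lambda>x. x"]
        integral_simple_function_comp(2)[OF finm um, of "\<lambda>x. x"] by simp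
    also have "\<dots> = (\<Sum>y\<in>u ` space \<Omega>. y * \<nu> (u -` {y} \<inter> space \<Omega>))"
      unfolding sum_subtractf[symmetric]
    proof (rule sum.cong[OF refl])
      fix y
      show "y * measure p (u -` {y} \<inter> space \<Omega>) - y * measure m (u -` {y} \<inter> space \<Omega>) =
          y * \<nu> (u -` {y} \<inter> space \<Omega>)"
        unfolding mp[OF sets] mm[OF sets] \<nu>_split[OF sets] by (simp add: algebra_simps)
    qed
    also have "\<dots> = Re (trace (D ** povm_integral \<Omega> M u))"
      by (simp add: povm_integral_def matrix_mult_sum_right matrix_mult_simps trace_sum trace_scaleR \<nu>_def)
    finally show "integral\<^sup>L p u - integral\<^sup>L m u = Re (trace (D ** povm_integral \<Omega> M u))" .
  qed
  have C0: "0 \<le> \<bar>C\<bar>" by simp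
  \<comment> \<open>The absolute value supplies the nonnegative constant that the Fatou argument
    asks for.\<close>
  have bound: "\<bar>integral\<^sup>L p u - integral\<^sup>L m u\<bar> \<le> \<bar>C\<bar> * sqrt (integral\<^sup>L P (\<lambda>x. (u x)\<^sup>2))"
    if u: "simple_function \<Omega> u" for u :: "'w \<Rightarrow> real"
  proof -
    let ?X = "povm_integral \<Omega> M u"
    have "\<bar>Re (trace (D ** ?X))\<bar> \<le> C * sqrt (Re (trace (\<rho> ** (?X ** ?X))))"
      by (rule C[OF hermitian_povm_integral[OF M u]])
    also have "\<dots> \<le> \<bar>C\<bar> * sqrt (Re (trace (\<rho> ** (?X ** ?X))))"
    proof (rule mult_right_mono)
      show "0 \<le> sqrt (Re (trace (\<rho> ** (?X ** ?X))))"
      proof -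
        have h: "dagger ?X = ?X" using hermitian_povm_integral[OF M u] by (simp add: hermitian_def)
        have "v \<bullet> ((?X ** ?X) *v v) = (?X *v v) \<bullet> (?X *v v)" for v
          by (simp add: inner_mult_left h matrix_vector_mul_assoc)
        then have "psd (?X ** ?X)" by (simp add: psd_inner hermitian_def dagger_mult h)
        then show ?thesis using trace_psd_mult_nonneg[OF \<rho>] by simp
      qed
    qed simp
    also have "\<dots> \<le> \<bar>C\<bar> * sqrt (integral\<^sup>L P (\<lambda>x. (u x)\<^sup>2))"
      unfolding P_def by (intro mult_left_mono real_sqrt_le_mono povm_integral_second_moment M \<rho> u) simp
    finally show ?thesis by (simp add: diff[OF u])
  qed
  have cut: "integral\<^sup>L P (\<lambda>x. (u x * indicator B x)\<^sup>2) \<le> integral\<^sup>L P (\<lambda>x. (u x)\<^sup>2)"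
    if u: "simple_function \<Omega> u" and B: "B \<in> sets \<Omega>" for u :: "'w \<Rightarrow> real" and B
  proof (rule integral_mono)
    have "simple_function \<Omega> (\<lambda>x. u x * indicator B x)"
      using u B by (intro simple_function_mult) auto
    then show "integrable P (\<lambda>x. (u x * indicator B x)\<^sup>2)"
      using integral_simple_function_comp(1)[OF finP simple, of _ "\<lambda>x. x\<^sup>2"] by simp
    show "integrable P (\<lambda>x. (u x)\<^sup>2)"
      using integral_simple_function_comp(1)[OF finP simple[OF u], of "\<lambda>x. x\<^sup>2"] by simp
    show "(u x * indicator B x)\<^sup>2 \<le> (u x)\<^sup>2" for x by (auto simp: indicator_def)
  qed
  have AEp: "AE x in p. x \<in> Y"
  proof (rule AE_I)
    show "{x \<in> space p. x \<notin> Y} \<subseteq> space \<Omega> - Y" by auto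
    have "emeasure p (space \<Omega> - Y) = ennreal (\<nu> ((space \<Omega> - Y) \<inter> Y))"
      unfolding p_def using Y by (intro ep) auto
    also have "(space \<Omega> - Y) \<inter> Y = {}" by auto
    finally show "emeasure p (space \<Omega> - Y) = 0" by (simp add: \<nu>_def povm_empty[OF M])
    show "space \<Omega> - Y \<in> sets p" using Y by auto
  qed
  have AEm: "AE x in m. x \<notin> Y"
  proof (rule AE_I)
    show "{x \<in> space m. \<not> x \<notin> Y} \<subseteq> Y" by auto
    have "emeasure m Y = ennreal (- \<nu> (Y - Y))"
      unfolding m_def using Y by (intro em) auto
    then show "emeasure m Y = 0" by (simp add: \<nu>_def povm_empty[OF M])
    show "Y \<in> sets m" using Y by auto
  qed
  have fP: "f \<in> borel_measurable P" using f by (simp add: measurable_cong_sets[of P \<Omega>])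
  have f2P: "integrable P (\<lambda>x. (f x)\<^sup>2)" using f2 by (simp add: P_def)
  have fp: "integrable p f"
  proof (rule integrable_of_simple_L2_bound[OF finp _ finP fP f2P _ C0])
    fix u :: "'w \<Rightarrow> real" assume "simple_function P u" "\<And>x. 0 \<le> u x"
    then have u: "simple_function \<Omega> u" using simple_function_cong_algebra[of P \<Omega> u] by simp
    \<comment> \<open>Cutting to \<open>Y\<close> removes the integral against \<open>m\<close> and
      leaves the one against \<open>p\<close> unchanged, while the second moment does not
      grow.\<close>
    let ?u = "\<lambda>x. u x * indicator Y x"
    have su: "simple_function \<Omega> ?u" using u Y by (intro simple_function_mult) auto
    have "integral\<^sup>L p ?u = integral\<^sup>L p u"
      using AEp borel_measurable_simple_function[OF simple[OF u, of p]]
        borel_measurable_simple_function[OF simple[OF su, of p]]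
      by (intro integral_cong_AE) auto
    moreover have "integral\<^sup>L m ?u = integral\<^sup>L m (\<lambda>x. 0)"
      using AEm borel_measurable_simple_function[OF simple[OF su, of m]]
      by (intro integral_cong_AE) auto
    ultimately have "integral\<^sup>L p u \<le> \<bar>C\<bar> * sqrt (integral\<^sup>L P (\<lambda>x. (?u x)\<^sup>2))"
      using bound[OF su] by simp
    also have "\<dots> \<le> \<bar>C\<bar> * sqrt (integral\<^sup>L P (\<lambda>x. (u x)\<^sup>2))"
      by (intro mult_left_mono real_sqrt_le_mono cut u Y) simp
    finally show "integral\<^sup>L p u \<le> \<bar>C\<bar> * sqrt (integral\<^sup>L P (\<lambda>x. (u x)\<^sup>2))" .
  qed simp
  have fm: "integrable m f"
  proof (rule integrable_of_simple_L2_bound[OF finm _ finP fP f2P _ C0])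
    fix u :: "'w \<Rightarrow> real" assume "simple_function P u" "\<And>x. 0 \<le> u x"
    then have u: "simple_function \<Omega> u" using simple_function_cong_algebra[of P \<Omega> u] by simp
    \<comment> \<open>The same cut with the roles of \<open>p\<close> and \<open>m\<close>
      exchanged; the sign is absorbed by the absolute value in \<open>bound\<close>.\<close>
    let ?u = "\<lambda>x. u x * indicator (space \<Omega> - Y) x"
    have Y': "space \<Omega> - Y \<in> sets \<Omega>" using Y by auto
    have su: "simple_function \<Omega> ?u" using u Y' by (intro simple_function_mult) auto
    have "integral\<^sup>L m ?u = integral\<^sup>L m u"
    proof (rule integral_cong_AE)
      show "AE x in m. ?u x = u x"
        using AEm AE_space by eventually_elim auto
    qed (use borel_measurable_simple_function[OF simple[OF u, of m]]
        borel_measurable_simple_function[OF simple[OF su, of m]] in auto)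
    moreover have "integral\<^sup>L p ?u = integral\<^sup>L p (\<lambda>x. 0)"
      using AEp borel_measurable_simple_function[OF simple[OF su, of p]]
      by (intro integral_cong_AE) auto
    ultimately have "integral\<^sup>L m u \<le> \<bar>C\<bar> * sqrt (integral\<^sup>L P (\<lambda>x. (?u x)\<^sup>2))"
      using bound[OF su] by simp
    also have "\<dots> \<le> \<bar>C\<bar> * sqrt (integral\<^sup>L P (\<lambda>x. (u x)\<^sup>2))"
      by (intro mult_left_mono real_sqrt_le_mono cut u Y') simp
    finally show "integral\<^sup>L m u \<le> \<bar>C\<bar> * sqrt (integral\<^sup>L P (\<lambda>x. (u x)\<^sup>2))" .
  qed simp
  have conv: "(\<lambda>k. integral\<^sup>L N (F k)) \<longlonglongrightarrow> integral\<^sup>L N f"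
    if "integrable N f" "sets N = sets \<Omega>" for N
  proof (rule integral_dominated_convergence)
    have space: "space N = space \<Omega>" using that(2) by (rule sets_eq_imp_space_eq)
    show "f \<in> borel_measurable N" using that by simp
    show "F k \<in> borel_measurable N" for k
      by (rule borel_measurable_simple_function[OF simple[OF F(1) that(2)]])
    show "integrable N (\<lambda>x. 2 * \<bar>f x\<bar>)" using that by simp
    show "AE x in N. (\<lambda>k. F k x) \<longlonglongrightarrow> f x" using F(2) space by (intro AE_I2) auto
    show "AE x in N. norm (F k x) \<le> 2 * \<bar>f x\<bar>" for k using F2 space by (intro AE_I2) auto
  qed
  have "(\<lambda>k. integral\<^sup>L p (F k) - integral\<^sup>L m (F k)) \<longlonglongrightarrow> integral\<^sup>L p f - integral\<^sup>L m f"
    by (intro tendsto_diff conv fp fm) auto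
  moreover have "signed_integral \<Omega> \<nu> (\<lambda>x. f x + a) = integral\<^sup>L p f - integral\<^sup>L m f"
  proof -
    interpret p: finite_measure p by (rule finp)
    interpret m: finite_measure m by (rule finm)
    \<comment> \<open>The constant \<open>a\<close> contributes \<open>a\<close> times this
      difference of total masses, which is the trace of \<open>D\<close>, that is, zero.\<close>
    have "measure p (space \<Omega>) - measure m (space \<Omega>) = \<nu> (space \<Omega>)"
      using \<nu>_split[of "space \<Omega>"] by (simp add: mp mm)
    also have "\<dots> = 0" using M trD by (simp add: \<nu>_def povm_def)
    finally have "measure p (space \<Omega>) = measure m (space \<Omega>)" by simp
    then show ?thesis
      using fp fm unfolding signed_integral_def p_def[symmetric] m_def[symmetric] by simp
  qed
  ultimately show ?thesis using F(1) unfolding \<nu>_def by (simp add: diff)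
qed

section \<open>The bound\<close>

text \<open>Centring at the mean turns the second moment into the variance, and leaves the integrals
  against the derivative measures unchanged because the derivatives of the state are traceless. The
  hypotheses keep only the directional derivatives \<open>h i\<close> of the Hamiltonian, so both
  claims of the theorem are instances.\<close>

lemma estimator_variance_bound:
  fixes \<rho> :: "real^'r::finite \<Rightarrow> complex^('n::finite \<times> 'd::finite)^('n \<times> 'd)"
    and h :: "'r \<Rightarrow> complex^'n^'n" and qest :: "'w \<Rightarrow> real"
  assumes t: "t > 0" and E: "estimation_protocol t H0 \<rho> \<Omega> M"
    and H0: "\<And>\<theta>. hermitian (H0 \<theta>)" and h: "\<And>i. hermitian (h i)"
    and d: "\<And>i. ((\<lambda>s. H0 (\<theta>0 + s *\<^sub>R axis i 1)) has_vector_derivative h i) (at 0)"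
    and adm: "admissible_estimator \<Omega> M \<rho> qest q \<theta>0"
  shows "(gamma h (gradient q \<theta>0))\<^sup>2 / t\<^sup>2 \<le> estimator_variance (outcome_dist \<Omega> M (\<rho> \<theta>0)) qest"
proof -
  define P where "P = outcome_dist \<Omega> M (\<rho> \<theta>0)"
  define a where "a = integral\<^sup>L P qest"
  define f where "f x = qest x - a" for x
  define D where "D i = partial_deriv i \<rho> \<theta>0" for i
  have M: "povm \<Omega> M" using E by (simp add: estimation_protocol_def)
  note pert = protocol_perturbation[OF t E H0 h d]
  have \<rho>: "psd (\<rho> \<theta>0)" using pert(1) by (simp add: density_matrix_def)
  have f: "f \<in> borel_measurable \<Omega>" and f2: "integrable P (\<lambda>x. (f x)\<^sup>2)"
    using adm unfolding admissible_estimator_def has_finite_variance_def f_def a_def P_def by auto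
  have var: "estimator_variance P qest = integral\<^sup>L P (\<lambda>x. (f x)\<^sup>2)"
    by (simp add: estimator_variance_def f_def a_def)
  obtain F where F: "\<And>k. simple_function \<Omega> (F k)" "\<And>x. x \<in> space \<Omega> \<Longrightarrow> (\<lambda>k. F k x) \<longlonglongrightarrow> f x"
    and F2: "\<And>k x. x \<in> space \<Omega> \<Longrightarrow> \<bar>F k x\<bar> \<le> 2 * \<bar>f x\<bar>"
    by (rule simple_function_approximation[OF f]) blast
  define X where "X k = povm_integral \<Omega> M (F k)" for k
  define c where "c k = integral\<^sup>L P (\<lambda>x. (F k x)\<^sup>2)" for k
  have hX: "hermitian (X k)" for k unfolding X_def by (rule hermitian_povm_integral[OF M F(1)])
  have Xc: "Re (trace (\<rho> \<theta>0 ** (X k ** X k))) \<le> c k" for k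
    unfolding X_def c_def P_def by (rule povm_integral_second_moment[OF M \<rho> F(1)])
  have c: "c \<longlonglongrightarrow> integral\<^sup>L P (\<lambda>x. (f x)\<^sup>2)"
    unfolding c_def
  proof (rule integral_dominated_convergence)
    show "(\<lambda>x. (f x)\<^sup>2) \<in> borel_measurable P" using f2 by simp
    have "F k \<in> borel_measurable P" for k
      using borel_measurable_simple_function[OF F(1)[of k]]
      by (simp add: P_def measurable_cong_sets[of "outcome_dist \<Omega> M (\<rho> \<theta>0)" \<Omega>])
    then show "(\<lambda>x. (F k x)\<^sup>2) \<in> borel_measurable P" for k by simp
    show "integrable P (\<lambda>x. 4 * (f x)\<^sup>2)" using f2 by simp
    show "AE x in P. (\<lambda>k. (F k x)\<^sup>2) \<longlonglongrightarrow> (f x)\<^sup>2"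
      by (intro AE_I2 tendsto_power F) (simp add: P_def)
    show "AE x in P. norm ((F k x)\<^sup>2) \<le> 4 * (f x)\<^sup>2" for k
    proof (rule AE_I2)
      fix x assume "x \<in> space P"
      then have "\<bar>F k x\<bar>\<^sup>2 \<le> (2 * \<bar>f x\<bar>)\<^sup>2" by (intro power_mono F2) (auto simp: P_def)
      then show "norm ((F k x)\<^sup>2) \<le> 4 * (f x)\<^sup>2" by (simp add: power_mult_distrib)
    qed
  qed
  \<comment> \<open>This crude constant serves only integrability and convergence for each
    \<open>i\<close>; the final estimate rests on \<open>AW\<close>.\<close>
  have bound: "\<bar>Re (trace (D i ** X))\<bar> \<le> (2 * t * norm (h i)) * sqrt (Re (trace (\<rho> \<theta>0 ** (X ** X))))"
    if "hermitian X" for i X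
  proof -
    obtain A where A: "hermitian A" "\<forall>i. trace (partial_deriv i \<rho> \<theta>0 ** X) = trace (A ** h i)"
      "\<forall>W. contraction W \<longrightarrow> Re (trace (W ** A)) \<le> 2 * t * sqrt (Re (trace (\<rho> \<theta>0 ** (X ** X))))"
      using pert(4)[OF \<open>hermitian X\<close>] by blast
    have "\<bar>Re (trace (D i ** X))\<bar> = \<bar>A \<bullet> h i\<bar>"
      using A(1) A(2) by (simp add: D_def inner_matrix hermitian_def)
    also have "\<dots> \<le> norm A * norm (h i)" by (rule Cauchy_Schwarz_ineq2)
    also have "\<dots> \<le> (2 * t * sqrt (Re (trace (\<rho> \<theta>0 ** (X ** X))))) * norm (h i)"
      using A(3) by (intro mult_right_mono norm_le_contraction_bound[OF A(1)]) auto
    finally show ?thesis by (simp add: mult_ac)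
  qed
  have lim: "(\<lambda>k. Re (trace (D i ** X k))) \<longlonglongrightarrow> gradient q \<theta>0 $ i" for i
  proof -
    have "(\<lambda>k. Re (trace (D i ** X k))) \<longlonglongrightarrow>
        signed_integral \<Omega> (\<lambda>E. Re (trace (D i ** M E))) (\<lambda>x. f x + a)"
      unfolding X_def
      by (rule signed_integral_povm[OF M \<rho> _ _ f _ bound F F2]) (use f2 pert in \<open>auto simp: D_def P_def\<close>)
    also have "(\<lambda>x. f x + a) = qest" by (simp add: f_def)
    also have "signed_integral \<Omega> (\<lambda>E. Re (trace (D i ** M E))) qest = gradient q \<theta>0 $ i"
      using adm by (simp add: admissible_estimator_def locally_unbiased_def D_def gradient_def)
    finally show ?thesis .
  qed
  have "\<forall>k. \<exists>A. hermitian A \<and> trace A = 0 \<and> (\<forall>i. trace (D i ** X k) = trace (A ** h i)) \<and>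
      (\<forall>W. contraction W \<longrightarrow> Re (trace (W ** A)) \<le> 2 * t * sqrt (Re (trace (\<rho> \<theta>0 ** (X k ** X k)))))"
    unfolding D_def using pert(4)[OF hX] by blast
  then obtain A where A: "\<And>k. hermitian (A k)" "\<And>k. trace (A k) = 0"
      "\<And>k i. trace (D i ** X k) = trace (A k ** h i)"
    and AW: "\<And>k W. contraction W \<Longrightarrow> Re (trace (W ** A k)) \<le> 2 * t * sqrt (Re (trace (\<rho> \<theta>0 ** (X k ** X k))))"
    by metis
  obtain B where B: "hermitian B" "\<And>i. trace (B ** h i) = complex_of_real (gradient q \<theta>0 $ i)" "trace B = 0"
    and Bn: "trace_norm B \<le> 2 * t * sqrt (integral\<^sup>L P (\<lambda>x. (f x)\<^sup>2))"
  proof (rule feasible_limit[OF A(1,2)])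
    fix i
    \<comment> \<open>The trace of a product of two Hermitian matrices is real, so the limits of the
      real parts settle the complex constraints.\<close>
    have "trace (A k ** h i) = complex_of_real (Re (trace (D i ** X k)))" for k
      using hermitian_trace_mult_real[OF A(1) h] A(3) by metis
    then show "(\<lambda>k. trace (A k ** h i)) \<longlonglongrightarrow> complex_of_real (gradient q \<theta>0 $ i)"
      using tendsto_of_real[OF lim[of i]] by simp
  next
    fix k and W :: "complex^'n^'n" assume "contraction W"
    then have "Re (trace (W ** A k)) \<le> 2 * t * sqrt (Re (trace (\<rho> \<theta>0 ** (X k ** X k))))" by (rule AW)
    also have "\<dots> \<le> 2 * t * sqrt (c k)"
      using t by (intro mult_left_mono real_sqrt_le_mono Xc) auto
    finally show "Re (trace (W ** A k)) \<le> 2 * t * sqrt (c k)" .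
  next
    show "(\<lambda>k. 2 * t * sqrt (c k)) \<longlonglongrightarrow> 2 * t * sqrt (integral\<^sup>L P (\<lambda>x. (f x)\<^sup>2))"
      by (intro tendsto_mult tendsto_const tendsto_real_sqrt c)
  qed blast
  let ?\<gamma> = "gamma h (gradient q \<theta>0)"
  have "0 \<le> ?\<gamma>" "?\<gamma> \<le> trace_norm B / 2" using gamma_le[OF B] by auto
  \<comment> \<open>Here the 1/2 in \<open>gamma\<close> cancels the 2 of the commutator bound.
    Nonnegativity is recorded because the inequality is squared next.\<close>
  then have "0 \<le> ?\<gamma>" "?\<gamma> \<le> t * sqrt (integral\<^sup>L P (\<lambda>x. (f x)\<^sup>2))" using Bn by auto
  then have "?\<gamma>\<^sup>2 \<le> (t * sqrt (integral\<^sup>L P (\<lambda>x. (f x)\<^sup>2)))\<^sup>2" by (intro power_mono) auto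
  also have "\<dots> = t\<^sup>2 * integral\<^sup>L P (\<lambda>x. (f x)\<^sup>2)"
    by (simp add: power_mult_distrib integral_nonneg_AE)
  finally show ?thesis
    using t unfolding P_def[symmetric] var by (simp add: divide_le_eq mult.commute)
qed

section \<open>Parameter derivatives of the Hamiltonian and the two claims\<close>

text \<open>\<open>vector_derivative\<close> is a choice operator and says nothing unless a
  derivative exists; differentiability of \<open>f\<close> composed with a line supplies it.\<close>

lemma partial_deriv_works:
  assumes "twice_continuously_differentiable f"
  shows "((\<lambda>s. f (x + s *\<^sub>R axis i 1)) has_vector_derivative partial_deriv i f x) (at 0)"
proof -
  obtain f' where "(f has_derivative blinfun_apply (f' x)) (at x)"
    using assms unfolding twice_continuously_differentiable_def by blast
  then have f: "(f has_derivative blinfun_apply (f' x)) (at (x + 0 *\<^sub>R axis i 1))" by simp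
  have "((\<lambda>s. x + s *\<^sub>R axis i 1) has_derivative (\<lambda>s. s *\<^sub>R axis i 1)) (at 0)"
    by (auto intro!: derivative_eq_intros)
  from has_derivative_compose[OF this f]
  have "(\<lambda>s. f (x + s *\<^sub>R axis i 1)) differentiable (at 0)"
    by (rule differentiableI)
  then show ?thesis
    unfolding partial_deriv_def by (simp add: vector_derivative_works)
qed

lemma gradient_inner: "gradient (\<lambda>\<theta>. \<alpha> \<bullet> \<theta>) x = \<alpha>"
proof -
  have "partial_deriv i (\<lambda>\<theta>. \<alpha> \<bullet> \<theta>) x = \<alpha> $ i" for i
    unfolding partial_deriv_def
    by (rule vector_derivative_at) (auto intro!: derivative_eq_intros
        simp: inner_add_right inner_axis has_vector_derivative_def)
  then show ?thesis by (simp add: gradient_def vec_eq_iff)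
qed

theorem mainTheorem1:
  fixes g :: "'m::finite \<Rightarrow> complex^'n::finite^'n"
    and t :: real
  assumes g_herm: "\<And>j. hermitian (g j)"
    and g_traceless: "\<And>j. trace (g j) = 0"
    and g_indep: "inj g" "independent (range g)"
    and t_pos: "t > 0"
  shows
    "(\<forall>(f :: 'm \<Rightarrow> real^'r::finite \<Rightarrow> real) (q :: real^'r \<Rightarrow> real) (\<theta>0 :: real^'r)
        (\<rho> :: real^'r \<Rightarrow> complex^('n \<times> 'd::finite)^('n \<times> 'd))
        (\<Omega> :: 'w measure) M (qest :: 'w \<Rightarrow> real).
        CARD('r) \<le> CARD('m) \<and>
        (\<forall>j. twice_continuously_differentiable (f j)) \<and>
        twice_continuously_differentiable q \<and>
        gradient q \<theta>0 \<noteq> 0 \<and>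
        rank (jacobian_mat f \<theta>0) = CARD('r) \<and>
        estimation_protocol t (\<lambda>\<theta>. \<Sum>j\<in>UNIV. f j \<theta> *\<^sub>R g j) \<rho> \<Omega> M \<and>
        admissible_estimator \<Omega> M \<rho> qest q \<theta>0
        \<longrightarrow> estimator_variance (outcome_dist \<Omega> M (\<rho> \<theta>0)) qest
            \<ge> (gamma (\<lambda>i. \<Sum>j\<in>UNIV. jacobian_mat f \<theta>0 $ i $ j *\<^sub>R g j) (gradient q \<theta>0))\<^sup>2 / t\<^sup>2)
     \<and>
     (\<forall>(\<alpha> :: real^'m) (\<theta>0 :: real^'m)
        (\<rho> :: real^'m \<Rightarrow> complex^('n \<times> 'd)^('n \<times> 'd))
        (\<Omega> :: 'w measure) M (qest :: 'w \<Rightarrow> real).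
        \<alpha> \<noteq> 0 \<and>
        estimation_protocol t (\<lambda>\<theta>. \<Sum>j\<in>UNIV. (\<theta> $ j) *\<^sub>R g j) \<rho> \<Omega> M \<and>
        admissible_estimator \<Omega> M \<rho> qest (\<lambda>\<theta>. \<alpha> \<bullet> \<theta>) \<theta>0
        \<longrightarrow> estimator_variance (outcome_dist \<Omega> M (\<rho> \<theta>0)) qest \<ge> (gamma g \<alpha>)\<^sup>2 / t\<^sup>2)"
proof (intro conjI allI impI; (elim conjE)?)
  fix f :: "'m \<Rightarrow> real^'r \<Rightarrow> real" and q :: "real^'r \<Rightarrow> real" and \<theta>0 :: "real^'r"
    and \<rho> :: "real^'r \<Rightarrow> complex^('n \<times> 'd)^('n \<times> 'd)" and \<Omega> :: "'w measure" and M and qest :: "'w \<Rightarrow> real"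
  assume f: "\<forall>j. twice_continuously_differentiable (f j)"
    and E: "estimation_protocol t (\<lambda>\<theta>. \<Sum>j\<in>UNIV. f j \<theta> *\<^sub>R g j) \<rho> \<Omega> M"
    and adm: "admissible_estimator \<Omega> M \<rho> qest q \<theta>0"
  show "estimator_variance (outcome_dist \<Omega> M (\<rho> \<theta>0)) qest
    \<ge> (gamma (\<lambda>i. \<Sum>j\<in>UNIV. jacobian_mat f \<theta>0 $ i $ j *\<^sub>R g j) (gradient q \<theta>0))\<^sup>2 / t\<^sup>2"
  proof (rule estimator_variance_bound[OF t_pos E _ _ _ adm])
    show "((\<lambda>s. \<Sum>j\<in>UNIV. f j (\<theta>0 + s *\<^sub>R axis i 1) *\<^sub>R g j) has_vector_derivative
        (\<Sum>j\<in>UNIV. jacobian_mat f \<theta>0 $ i $ j *\<^sub>R g j)) (at 0)" for i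
      using f by (intro has_vector_derivative_sum bounded_linear.has_vector_derivative[OF
            bounded_linear_scaleR_left]) (simp add: jacobian_mat_def partial_deriv_works)
  qed (intro hermitian_sum hermitian_scaleR g_herm)+
next
  fix \<alpha> \<theta>0 :: "real^'m"
    and \<rho> :: "real^'m \<Rightarrow> complex^('n \<times> 'd)^('n \<times> 'd)" and \<Omega> :: "'w measure" and M and qest :: "'w \<Rightarrow> real"
  assume E: "estimation_protocol t (\<lambda>\<theta>. \<Sum>j\<in>UNIV. (\<theta> $ j) *\<^sub>R g j) \<rho> \<Omega> M"
    and adm: "admissible_estimator \<Omega> M \<rho> qest (\<lambda>\<theta>. \<alpha> \<bullet> \<theta>) \<theta>0"
  have "(gamma g (gradient (\<lambda>\<theta>. \<alpha> \<bullet> \<theta>) \<theta>0))\<^sup>2 / t\<^sup>2 \<le>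
      estimator_variance (outcome_dist \<Omega> M (\<rho> \<theta>0)) qest"
  \<comment> \<open>The Hamiltonian is affine along each axis with slope \<open>g i\<close>, so the
    bound applies to \<open>g\<close> itself without evaluating a Jacobian.\<close>
  proof (rule estimator_variance_bound[OF t_pos E _ g_herm _ adm])
    show "((\<lambda>s. \<Sum>j\<in>UNIV. ((\<theta>0 + s *\<^sub>R axis i 1) $ j) *\<^sub>R g j) has_vector_derivative g i) (at 0)" for i
    proof -
      have "(\<Sum>j\<in>UNIV. ((\<theta>0 + s *\<^sub>R axis i 1) $ j) *\<^sub>R g j) = (\<Sum>j\<in>UNIV. (\<theta>0 $ j) *\<^sub>R g j) + s *\<^sub>R g i" for s
      proof -
        have "(\<Sum>j\<in>UNIV. ((\<theta>0 + s *\<^sub>R axis i 1) $ j) *\<^sub>R g j) =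
            (\<Sum>j\<in>UNIV. (\<theta>0 $ j) *\<^sub>R g j + (if j = i then s *\<^sub>R g i else 0))"
          by (rule sum.cong) (auto simp: axis_def scaleR_add_left)
        then show ?thesis by (simp add: sum.distrib)
      qed
      then show ?thesis by (auto intro!: derivative_eq_intros simp: has_vector_derivative_def)
    qed
  qed (intro hermitian_sum hermitian_scaleR g_herm)
  then show "estimator_variance (outcome_dist \<Omega> M (\<rho> \<theta>0)) qest \<ge> (gamma g \<alpha>)\<^sup>2 / t\<^sup>2"
    by (simp only: gradient_inner)
qed

end
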